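(* For the probing version of minimum makespan scheduling on $m$ identical machines: (a) property (P2) holds with $\rho=1$; (b) there is a polynomial-time algorithm that outputs a set $S$ with $\sum_{i\in S}c_i\le C$ whose outlier objective is at most $O(1)\cdot\mathcal{G}^*(C)$; (c) there is a polynomial-time algorithm that, given a probed set $S$ and observed sizes $\mathbf{v}_S$, computes an assignment whose expected makespan (over unprobed sizes) is at most $O(1)$ times $\min_o\mathbb{E}_{\mathbf{v}_{\bar S}}[h(o;\mathbf{v}_S,\mathbf{v}_{\bar S})]$. Consequently, the non-adaptive strategy that probes $S$ from (b) and uses the assignment from (c) has probing cost at most $C$ and expected makespan at most $O(1)\cdot OPT_h$.
   Context: There are $m$ identical machines and $n$ jobs; the size of job $i$ is an independent nonnegative random variable $X_i$ with a discrete distribution given explicitly as input; probing job $i$ costs $c_i\ge0$ and reveals its size; $C\ge\max_i c_i$ is the budget. For a set $A$ of jobs, a solution $o\in\mathcal{O}_A$ is an assignment of the jobs of $A$ to machines and $h_A(o;\mathbf{v}_A)$ is the makespan (maximum over machines of the total size of jobs assigned to it) under sizes $\mathbf{v}_A$; $h=h_{[n]}$, $\mathcal{O}=\mathcal{O}_{[n]}$. After probing a set $S$ with outcome $\mathbf{v}_S$, an assignment of all jobs is chosen before unprobed sizes are realized; its value is the expected makespan. An adaptive policy is a decision tree of probes with value equal to the expected value at its leaves, where the leaf value is $\min_o\mathbb{E}_{\mathbf{v}_{\bar S}}[h(o;\mathbf{v}_S,\mathbf{v}_{\bar S})]$; $OPT_h$ is the minimum value over adaptive policies with probing cost at most $C$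 on every path. (P2) with constant $\rho$: for all $A$ and $\mathbf{v}_A$, $\min_{o}\mathbb{E}[h(o;\mathbf{v}_A,\mathbf{v}_{\bar A})]\le\rho\big(\min_{o\in\mathcal{O}_A}h_A(o;\mathbf{v}_A)+\min_{o\in\mathcal{O}_{\bar A}}\mathbb{E}[h_{\bar A}(o;\mathbf{v}_{\bar A})]+\mathbb{E}[\min_o h(o;\mathbf{v}_A,\mathbf{v}_{\bar A})]\big)$. Outlier problem: $\mathcal{G}^*(C)$ is the minimum over $S$ with $\sum_{i\in S}c_i\le C$ of the outlier objective $\min_{o\in\mathcal{O}_{\bar S}}\mathbb{E}[h_{\bar S}(o;\mathbf{v}_{\bar S})]$ (optimal expected makespan of the jobs not in $S$, with no probing). *)

theory Defs
  imports "HOL-Probability.Probability" "HOL-Library.Log_Nat"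
begin

text \<open>
  Programs act on finite trees whose leaves are natural numbers in binary. The cost is
  logarithmic: every elementary step pays for the total bit size of the data it reads and writes
  (or copies), so that each step can be simulated by a Turing machine in time polynomial in its
  cost, and vice versa.  Polynomial time in this model therefore is the usual notion.
\<close>

datatype val = VNum nat | VPair val val

primrec vsize :: "val \<Rightarrow> nat" where
  "vsize (VNum n) = 1 + floorlog 2 n"
| "vsize (VPair u v) = 1 + vsize u + vsize v"

datatype prim = Ident | Const nat | First | Second | IsNum | Plus | Minus | Times | Div | Leq

text \<open>Ill-typed applications return \<open>VNum 0\<close>, and \<open>VNum 0\<close> is the truth value ``false''.\<close>

fun apply_prim :: "prim \<Rightarrow> val \<Rightarrow> val" where
  "apply_prim Ident v = v"
| "apply_prim (Const k) v = VNum k"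
| "apply_prim First (VPair u v) = u"
| "apply_prim Second (VPair u v) = v"
| "apply_prim IsNum (VNum n) = VNum 1"
| "apply_prim Plus (VPair (VNum a) (VNum b)) = VNum (a + b)"
| "apply_prim Minus (VPair (VNum a) (VNum b)) = VNum (a - b)"
| "apply_prim Times (VPair (VNum a) (VNum b)) = VNum (a * b)"
| "apply_prim Div (VPair (VNum a) (VNum b)) = VNum (a div b)"
| "apply_prim Leq (VPair (VNum a) (VNum b)) = VNum (if a \<le> b then 1 else 0)"
| "apply_prim _ _ = VNum 0"

datatype prog =
    Prim prim
  | Then prog prog
  | Fork prog prog
  | Branch prog prog prog
  | Loop prog prog

text \<open>\<open>exec p u v t\<close>: on input \<open>u\<close>, program \<open>p\<close> halts with output \<open>v\<close> after time \<open>t\<close>.\<close>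

inductive exec :: "prog \<Rightarrow> val \<Rightarrow> val \<Rightarrow> nat \<Rightarrow> bool" where
  exec_Prim: "exec (Prim f) u (apply_prim f u) (vsize u + vsize (apply_prim f u))"
| exec_Then: "exec p u v s \<Longrightarrow> exec q v w t \<Longrightarrow> exec (Then p q) u w (s + t)"
| exec_Fork: "exec p u v s \<Longrightarrow> exec q u w t \<Longrightarrow> exec (Fork p q) u (VPair v w) (vsize u + s + t)"
| exec_Branch_True: "exec b u x r \<Longrightarrow> x \<noteq> VNum 0 \<Longrightarrow> exec p u v s
    \<Longrightarrow> exec (Branch b p q) u v (vsize u + r + s)"
| exec_Branch_False: "exec b u (VNum 0) r \<Longrightarrow> exec q u v s
    \<Longrightarrow> exec (Branch b p q) u v (vsize u + r + s)"
| exec_Loop_Stop: "exec b u (VNum 0) r \<Longrightarrow> exec (Loop b p) u u (vsize u + r)"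
| exec_Loop_Step: "exec b u x r \<Longrightarrow> x \<noteq> VNum 0 \<Longrightarrow> exec p u v s \<Longrightarrow> exec (Loop b p) v w t
    \<Longrightarrow> exec (Loop b p) u w (vsize u + r + s + t)"

inductive_cases exec_PrimE: "exec (Prim f) u v t"
inductive_cases exec_ThenE: "exec (Then p q) u v t"
inductive_cases exec_ForkE: "exec (Fork p q) u v t"
inductive_cases exec_BranchE: "exec (Branch b p q) u v t"
inductive_cases exec_LoopE: "exec (Loop b p) u v t"

lemma exec_deterministic:
  "exec p u v t \<Longrightarrow> exec p u v' t' \<Longrightarrow> v' = v \<and> t' = t"
proof (induction arbitrary: v' t' rule: exec.induct)
  case (exec_Prim f u)
  then show ?case by (auto elim: exec_PrimE)
next
  case (exec_Then p u v s q w t)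
  from exec_Then.prems show ?case
    by (rule exec_ThenE) (use exec_Then.IH in blast)
next
  case (exec_Fork p u v s q w t)
  from exec_Fork.prems show ?case
    by (rule exec_ForkE) (use exec_Fork.IH in blast)
next
  case (exec_Branch_True b u x r p v s q)
  from exec_Branch_True.prems show ?case
    by (rule exec_BranchE) (use exec_Branch_True.IH exec_Branch_True.hyps in blast)+
next
  case (exec_Branch_False b u r q v s p)
  from exec_Branch_False.prems show ?case
    by (rule exec_BranchE) (use exec_Branch_False.IH in blast)+
next
  case (exec_Loop_Stop b u r p)
  from exec_Loop_Stop.prems show ?case
    by (rule exec_LoopE) (use exec_Loop_Stop.IH in blast)+
next
  case (exec_Loop_Step b u x r p v s w t)
  from exec_Loop_Step.prems show ?case
    by (rule exec_LoopE) (use exec_Loop_Step.IH exec_Loop_Step.hyps in blast)+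
qed

definition polytime_on :: "'a set \<Rightarrow> ('a \<Rightarrow> val) \<Rightarrow> ('a \<Rightarrow> val) \<Rightarrow> bool" where
  "polytime_on D inp out \<longleftrightarrow>
    (\<exists>p k. \<forall>x\<in>D. \<exists>t. exec p (inp x) (out x) t \<and> t \<le> k * vsize (inp x) ^ k)"

definition enc_list :: "('a \<Rightarrow> val) \<Rightarrow> 'a list \<Rightarrow> val" where
  "enc_list e xs = foldr (\<lambda>x. VPair (e x)) xs (VNum 0)"

text \<open>Only used for nonnegative rational \<open>x\<close>: numerator and denominator in lowest terms.\<close>

definition enc_rat :: "real \<Rightarrow> val" where
  "enc_rat x = (let (a, b) = quotient_of (THE q. of_rat q = x) in VPair (VNum (nat a)) (VNum (nat b)))"

text \<open>
  Jobs are numbered from \<open>0\<close>.  A job consists of its probing cost and the explicit list of the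
  pairs (size, probability) of its size distribution.
\<close>

record sched =
  machines :: nat
  jobs :: "(real \<times> (real \<times> real) list) list"
  budget :: real

abbreviation job_set :: "sched \<Rightarrow> nat set" where
  "job_set I \<equiv> {..<length (jobs I)}"

definition job_cost :: "sched \<Rightarrow> nat \<Rightarrow> real" where
  "job_cost I i = fst (jobs I ! i)"

definition job_size :: "sched \<Rightarrow> nat \<Rightarrow> real pmf" where
  "job_size I i = pmf_of_list (snd (jobs I ! i))"

text \<open>The condition \<open>0 \<le> budget I\<close> only matters if there are no jobs.\<close>

definition valid :: "sched \<Rightarrow> bool" where
  "valid I \<longleftrightarrow> 0 < machines I \<and> 0 \<le> budget I \<and>
    (\<forall>(c, d)\<in>set (jobs I). 0 \<le> c \<and> c \<le> budget I \<and>
       pmf_of_list_wf d \<and> (\<forall>(x, p)\<in>set d. 0 \<le> x))"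

definition rational :: "sched \<Rightarrow> bool" where
  "rational I \<longleftrightarrow> budget I \<in> \<rat> \<and>
    (\<forall>(c, d)\<in>set (jobs I). c \<in> \<rat> \<and> (\<forall>(x, p)\<in>set d. x \<in> \<rat> \<and> p \<in> \<rat>))"

definition probing_cost :: "sched \<Rightarrow> nat set \<Rightarrow> real" where
  "probing_cost I S = (\<Sum>i\<in>S. job_cost I i)"

text \<open>Independence is built in as a product law; coordinates outside \<open>A\<close> are \<open>0\<close>.\<close>

definition sizes :: "sched \<Rightarrow> nat set \<Rightarrow> (nat \<Rightarrow> real) pmf" where
  "sizes I A = Pi_pmf A 0 (job_size I)"

definition assignments :: "sched \<Rightarrow> nat set \<Rightarrow> (nat \<Rightarrow> nat) set" where
  "assignments I A = A \<rightarrow>\<^sub>E {..<machines I}"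

definition makespan :: "sched \<Rightarrow> nat set \<Rightarrow> (nat \<Rightarrow> nat) \<Rightarrow> (nat \<Rightarrow> real) \<Rightarrow> real" where
  "makespan I A a v = (MAX k\<in>{..<machines I}. \<Sum>i\<in>{i\<in>A. a i = k}. v i)"

text \<open>Only the values of \<open>v\<close> on the probed set \<open>S\<close> matter.\<close>

definition expected_makespan :: "sched \<Rightarrow> nat set \<Rightarrow> (nat \<Rightarrow> real) \<Rightarrow> (nat \<Rightarrow> nat) \<Rightarrow> real" where
  "expected_makespan I S v a =
    measure_pmf.expectation (sizes I (job_set I - S))
      (\<lambda>w. makespan I (job_set I) a (override_on w v S))"

definition best_value :: "sched \<Rightarrow> nat set \<Rightarrow> (nat \<Rightarrow> real) \<Rightarrow> real" where
  "best_value I S v = (MIN a\<in>assignments I (job_set I). expected_makespan I S v a)"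

definition outlier_value :: "sched \<Rightarrow> nat set \<Rightarrow> real" where
  "outlier_value I S =
    (MIN a\<in>assignments I (job_set I - S).
       measure_pmf.expectation (sizes I (job_set I - S)) (makespan I (job_set I - S) a))"

definition outlier_opt :: "sched \<Rightarrow> real" where
  "outlier_opt I =
    (MIN S\<in>{S. S \<subseteq> job_set I \<and> probing_cost I S \<le> budget I}. outlier_value I S)"

definition P2 :: "sched \<Rightarrow> real \<Rightarrow> bool" where
  "P2 I \<rho> \<longleftrightarrow> (\<forall>A v. A \<subseteq> job_set I \<longrightarrow> (\<forall>i\<in>A. 0 \<le> v i) \<longrightarrow>
    best_value I A v \<le>
      \<rho> * ((MIN a\<in>assignments I A. makespan I A a v)
         + outlier_value I A
         + measure_pmf.expectation (sizes I (job_set I - A))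
             (\<lambda>w. MIN a\<in>assignments I (job_set I). makespan I (job_set I) a (override_on w v A))))"

text \<open>
  Decision trees: \<open>Probe i T\<close> probes job \<open>i\<close> and continues with \<open>T x\<close> if its size is found to be
  \<open>x\<close>.  A realization \<open>v\<close> of all sizes determines a root-leaf path; \<open>probed T v\<close> is the
  set of jobs probed on it.  (Probing a job again on the same path reveals nothing new and is
  counted once.)
\<close>

datatype policy = Stop | Probe nat "real \<Rightarrow> policy"

primrec probed :: "policy \<Rightarrow> (nat \<Rightarrow> real) \<Rightarrow> nat set" where
  "probed Stop v = {}"
| "probed (Probe i T) v = insert i (probed (T (v i)) v)"

definition policies :: "sched \<Rightarrow> policy set" where
  "policies I = {T. \<forall>v\<in>set_pmf (sizes I (job_set I)).
     probed T v \<subseteq> job_set I \<and> probing_cost I (probed T v) \<le> budget I}"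

definition policy_value :: "sched \<Rightarrow> policy \<Rightarrow> real" where
  "policy_value I T =
    measure_pmf.expectation (sizes I (job_set I)) (\<lambda>v. best_value I (probed T v) v)"

text \<open>
  The infimum is a minimum: sizes have finite support, so policies take only finitely many values.
\<close>

definition OPT :: "sched \<Rightarrow> real" where
  "OPT I = (INF T\<in>policies I. policy_value I T)"

definition nonadaptive_value :: "sched \<Rightarrow> nat set \<Rightarrow> ((nat \<Rightarrow> real) \<Rightarrow> nat \<Rightarrow> nat) \<Rightarrow> real" where
  "nonadaptive_value I S a =
    measure_pmf.expectation (sizes I S) (\<lambda>v. expected_makespan I S v (a v))"

definition enc_sched :: "sched \<Rightarrow> val" where
  "enc_sched I =
    VPair (VNum (machines I)) (VPair (enc_rat (budget I))
      (enc_list (\<lambda>(c, d). VPair (enc_rat c) (enc_list (\<lambda>(x, p). VPair (enc_rat x) (enc_rat p)) d))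
        (jobs I)))"

definition enc_set :: "nat set \<Rightarrow> val" where
  "enc_set S = enc_list VNum (sorted_list_of_set S)"

definition enc_observed :: "nat set \<Rightarrow> (nat \<Rightarrow> real) \<Rightarrow> val" where
  "enc_observed S v = enc_list (\<lambda>i. VPair (VNum i) (enc_rat (v i))) (sorted_list_of_set S)"

definition enc_assignment :: "sched \<Rightarrow> (nat \<Rightarrow> nat) \<Rightarrow> val" where
  "enc_assignment I a = enc_list (\<lambda>i. VNum (a i)) [0..<length (jobs I)]"

definition inputs :: "sched set" where
  "inputs = {I. valid I \<and> rational I}"

definition observations :: "(sched \<times> nat set \<times> (nat \<Rightarrow> real)) set" where
  "observations = {(I, S, v). I \<in> inputs \<and> S \<subseteq> job_set I \<and> (\<forall>i\<in>S. 0 \<le> v i \<and> v i \<in> \<rat>)}"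

definition outlier_algorithm :: "real \<Rightarrow> (sched \<Rightarrow> nat set) \<Rightarrow> bool" where
  "outlier_algorithm \<alpha> f \<longleftrightarrow>
    polytime_on inputs enc_sched (\<lambda>I. enc_set (f I)) \<and>
    (\<forall>I\<in>inputs. f I \<subseteq> job_set I \<and> probing_cost I (f I) \<le> budget I \<and>
       outlier_value I (f I) \<le> \<alpha> * outlier_opt I)"

definition assignment_algorithm ::
  "real \<Rightarrow> (sched \<Rightarrow> nat set \<Rightarrow> (nat \<Rightarrow> real) \<Rightarrow> nat \<Rightarrow> nat) \<Rightarrow> bool" where
  "assignment_algorithm \<beta> g \<longleftrightarrow>
    polytime_on observations (\<lambda>(I, S, v). VPair (enc_sched I) (enc_observed S v))
      (\<lambda>(I, S, v). enc_assignment I (g I S v)) \<and>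
    (\<forall>(I, S, v)\<in>observations. g I S v \<in> assignments I (job_set I) \<and>
       expected_makespan I S v (g I S v) \<le> \<beta> * best_value I S v)"

end

theory Submission
  imports Defs
begin

text \<open>
  (P2) holds since assignments of \<open>A\<close> and of its complement can be combined.  For (b) and (c) we use
  the effective sizes of Kleinberg, Rabani and Tardos: relative to a guess \<open>B\<close> for the expected makespan,
  a job is charged for the mean of its size above \<open>B\<close> and for the logarithm of an exponential
  moment, with base about \<open>m\<close>, of its size below \<open>B\<close>.  The charges of the jobs are bounded by a constant
  if they can be scheduled with expected makespan \<open>B / 2\<close>, and if they are, then cutting the sequence of
  jobs into intervals of about equal charge has expected makespan \<open>O(B)\<close>.  Moments and logarithms
  are rounded so that all charges are rational, and \<open>B\<close> ranges over powers of two times the mean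
  of a job.  Choosing the jobs to leave unprobed becomes a covering problem with a single weight, for which
  the greedy algorithm is good enough.  All numbers are written as closed expressions built from sums over
  index ranges, comparisons and roundings, which preserve computability in polynomial time.

  For the last part, the leaf value of a policy is at least the expected minimal makespan given the
  probed sizes and at least the outlier value of the probed set; redrawing unprobed sizes preserves the
  law, so \<open>OPT\<close> is at least the expected minimal makespan and at least the outlier optimum.
\<close>

section \<open>Polynomial-time functions\<close>

text \<open>The delicate direction is that a good schedule forces small charges, since a machine
  that is often overloaded can have a huge exponential moment. Different machines are independent,
  so their overload probabilities add up to at most 1. If a machine is overloaded with probability
  at most \<open>1 / (2 * 16 powr (L / 5))\<close>, its moment is of order
  \<open>4 powr (L / 5)\<close>. On any other machine the moment is linearised, at the price of a
  factor \<open>2 powr (L / 5)\<close>, and charged to the overload probability. The total loss is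
  of order \<open>16 powr (L / 5) * 2 powr (L / 5) = 2 ^ L \<le> 2 * m\<close> times
  \<open>L\<close>, which fixes the unit in which load \<open>B\<close> is level
  \<open>L / 5\<close>. In the other direction \<open>m < 2 ^ L\<close> pays for a union bound over
  the machines. A scale is accepted if the total charge is at most 4: a feasible solution has charge
  at most 2 at a suitable scale, and the greedy choice loses a factor 2. Charge 4 yields expected
  makespan \<open>414 * B\<close>, and the scale found is at most 4 times the optimum, whence
  \<open>1656 = 4 * 414\<close>.\<close>

lemma vsize_pos [simp]: "0 < vsize v"
  by (cases v) auto

lemma one_le_vsize [simp]: "1 \<le> vsize v" "Suc 0 \<le> vsize v"
  using vsize_pos[of v] by linarith+

lemma exec_size_le: "exec p u v t \<Longrightarrow> vsize v \<le> t"
proof (induction rule: exec.induct)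
  case (exec_Fork p u v s q w t)
  then show ?case using vsize_pos[of u] unfolding vsize.simps by linarith
qed auto

text \<open>The shape of the bound in \<open>polytime_on\<close>: one constant is both coefficient
  and exponent. As \<open>vsize\<close> is at least 1, the constant may be enlarged, which gives
  closure under sums, products and fixed powers.\<close>

definition pbounded :: "'a set \<Rightarrow> ('a \<Rightarrow> val) \<Rightarrow> ('a \<Rightarrow> nat) \<Rightarrow> bool" where
  "pbounded D inp g \<longleftrightarrow> (\<exists>k. \<forall>x\<in>D. g x \<le> k * vsize (inp x) ^ k)"

lemma pbounded_mono:
  "pbounded D inp g \<Longrightarrow> (\<And>x. x \<in> D \<Longrightarrow> f x \<le> g x) \<Longrightarrow> pbounded D inp f"
  unfolding pbounded_def by (blast intro: order_trans)

lemma pbounded_subset: "pbounded D inp g \<Longrightarrow> D' \<subseteq> D \<Longrightarrow> pbounded D' inp g"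
  unfolding pbounded_def by blast

lemma pbounded_const: "pbounded D inp (\<lambda>_. c)"
  unfolding pbounded_def by (rule exI[of _ c]) (simp add: Suc_leI)

lemma pbounded_vsize: "pbounded D inp (\<lambda>x. vsize (inp x))"
  unfolding pbounded_def by (rule exI[of _ 1]) simp

lemma pbounded_add:
  assumes "pbounded D inp f" "pbounded D inp g"
  shows "pbounded D inp (\<lambda>x. f x + g x)"
proof -
  obtain k l where k: "\<forall>x\<in>D. f x \<le> k * vsize (inp x) ^ k"
    and l: "\<forall>x\<in>D. g x \<le> l * vsize (inp x) ^ l"
    using assms unfolding pbounded_def by blast
  have "f x + g x \<le> (k + l) * vsize (inp x) ^ (k + l)" if "x \<in> D" for x
  proof -
    have "k * vsize (inp x) ^ k \<le> k * vsize (inp x) ^ (k + l)"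
      "l * vsize (inp x) ^ l \<le> l * vsize (inp x) ^ (k + l)"
      by (intro mult_left_mono power_increasing; simp)+
    moreover have "f x \<le> k * vsize (inp x) ^ k" "g x \<le> l * vsize (inp x) ^ l"
      using k l that by blast+
    ultimately show ?thesis unfolding add_mult_distrib by linarith
  qed
  then show ?thesis unfolding pbounded_def by blast
qed

lemma pbounded_mult:
  assumes "pbounded D inp f" "pbounded D inp g"
  shows "pbounded D inp (\<lambda>x. f x * g x)"
proof -
  obtain k l where k: "\<forall>x\<in>D. f x \<le> k * vsize (inp x) ^ k"
    and l: "\<forall>x\<in>D. g x \<le> l * vsize (inp x) ^ l"
    using assms unfolding pbounded_def by blast
  have "f x * g x \<le> (k * l + k + l) * vsize (inp x) ^ (k * l + k + l)" if "x \<in> D" for x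
  proof -
    have "f x * g x \<le> (k * vsize (inp x) ^ k) * (l * vsize (inp x) ^ l)"
      using k l that by (intro mult_mono) auto
    also have "\<dots> = k * l * vsize (inp x) ^ (k + l)"
      by (simp add: power_add algebra_simps)
    also have "\<dots> \<le> (k * l + k + l) * vsize (inp x) ^ (k * l + k + l)"
      by (intro mult_mono power_increasing) auto
    finally show ?thesis .
  qed
  then show ?thesis unfolding pbounded_def by blast
qed

lemma pbounded_power:
  assumes "pbounded D inp f"
  shows "pbounded D inp (\<lambda>x. f x ^ c)"
  by (induction c) (use assms in \<open>auto intro: pbounded_mult pbounded_const\<close>)

lemma pbounded_compose:
  assumes g: "pbounded D' inp' g" and h: "\<And>x. x \<in> D \<Longrightarrow> h x \<in> D'"
    and size: "pbounded D inp (\<lambda>x. vsize (inp' (h x)))"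
  shows "pbounded D inp (\<lambda>x. g (h x))"
proof -
  obtain k where k: "\<forall>x\<in>D'. g x \<le> k * vsize (inp' x) ^ k"
    using g unfolding pbounded_def by blast
  have "pbounded D inp (\<lambda>x. k * vsize (inp' (h x)) ^ k)"
    by (intro pbounded_mult pbounded_const pbounded_power size)
  then show ?thesis by (rule pbounded_mono) (use k h in blast)
qed

lemma polytime_onI:
  assumes "pbounded D inp T" "\<And>x. x \<in> D \<Longrightarrow> \<exists>t. exec p (inp x) (out x) t \<and> t \<le> T x"
  shows "polytime_on D inp out"
proof -
  obtain k where k: "\<And>x. x \<in> D \<Longrightarrow> T x \<le> k * vsize (inp x) ^ k"
    using assms(1) unfolding pbounded_def by blast
  have "\<exists>t. exec p (inp x) (out x) t \<and> t \<le> k * vsize (inp x) ^ k" if "x \<in> D" for x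
    using assms(2)[OF that] k[OF that] order_trans by blast
  then show ?thesis unfolding polytime_on_def by blast
qed

lemma polytime_onE:
  assumes "polytime_on D inp out"
  obtains p T where "pbounded D inp T" "\<And>x. x \<in> D \<Longrightarrow> \<exists>t. exec p (inp x) (out x) t \<and> t \<le> T x"
proof -
  obtain p k where "\<forall>x\<in>D. \<exists>t. exec p (inp x) (out x) t \<and> t \<le> k * vsize (inp x) ^ k"
    using assms unfolding polytime_on_def by blast
  moreover have "pbounded D inp (\<lambda>x. k * vsize (inp x) ^ k)"
    unfolding pbounded_def by blast
  ultimately show thesis using that by blast
qed

lemma polytime_subset: "polytime_on D inp out \<Longrightarrow> D' \<subseteq> D \<Longrightarrow> polytime_on D' inp out"
  unfolding polytime_on_def by blast

lemma polytime_cong: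
  "polytime_on D inp out \<Longrightarrow> (\<And>x. x \<in> D \<Longrightarrow> out x = out' x) \<Longrightarrow> polytime_on D inp out'"
  unfolding polytime_on_def by (metis (no_types, lifting))

lemma polytime_size:
  assumes "polytime_on D inp out"
  shows "pbounded D inp (\<lambda>x. vsize (out x))"
proof -
  obtain p T where T: "pbounded D inp T"
    and p: "\<And>x. x \<in> D \<Longrightarrow> \<exists>t. exec p (inp x) (out x) t \<and> t \<le> T x"
    using assms by (rule polytime_onE) blast
  have "vsize (out x) \<le> T x" if "x \<in> D" for x
  proof -
    from p[OF that] obtain t where "exec p (inp x) (out x) t" "t \<le> T x" by blast
    then show ?thesis using exec_size_le[of p "inp x" "out x" t] by linarith
  qed
  with T show ?thesis by (rule pbounded_mono)
qed

lemma floorlog_le_self: "floorlog 2 n \<le> n"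
  by (rule floorlog_leI) auto

text \<open>No primitive enlarges its argument by more than a constant: an arithmetic result has at
  most one bit more than both operands together, and \<open>Const k\<close> is paid for by
  \<open>c\<close>.\<close>

lemma polytime_prim:
  assumes "polytime_on D inp f"
  shows "polytime_on D inp (\<lambda>x. apply_prim q (f x))"
proof -
  obtain p T where T: "pbounded D inp T"
    and p: "\<And>x. x \<in> D \<Longrightarrow> \<exists>t. exec p (inp x) (f x) t \<and> t \<le> T x"
    using assms by (rule polytime_onE) blast
  define c where "c = (case q of Const k \<Rightarrow> k | _ \<Rightarrow> 0)"
  have fl: "floorlog 2 (a + b) \<le> Suc (floorlog 2 a + floorlog 2 b)"
    "floorlog 2 (a - b) \<le> Suc (floorlog 2 a + floorlog 2 b)"
    "floorlog 2 (a * b) \<le> Suc (floorlog 2 a + floorlog 2 b)"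
    "floorlog 2 (a div b) \<le> Suc (floorlog 2 a + floorlog 2 b)" for a b :: nat
  proof -
    have a: "a < 2 ^ floorlog 2 a" and b: "b < 2 ^ floorlog 2 b"
      using floorlog_leD[of 2 _ "floorlog 2 _"] by auto
    have "2 ^ floorlog 2 a + (2::nat) ^ floorlog 2 b \<le> 2 ^ (floorlog 2 a + floorlog 2 b) + 2 ^ (floorlog 2 a + floorlog 2 b)"
      by (intro add_mono power_increasing) auto
    then have "a + b < 2 ^ Suc (floorlog 2 a + floorlog 2 b)" using a b
      by (simp only: power_Suc mult_2)
    then show "floorlog 2 (a + b) \<le> Suc (floorlog 2 a + floorlog 2 b)"
      by (intro floorlog_leI) auto
    have "a * b < 2 ^ floorlog 2 a * 2 ^ floorlog 2 b" using a b by (intro mult_strict_mono) auto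
    also have "\<dots> \<le> 2 ^ Suc (floorlog 2 a + floorlog 2 b)" by (simp add: power_add)
    finally show "floorlog 2 (a * b) \<le> Suc (floorlog 2 a + floorlog 2 b)"
      by (intro floorlog_leI) auto
    have "floorlog 2 (a - b) \<le> floorlog 2 a" "floorlog 2 (a div b) \<le> floorlog 2 a"
      by (intro floorlog_mono; simp)+
    then show "floorlog 2 (a - b) \<le> Suc (floorlog 2 a + floorlog 2 b)"
      "floorlog 2 (a div b) \<le> Suc (floorlog 2 a + floorlog 2 b)" by linarith+
  qed
  have floorlog_0: "floorlog 2 0 = 0" by (simp add: floorlog_def)
  have floorlog_1: "floorlog 2 (Suc 0) = 1" by (simp add: floorlog_def)
  have size: "vsize (apply_prim q v) \<le> vsize v + c + 1" for v
    unfolding c_def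
  proof (induction q v rule: apply_prim.induct)
    case (6 a b)
    show ?case using fl(1)[of a b] by simp
  next
    case (7 a b)
    show ?case using fl(2)[of a b] by simp
  next
    case (8 a b)
    show ?case using fl(3)[of a b] by simp
  next
    case (9 a b)
    show ?case using fl(4)[of a b] by simp
  qed (auto simp: floorlog_0 floorlog_1 floorlog_le_self trans_le_add2)
  show ?thesis
  proof (rule polytime_onI[where p = "Then p (Prim q)" and T = "\<lambda>x. T x + (T x + (T x + c + 1))"])
    show "pbounded D inp (\<lambda>x. T x + (T x + (T x + c + 1)))"
      by (intro pbounded_add T pbounded_const)
    fix x assume "x \<in> D"
    then obtain t where t: "exec p (inp x) (f x) t" "t \<le> T x" using p by blast
    have "vsize (f x) \<le> T x" using exec_size_le[OF t(1)] t(2) by linarith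
    then have "t + (vsize (f x) + vsize (apply_prim q (f x))) \<le> T x + (T x + (T x + c + 1))"
      using size[of "f x"] t(2) by linarith
    then show "\<exists>t. exec (Then p (Prim q)) (inp x) (apply_prim q (f x)) t \<and>
        t \<le> T x + (T x + (T x + c + 1))"
      using exec_Then[OF t(1) exec_Prim] by blast
  qed
qed

lemma polytime_input: "polytime_on D inp inp"
proof (rule polytime_onI[where p = "Prim Ident" and T = "\<lambda>x. vsize (inp x) + vsize (inp x)"])
  show "\<exists>t. exec (Prim Ident) (inp x) (inp x) t \<and> t \<le> vsize (inp x) + vsize (inp x)" for x
    using exec_Prim[of Ident "inp x"] by auto
qed (intro pbounded_add pbounded_vsize)

lemma polytime_compose:
  assumes f: "polytime_on D inp (\<lambda>x. inp' (h x))" and h: "\<And>x. x \<in> D \<Longrightarrow> h x \<in> D'"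
    and g: "polytime_on D' inp' out"
  shows "polytime_on D inp (\<lambda>x. out (h x))"
proof -
  obtain p T where T: "pbounded D inp T"
    and p: "\<And>x. x \<in> D \<Longrightarrow> \<exists>t. exec p (inp x) (inp' (h x)) t \<and> t \<le> T x"
    using f by (rule polytime_onE) blast
  obtain q T' where T': "pbounded D' inp' T'"
    and q: "\<And>x. x \<in> D' \<Longrightarrow> \<exists>t. exec q (inp' x) (out x) t \<and> t \<le> T' x"
    using g by (rule polytime_onE) blast
  show ?thesis
  proof (rule polytime_onI[where p = "Then p q" and T = "\<lambda>x. T x + T' (h x)"])
    show "pbounded D inp (\<lambda>x. T x + T' (h x))"
      by (intro pbounded_add T pbounded_compose[OF T' h] polytime_size[OF f])
    fix x assume x: "x \<in> D"
    obtain t t' where "exec p (inp x) (inp' (h x)) t" "t \<le> T x"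
      "exec q (inp' (h x)) (out (h x)) t'" "t' \<le> T' (h x)"
      using p[OF x] q[OF h[OF x]] by blast
    then show "\<exists>t. exec (Then p q) (inp x) (out (h x)) t \<and> t \<le> T x + T' (h x)"
      using exec_Then[of p _ _ t q _ t'] add_mono[of t _ t'] by blast
  qed
qed

lemma polytime_pair:
  assumes "polytime_on D inp f" "polytime_on D inp g"
  shows "polytime_on D inp (\<lambda>x. VPair (f x) (g x))"
proof -
  obtain p T where T: "pbounded D inp T"
    and p: "\<And>x. x \<in> D \<Longrightarrow> \<exists>t. exec p (inp x) (f x) t \<and> t \<le> T x"
    using assms(1) by (rule polytime_onE) blast
  obtain q T' where T': "pbounded D inp T'"
    and q: "\<And>x. x \<in> D \<Longrightarrow> \<exists>t. exec q (inp x) (g x) t \<and> t \<le> T' x"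
    using assms(2) by (rule polytime_onE) blast
  show ?thesis
  proof (rule polytime_onI[where p = "Fork p q" and T = "\<lambda>x. vsize (inp x) + T x + T' x"])
    show "pbounded D inp (\<lambda>x. vsize (inp x) + T x + T' x)"
      by (intro pbounded_add T T' pbounded_vsize)
    fix x assume x: "x \<in> D"
    obtain t t' where t: "exec p (inp x) (f x) t" "t \<le> T x" "exec q (inp x) (g x) t'" "t' \<le> T' x"
      using p[OF x] q[OF x] by blast
    then have "vsize (inp x) + t + t' \<le> vsize (inp x) + T x + T' x" by linarith
    then show "\<exists>t. exec (Fork p q) (inp x) (VPair (f x) (g x)) t \<and> t \<le> vsize (inp x) + T x + T' x"
      using exec_Fork[OF t(1,3)] by blast
  qed
qed

lemma polytime_const: "polytime_on D inp (\<lambda>_. VNum c)"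
  using polytime_prim[OF polytime_input, of D inp "Const c"] by simp

lemma polytime_first: "polytime_on D inp (\<lambda>x. VPair (f x) (g x)) \<Longrightarrow> polytime_on D inp f"
  using polytime_prim[of D inp "\<lambda>x. VPair (f x) (g x)" First] by simp

lemma polytime_second: "polytime_on D inp (\<lambda>x. VPair (f x) (g x)) \<Longrightarrow> polytime_on D inp g"
  using polytime_prim[of D inp "\<lambda>x. VPair (f x) (g x)" Second] by simp

section \<open>Natural numbers and truth values\<close>

abbreviation pnat :: "'a set \<Rightarrow> ('a \<Rightarrow> val) \<Rightarrow> ('a \<Rightarrow> nat) \<Rightarrow> bool" where
  "pnat D inp f \<equiv> polytime_on D inp (\<lambda>x. VNum (f x))"

abbreviation pbool :: "'a set \<Rightarrow> ('a \<Rightarrow> val) \<Rightarrow> ('a \<Rightarrow> bool) \<Rightarrow> bool" where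
  "pbool D inp P \<equiv> pnat D inp (\<lambda>x. of_bool (P x))"

lemma pnat_add: "pnat D inp f \<Longrightarrow> pnat D inp g \<Longrightarrow> pnat D inp (\<lambda>x. f x + g x)"
  using polytime_prim[OF polytime_pair, of D inp "\<lambda>x. VNum (f x)" "\<lambda>x. VNum (g x)" Plus] by simp

lemma pnat_diff: "pnat D inp f \<Longrightarrow> pnat D inp g \<Longrightarrow> pnat D inp (\<lambda>x. f x - g x)"
  using polytime_prim[OF polytime_pair, of D inp "\<lambda>x. VNum (f x)" "\<lambda>x. VNum (g x)" Minus] by simp

lemma pnat_mult: "pnat D inp f \<Longrightarrow> pnat D inp g \<Longrightarrow> pnat D inp (\<lambda>x. f x * g x)"
  using polytime_prim[OF polytime_pair, of D inp "\<lambda>x. VNum (f x)" "\<lambda>x. VNum (g x)" Times] by simp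

lemma pnat_div: "pnat D inp f \<Longrightarrow> pnat D inp g \<Longrightarrow> pnat D inp (\<lambda>x. f x div g x)"
  using polytime_prim[OF polytime_pair, of D inp "\<lambda>x. VNum (f x)" "\<lambda>x. VNum (g x)" Div] by simp

lemma pnat_mod: "pnat D inp f \<Longrightarrow> pnat D inp g \<Longrightarrow> pnat D inp (\<lambda>x. f x mod g x)"
  using pnat_diff[OF _ pnat_mult[OF pnat_div], of D inp f f g g]
  by (simp add: minus_div_mult_eq_mod)

lemma pbool_le: "pnat D inp f \<Longrightarrow> pnat D inp g \<Longrightarrow> pbool D inp (\<lambda>x. f x \<le> g x)"
  using polytime_prim[OF polytime_pair, of D inp "\<lambda>x. VNum (f x)" "\<lambda>x. VNum (g x)" Leq]
  by (simp add: of_bool_def)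

lemma pbool_not: "pbool D inp P \<Longrightarrow> pbool D inp (\<lambda>x. \<not> P x)"
  using pnat_diff[OF polytime_const, of D inp "\<lambda>x. of_bool (P x)" 1]
  by (rule polytime_cong) auto

lemma pbool_conj: "pbool D inp P \<Longrightarrow> pbool D inp Q \<Longrightarrow> pbool D inp (\<lambda>x. P x \<and> Q x)"
  using pnat_mult[of D inp "\<lambda>x. of_bool (P x)" "\<lambda>x. of_bool (Q x)"] by (simp add: of_bool_conj)

lemma pbool_disj: "pbool D inp P \<Longrightarrow> pbool D inp Q \<Longrightarrow> pbool D inp (\<lambda>x. P x \<or> Q x)"
  using pbool_not[OF pbool_conj[OF pbool_not pbool_not], of D inp P Q] by simp

lemma pbool_imp: "pbool D inp P \<Longrightarrow> pbool D inp Q \<Longrightarrow> pbool D inp (\<lambda>x. P x \<longrightarrow> Q x)"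
  by (rule polytime_cong[OF pbool_disj[OF pbool_not, of D inp P Q]]) auto

lemma pbool_less: "pnat D inp f \<Longrightarrow> pnat D inp g \<Longrightarrow> pbool D inp (\<lambda>x. f x < g x)"
  using pbool_not[OF pbool_le, of D inp g f] by (simp add: not_le)

lemma pbool_eq: "pnat D inp f \<Longrightarrow> pnat D inp g \<Longrightarrow> pbool D inp (\<lambda>x. f x = g x)"
  using pbool_conj[OF pbool_le pbool_le, of D inp f g g f] by (simp add: eq_iff)

text \<open>Each branch has to be efficient only on the inputs that reach it. This matters where a
  branch is meaningful only there, as for looking up a size that has been observed.\<close>

lemma polytime_if:
  assumes "pbool D inp P" "polytime_on {x \<in> D. P x} inp f" "polytime_on {x \<in> D. \<not> P x} inp g"
  shows "polytime_on D inp (\<lambda>x. if P x then f x else g x)"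
proof -
  obtain b T0 where T0: "pbounded D inp T0"
    and b: "\<And>x. x \<in> D \<Longrightarrow> \<exists>t. exec b (inp x) (VNum (of_bool (P x))) t \<and> t \<le> T0 x"
    using assms(1) by (rule polytime_onE) blast
  obtain p k where p: "\<And>x. x \<in> D \<Longrightarrow> P x \<Longrightarrow> \<exists>t. exec p (inp x) (f x) t \<and> t \<le> k * vsize (inp x) ^ k"
    using assms(2) unfolding polytime_on_def by blast
  obtain q l where q: "\<And>x. x \<in> D \<Longrightarrow> \<not> P x \<Longrightarrow> \<exists>t. exec q (inp x) (g x) t \<and> t \<le> l * vsize (inp x) ^ l"
    using assms(3) unfolding polytime_on_def by blast
  let ?T = "\<lambda>x. vsize (inp x) + T0 x + (k * vsize (inp x) ^ k + l * vsize (inp x) ^ l)"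
  show ?thesis
  proof (rule polytime_onI[where p = "Branch b p q" and T = ?T])
    show "pbounded D inp ?T"
      by (intro pbounded_add pbounded_mult pbounded_power pbounded_vsize T0 pbounded_const)
    fix x assume x: "x \<in> D"
    obtain r where r: "exec b (inp x) (VNum (of_bool (P x))) r" "r \<le> T0 x" using b[OF x] by blast
    show "\<exists>t. exec (Branch b p q) (inp x) (if P x then f x else g x) t \<and> t \<le> ?T x"
    proof (cases "P x")
      case True
      then obtain s where s: "exec p (inp x) (f x) s" "s \<le> k * vsize (inp x) ^ k" using p x by blast
      have "exec (Branch b p q) (inp x) (f x) (vsize (inp x) + r + s)"
        using exec_Branch_True[OF r(1) _ s(1)] True by simp
      then show ?thesis using True r s by (intro exI[of _ "vsize (inp x) + r + s"]) auto
    next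
      case False
      then obtain s where s: "exec q (inp x) (g x) s" "s \<le> l * vsize (inp x) ^ l" using q x by blast
      have "exec (Branch b p q) (inp x) (g x) (vsize (inp x) + r + s)"
        using exec_Branch_False[OF _ s(1)] r(1) False by simp
      then show ?thesis using False r s by (intro exI[of _ "vsize (inp x) + r + s"]) auto
    qed
  qed
qed

lemma pnat_if:
  assumes "pbool D inp P" "pnat {x \<in> D. P x} inp f" "pnat {x \<in> D. \<not> P x} inp g"
  shows "pnat D inp (\<lambda>x. if P x then f x else g x)"
  using polytime_if[OF assms] by (simp add: if_distrib)

text \<open>The loop sees nothing but the state, so the states themselves are the inputs in the
  hypotheses on the exit test and on the body. The bound \<open>S\<close> on all states is separate
  because polynomially many efficient steps may still build up exponentially long data, for instance
  by repeated squaring.\<close>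

lemma polytime_while:
  assumes init: "polytime_on D inp (\<lambda>x. st x 0)"
    and cond: "pbool (SIGMA x:D. {..n x}) (\<lambda>(x, i). st x i) (\<lambda>(x, i). i < n x)"
    and step: "polytime_on (SIGMA x:D. {..<n x}) (\<lambda>(x, i). st x i) (\<lambda>(x, i). st x (Suc i))"
    and n: "pbounded D inp n" and S: "pbounded D inp S"
    and size: "\<And>x i. x \<in> D \<Longrightarrow> i \<le> n x \<Longrightarrow> vsize (st x i) \<le> S x"
  shows "polytime_on D inp (\<lambda>x. st x (n x))"
proof -
  obtain p T where T: "pbounded D inp T"
    and p: "\<And>x. x \<in> D \<Longrightarrow> \<exists>t. exec p (inp x) (st x 0) t \<and> t \<le> T x"
    using init by (rule polytime_onE) blast
  obtain b k where b: "\<And>x i. x \<in> D \<Longrightarrow> i \<le> n x \<Longrightarrow>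
      \<exists>t. exec b (st x i) (VNum (of_bool (i < n x))) t \<and> t \<le> k * vsize (st x i) ^ k"
    using cond unfolding polytime_on_def by force
  obtain q l where q: "\<And>x i. x \<in> D \<Longrightarrow> i < n x \<Longrightarrow>
      \<exists>t. exec q (st x i) (st x (Suc i)) t \<and> t \<le> l * vsize (st x i) ^ l"
    using step unfolding polytime_on_def by force
  let ?U = "\<lambda>x. S x + k * S x ^ k + l * S x ^ l"
  have loop: "\<exists>t. exec (Loop b q) (st x i) (st x (n x)) t \<and> t \<le> (n x - i + 1) * ?U x"
    if x: "x \<in> D" and i: "i \<le> n x" for x i
    using i
  proof (induction "n x - i" arbitrary: i)
    case 0
    then have [simp]: "i = n x" by simp
    obtain r where r: "exec b (st x i) (VNum 0) r" "r \<le> k * vsize (st x i) ^ k"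
      using b[OF x, of i] by auto
    have "k * vsize (st x i) ^ k \<le> k * S x ^ k"
      by (intro mult_left_mono power_mono size[OF x]) auto
    then have "vsize (st x i) + r \<le> ?U x" using r(2) size[OF x order.refl] unfolding \<open>i = n x\<close> by linarith
    then show ?case using exec_Loop_Stop[OF r(1)] by auto
  next
    case (Suc d)
    then have i: "i < n x" "d = n x - Suc i" by auto
    obtain r where r: "exec b (st x i) (VNum 1) r" "r \<le> k * vsize (st x i) ^ k"
      using b[OF x, of i] i by auto
    obtain s where s: "exec q (st x i) (st x (Suc i)) s" "s \<le> l * vsize (st x i) ^ l"
      using q[OF x, of i] i by auto
    obtain t where t: "exec (Loop b q) (st x (Suc i)) (st x (n x)) t" "t \<le> (n x - Suc i + 1) * ?U x"
      using Suc(1)[OF i(2)] i by auto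
    have "k * vsize (st x i) ^ k \<le> k * S x ^ k" "l * vsize (st x i) ^ l \<le> l * S x ^ l"
      using i by (intro mult_left_mono power_mono size[OF x]; simp)+
    then have "vsize (st x i) + r + s \<le> ?U x" using r s size[OF x, of i] i by linarith
    moreover have "(n x - i + 1) * ?U x = ?U x + (n x - Suc i + 1) * ?U x"
    proof -
      have "n x - i + 1 = Suc (n x - Suc i + 1)" using i by linarith
      then show ?thesis by (simp only: mult_Suc)
    qed
    ultimately have "vsize (st x i) + r + s + t \<le> (n x - i + 1) * ?U x"
      using t(2) by linarith
    then show ?case using exec_Loop_Step[OF r(1) _ s(1) t(1)] by auto
  qed
  let ?T = "\<lambda>x. T x + (n x + 1) * ?U x"
  show ?thesis
  proof (rule polytime_onI[where p = "Then p (Loop b q)" and T = ?T])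
    show "pbounded D inp ?T"
      by (intro pbounded_add pbounded_mult pbounded_power T S n pbounded_const)
    fix x assume x: "x \<in> D"
    obtain t t' where t: "exec p (inp x) (st x 0) t" "t \<le> T x"
      "exec (Loop b q) (st x 0) (st x (n x)) t'" "t' \<le> (n x + 1) * ?U x"
      using p[OF x] loop[OF x, of 0] by auto
    from exec_Then[OF t(1,3)] add_mono[OF t(2,4)]
    show "\<exists>t. exec (Then p (Loop b q)) (inp x) (st x (n x)) t \<and> t \<le> ?T x" by blast
  qed
qed

text \<open>The data of an enclosing sum, quantifier or loop, paired with the running index; nested
  binders nest \<open>ext\<close>. The domains that go with it are dependent sums, which record the
  range of the index.\<close>

definition ext :: "('a \<Rightarrow> val) \<Rightarrow> 'a \<times> nat \<Rightarrow> val" where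
  "ext inp = (\<lambda>p. VPair (inp (fst p)) (VNum (snd p)))"

lemma polytime_ext: "polytime_on A (ext inp) (\<lambda>p. VPair (inp (fst p)) (VNum (snd p)))"
  by (rule polytime_cong[OF polytime_input]) (simp add: ext_def)

lemma polytime_weaken:
  assumes "polytime_on D inp f"
  shows "polytime_on (Sigma D A) (ext inp) (\<lambda>p. f (fst p))"
proof (rule polytime_compose[where h = fst, OF _ _ assms])
  show "polytime_on (Sigma D A) (ext inp) (\<lambda>x. inp (fst x))"
    by (rule polytime_first[OF polytime_ext])
qed auto

lemma pnat_index: "pnat D (ext inp) snd"
  by (rule polytime_second[OF polytime_ext])

text \<open>An index below \<open>n x\<close> adds at most \<open>n x + 2\<close> to the size of the
  data, so a bound in terms of the extended data becomes one in terms of \<open>inp x\<close> alone,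
  the same for all rounds.\<close>

lemma pbounded_uniform:
  assumes g: "pbounded (SIGMA x:D. {..<n x}) (ext inp) g" and n: "pbounded D inp n"
  obtains S where "pbounded D inp S" "\<And>x i. x \<in> D \<Longrightarrow> i < n x \<Longrightarrow> g (x, i) \<le> S x"
proof -
  obtain k where k: "\<And>x i. x \<in> D \<Longrightarrow> i < n x \<Longrightarrow> g (x, i) \<le> k * vsize (ext inp (x, i)) ^ k"
    using g unfolding pbounded_def by fastforce
  let ?S = "\<lambda>x. k * (vsize (inp x) + (n x + 2)) ^ k"
  have "pbounded D inp ?S"
    by (intro pbounded_add pbounded_mult pbounded_power n pbounded_const pbounded_vsize)
  moreover have "g (x, i) \<le> ?S x" if "x \<in> D" "i < n x" for x i
  proof -
    have "vsize (ext inp (x, i)) \<le> vsize (inp x) + (n x + 2)"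
      using floorlog_le_self[of i] that by (simp add: ext_def)
    then have "k * vsize (ext inp (x, i)) ^ k \<le> ?S x"
      by (intro mult_left_mono power_mono) auto
    then show ?thesis using k[OF that] by linarith
  qed
  ultimately show thesis using that by blast
qed

text \<open>A while loop whose state carries the input, the counter, the accumulator
  \<open>st\<close> and the limit \<open>n\<close>; thus the body may consult the original data and
  the exit test can be read off the state.\<close>

lemma polytime_for:
  assumes n: "pnat D inp n" "pbounded D inp n"
    and init: "polytime_on D inp (\<lambda>x. st x 0)"
    and step: "polytime_on (SIGMA x:D. {..<n x})
      (\<lambda>p. VPair (ext inp p) (st (fst p) (snd p))) (\<lambda>p. st (fst p) (Suc (snd p)))"
    and S: "pbounded D inp S"
    and size: "\<And>x i. x \<in> D \<Longrightarrow> i \<le> n x \<Longrightarrow> vsize (st x i) \<le> S x"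
  shows "polytime_on D inp (\<lambda>x. st x (n x))"
proof -
  define V where "V = (\<lambda>p. VPair (VPair (ext inp p) (st (fst p) (snd p))) (VNum (n (fst p))))"
  have V: "polytime_on A V (\<lambda>p. VPair (VPair (ext inp p) (st (fst p) (snd p))) (VNum (n (fst p))))" for A
    using polytime_input[of A V] by (simp add: V_def)
  note V1 = polytime_first[OF V] and n' = polytime_second[OF V]
  note ext = polytime_first[OF V1]
  have ext': "polytime_on A V (\<lambda>p. VPair (inp (fst p)) (VNum (snd p)))" for A
    by (rule polytime_cong[OF ext]) (simp add: ext_def)
  note inp = polytime_first[OF ext'] and i = polytime_second[OF ext']
  have pairs: "(\<lambda>(x, i). V (x, i)) = V"
    by auto
  have "polytime_on D inp (\<lambda>x. V (x, n x))"
  proof (rule polytime_while[of D inp "\<lambda>x i. V (x, i)" n "\<lambda>x. vsize (inp x) + S x + (n x + n x + 6)"], unfold pairs)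
    show "polytime_on D inp (\<lambda>x. V (x, 0))"
      unfolding V_def ext_def fst_conv snd_conv by (intro polytime_pair polytime_input polytime_const init n)
    show "pbool (SIGMA x:D. {..n x}) V (\<lambda>(x, i). i < n x)"
      unfolding split_def by (rule pbool_less[OF i n'])
    have "polytime_on (SIGMA x:D. {..<n x}) V (\<lambda>p. st (fst p) (Suc (snd p)))"
      by (rule polytime_compose[where h = "\<lambda>x. x", OF V1 _ step])
    moreover have "pnat (SIGMA x:D. {..<n x}) V (\<lambda>p. Suc (snd p))"
      using pnat_add[OF i polytime_const[of _ _ 1]] by simp
    ultimately have "polytime_on (SIGMA x:D. {..<n x}) V (\<lambda>p. VPair (VPair
        (VPair (inp (fst p)) (VNum (Suc (snd p)))) (st (fst p) (Suc (snd p)))) (VNum (n (fst p))))"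
      by (intro polytime_pair inp n')
    then show "polytime_on (SIGMA x:D. {..<n x}) V (\<lambda>(x, i). V (x, Suc i))"
      by (rule polytime_cong) (simp add: V_def ext_def split_def)
    show "pbounded D inp n" by (fact n)
    show "pbounded D inp (\<lambda>x. vsize (inp x) + S x + (n x + n x + 6))"
      by (intro pbounded_add pbounded_vsize S n pbounded_const)
    show "vsize (V (x, i)) \<le> vsize (inp x) + S x + (n x + n x + 6)" if "x \<in> D" "i \<le> n x" for x i
      using size[OF that] floorlog_le_self[of i] floorlog_le_self[of "n x"] that
      by (simp add: V_def ext_def)
  qed
  then show ?thesis unfolding V_def fst_conv snd_conv by (rule polytime_second[OF polytime_first])
qed

text \<open>The representing fraction need not be in lowest terms, so no greatest common divisors are computed.\<close>

definition preal :: "'a set \<Rightarrow> ('a \<Rightarrow> val) \<Rightarrow> ('a \<Rightarrow> real) \<Rightarrow> bool" where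
  "preal D inp f \<longleftrightarrow> (\<exists>num den. polytime_on D inp (\<lambda>x. VPair (VNum (num x)) (VNum (den x))) \<and>
    (\<forall>x\<in>D. 0 < den x \<and> f x = real (num x) / real (den x)))"

lemma prealI:
  assumes "pnat D inp num" "pnat D inp den"
    "\<And>x. x \<in> D \<Longrightarrow> 0 < den x" "\<And>x. x \<in> D \<Longrightarrow> f x = real (num x) / real (den x)"
  shows "preal D inp f"
  unfolding preal_def using assms polytime_pair by blast

lemma prealE:
  assumes "preal D inp f"
  obtains num den where "pnat D inp num" "pnat D inp den"
    "\<And>x. x \<in> D \<Longrightarrow> 0 < den x" "\<And>x. x \<in> D \<Longrightarrow> f x = real (num x) / real (den x)"
proof -
  obtain num den where *: "polytime_on D inp (\<lambda>x. VPair (VNum (num x)) (VNum (den x)))"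
    "\<forall>x\<in>D. 0 < den x \<and> f x = real (num x) / real (den x)"
    using assms unfolding preal_def by blast
  show thesis
    by (rule that[OF polytime_first[OF *(1)] polytime_second[OF *(1)]]) (use *(2) in auto)
qed

lemma preal_cong: "preal D inp f \<Longrightarrow> (\<And>x. x \<in> D \<Longrightarrow> f x = g x) \<Longrightarrow> preal D inp g"
  unfolding preal_def by (metis (no_types, lifting))

lemma preal_subset: "preal D inp f \<Longrightarrow> D' \<subseteq> D \<Longrightarrow> preal D' inp f"
  unfolding preal_def by (meson polytime_subset subsetD)

lemma preal_compose:
  assumes f: "polytime_on D inp (\<lambda>x. inp' (h x))" and h: "\<And>x. x \<in> D \<Longrightarrow> h x \<in> D'"
    and g: "preal D' inp' g"
  shows "preal D inp (\<lambda>x. g (h x))"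
proof -
  obtain num den where *: "pnat D' inp' num" "pnat D' inp' den"
    "\<And>x. x \<in> D' \<Longrightarrow> 0 < den x" "\<And>x. x \<in> D' \<Longrightarrow> g x = real (num x) / real (den x)"
    using g by (rule prealE) blast
  show ?thesis
    by (rule prealI[OF polytime_compose[OF f h *(1)] polytime_compose[OF f h *(2)]])
      (use * h in auto)
qed

lemma ext_Pair: "ext inp (x, i) = VPair (inp x) (VNum i)"
  by (simp add: ext_def)

lemma preal_weaken: "preal D inp f \<Longrightarrow> preal (Sigma D A) (ext inp) (\<lambda>p. f (fst p))"
  by (rule preal_compose[where h = fst and inp' = inp and D' = D])
    (auto intro: polytime_weaken[OF polytime_input])

lemma preal_of_nat: "pnat D inp f \<Longrightarrow> preal D inp (\<lambda>x. real (f x))"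
  by (rule prealI[OF _ polytime_const[of _ _ 1]]) auto

lemma preal_numeral: "preal D inp (\<lambda>_. numeral k)" "preal D inp (\<lambda>_. 0)" "preal D inp (\<lambda>_. 1)"
  using preal_of_nat[OF polytime_const[of D inp "numeral k"]]
    preal_of_nat[OF polytime_const[of D inp 0]] preal_of_nat[OF polytime_const[of D inp 1]]
  by simp_all

lemma preal_add:
  assumes "preal D inp f" "preal D inp g"
  shows "preal D inp (\<lambda>x. f x + g x)"
proof -
  obtain a b where f: "pnat D inp a" "pnat D inp b"
    "\<And>x. x \<in> D \<Longrightarrow> 0 < b x" "\<And>x. x \<in> D \<Longrightarrow> f x = real (a x) / real (b x)"
    using assms(1) by (rule prealE) blast
  obtain c d where g: "pnat D inp c" "pnat D inp d"
    "\<And>x. x \<in> D \<Longrightarrow> 0 < d x" "\<And>x. x \<in> D \<Longrightarrow> g x = real (c x) / real (d x)"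
    using assms(2) by (rule prealE) blast
  show ?thesis
    by (rule prealI[where num = "\<lambda>x. a x * d x + c x * b x" and den = "\<lambda>x. b x * d x"])
      (use f(3,4) g(3,4) in \<open>auto intro!: pnat_add pnat_mult f(1,2) g(1,2) simp: add_frac_eq\<close>)
qed

lemma preal_mult:
  assumes "preal D inp f" "preal D inp g"
  shows "preal D inp (\<lambda>x. f x * g x)"
proof -
  obtain a b where f: "pnat D inp a" "pnat D inp b"
    "\<And>x. x \<in> D \<Longrightarrow> 0 < b x" "\<And>x. x \<in> D \<Longrightarrow> f x = real (a x) / real (b x)"
    using assms(1) by (rule prealE) blast
  obtain c d where g: "pnat D inp c" "pnat D inp d"
    "\<And>x. x \<in> D \<Longrightarrow> 0 < d x" "\<And>x. x \<in> D \<Longrightarrow> g x = real (c x) / real (d x)"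
    using assms(2) by (rule prealE) blast
  show ?thesis
    by (rule prealI[where num = "\<lambda>x. a x * c x" and den = "\<lambda>x. b x * d x"])
      (use f(3,4) g(3,4) in \<open>auto intro!: pnat_mult f(1,2) g(1,2)\<close>)
qed

lemma preal_divide:
  assumes "preal D inp f" "preal D inp g"
  shows "preal D inp (\<lambda>x. f x / g x)"
proof -
  obtain a b where f: "pnat D inp a" "pnat D inp b"
    "\<And>x. x \<in> D \<Longrightarrow> 0 < b x" "\<And>x. x \<in> D \<Longrightarrow> f x = real (a x) / real (b x)"
    using assms(1) by (rule prealE) blast
  obtain c d where g: "pnat D inp c" "pnat D inp d"
    "\<And>x. x \<in> D \<Longrightarrow> 0 < d x" "\<And>x. x \<in> D \<Longrightarrow> g x = real (c x) / real (d x)"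
    using assms(2) by (rule prealE) blast
  \<comment> \<open>Division by zero yields 0 in HOL, so a vanishing divisor is mapped to the
    fraction 0/1.\<close>
  have "pbool D inp (\<lambda>x. c x = 0)" by (intro pbool_eq g polytime_const)
  then have "pnat D inp (\<lambda>x. if c x = 0 then 0 else a x * d x)"
    "pnat D inp (\<lambda>x. if c x = 0 then 1 else b x * c x)"
    by (intro pnat_if pnat_mult polytime_const polytime_subset[OF f(1)] polytime_subset[OF f(2)]
      polytime_subset[OF g(1)] polytime_subset[OF g(2)]; blast)+
  then show ?thesis by (rule prealI) (use f(3,4) g(3,4) in auto)
qed

lemma pbool_preal_le:
  assumes "preal D inp f" "preal D inp g"
  shows "pbool D inp (\<lambda>x. f x \<le> g x)"
proof -
  obtain a b where f: "pnat D inp a" "pnat D inp b"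
    "\<And>x. x \<in> D \<Longrightarrow> 0 < b x" "\<And>x. x \<in> D \<Longrightarrow> f x = real (a x) / real (b x)"
    using assms(1) by (rule prealE) blast
  obtain c d where g: "pnat D inp c" "pnat D inp d"
    "\<And>x. x \<in> D \<Longrightarrow> 0 < d x" "\<And>x. x \<in> D \<Longrightarrow> g x = real (c x) / real (d x)"
    using assms(2) by (rule prealE) blast
  have "(f x \<le> g x) = (a x * d x \<le> c x * b x)" if "x \<in> D" for x
  proof -
    have "(f x \<le> g x) = (real (a x) * real (d x) \<le> real (c x) * real (b x))"
      unfolding f(4)[OF that] g(4)[OF that] using f(3)[OF that] g(3)[OF that]
      by (simp add: field_simps)
    then show ?thesis by (simp flip: of_nat_mult)
  qed
  then show ?thesis
    by (intro polytime_cong[OF pbool_le[OF pnat_mult[OF f(1) g(2)] pnat_mult[OF g(1) f(2)]]]) simp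
qed

lemma pbool_preal_less: "preal D inp f \<Longrightarrow> preal D inp g \<Longrightarrow> pbool D inp (\<lambda>x. f x < g x)"
  using pbool_not[OF pbool_preal_le, of D inp g f] by (simp add: not_le)

lemma pbool_preal_eq: "preal D inp f \<Longrightarrow> preal D inp g \<Longrightarrow> pbool D inp (\<lambda>x. f x = g x)"
  using pbool_conj[OF pbool_preal_le pbool_preal_le, of D inp f g g f] by (simp add: eq_iff)

lemma preal_if:
  assumes P: "pbool D inp P" and "preal {x \<in> D. P x} inp f" "preal {x \<in> D. \<not> P x} inp g"
  shows "preal D inp (\<lambda>x. if P x then f x else g x)"
proof -
  obtain a b where f: "pnat {x \<in> D. P x} inp a" "pnat {x \<in> D. P x} inp b"
    "\<And>x. x \<in> {x \<in> D. P x} \<Longrightarrow> 0 < b x" "\<And>x. x \<in> {x \<in> D. P x} \<Longrightarrow> f x = real (a x) / real (b x)"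
    using assms(2) by (rule prealE) blast
  obtain c d where g: "pnat {x \<in> D. \<not> P x} inp c" "pnat {x \<in> D. \<not> P x} inp d"
    "\<And>x. x \<in> {x \<in> D. \<not> P x} \<Longrightarrow> 0 < d x" "\<And>x. x \<in> {x \<in> D. \<not> P x} \<Longrightarrow> g x = real (c x) / real (d x)"
    using assms(3) by (rule prealE) blast
  show ?thesis
    by (rule prealI[OF pnat_if[OF P f(1) g(1)] pnat_if[OF P f(2) g(2)]]) (use f(3,4) g(3,4) in auto)
qed

lemma pnat_floor:
  assumes "preal D inp f"
  shows "pnat D inp (\<lambda>x. nat \<lfloor>f x\<rfloor>)"
proof -
  obtain a b where f: "pnat D inp a" "pnat D inp b"
    "\<And>x. x \<in> D \<Longrightarrow> 0 < b x" "\<And>x. x \<in> D \<Longrightarrow> f x = real (a x) / real (b x)"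
    using assms by (rule prealE) blast
  show ?thesis
    by (rule polytime_cong[OF pnat_div[OF f(1,2)]]) (use f(4) in \<open>simp add: floor_divide_of_nat_eq\<close>)
qed

text \<open>Numerator of the sum of the fractions \<open>a j / b j\<close> for \<open>j < i\<close>
  over the unreduced common denominator \<open>(\<Prod>j<i. b j)\<close>.\<close>

primrec fsum_num :: "(nat \<Rightarrow> nat) \<Rightarrow> (nat \<Rightarrow> nat) \<Rightarrow> nat \<Rightarrow> nat" where
  "fsum_num a b 0 = 0"
| "fsum_num a b (Suc i) = fsum_num a b i * b i + a i * (\<Prod>j<i. b j)"

lemma fsum_num:
  assumes "\<And>j. j < i \<Longrightarrow> 0 < b j"
  shows "(\<Sum>j<i. real (a j) / real (b j)) = real (fsum_num a b i) / real (\<Prod>j<i. b j)"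
  using assms by (induction i) (auto simp: add_frac_eq)

text \<open>Numerator plus denominator grows by a factor of at most \<open>a i + b i\<close> per
  summand. So \<open>n\<close> summands of \<open>S\<close> bits each lead to about
  \<open>n * S\<close> bits, although no fraction is ever reduced.\<close>

lemma fsum_num_bound: "fsum_num a b i + (\<Prod>j<i. b j) \<le> (\<Prod>j<i. a j + b j)"
proof (induction i)
  case (Suc i)
  have "fsum_num a b (Suc i) + (\<Prod>j<Suc i. b j) =
      (fsum_num a b i + (\<Prod>j<i. b j)) * b i + (\<Prod>j<i. b j) * a i"
    by (simp add: algebra_simps)
  also have "\<dots> \<le> (fsum_num a b i + (\<Prod>j<i. b j)) * b i + (fsum_num a b i + (\<Prod>j<i. b j)) * a i"
    by (intro add_left_mono mult_right_mono) auto
  also have "\<dots> = (fsum_num a b i + (\<Prod>j<i. b j)) * (a i + b i)"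
    by (simp add: algebra_simps)
  also have "\<dots> \<le> (\<Prod>j<i. a j + b j) * (a i + b i)"
    by (intro mult_right_mono Suc) auto
  finally show ?case by simp
qed auto

lemma preal_sum:
  assumes n: "pnat D inp n" "pbounded D inp n"
    and f: "preal (SIGMA x:D. {..<n x}) (ext inp) (\<lambda>p. f (fst p) (snd p))"
  shows "preal D inp (\<lambda>x. \<Sum>i<n x. f x i)"
proof -
  let ?X = "SIGMA x:D. {..<n x}"
  obtain a' b' where f: "pnat ?X (ext inp) a'" "pnat ?X (ext inp) b'"
    "\<And>p. p \<in> ?X \<Longrightarrow> 0 < b' p" "\<And>p. p \<in> ?X \<Longrightarrow> f (fst p) (snd p) = real (a' p) / real (b' p)"
    using f by (rule prealE) blast
  define a b where "a x i = a' (x, i)" and "b x i = b' (x, i)" for x i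
  define N Q where "N x i = fsum_num (a x) (b x) i" and "Q x i = (\<Prod>j<i. b x j)" for x i
  have "pbounded ?X (ext inp) (\<lambda>p. vsize (VNum (a' p + b' p)))"
    by (intro polytime_size pnat_add f)
  then obtain S where S: "pbounded D inp S"
    and ab: "\<And>x i. x \<in> D \<Longrightarrow> i < n x \<Longrightarrow> vsize (VNum (a' (x, i) + b' (x, i))) \<le> S x"
    using n(2) by (rule pbounded_uniform) blast
  have ab': "a x i + b x i \<le> 2 ^ S x" if "x \<in> D" "i < n x" for x i
  proof -
    have "floorlog 2 (a x i + b x i) \<le> S x" using ab[OF that] by (simp add: a_def b_def)
    then show ?thesis using floorlog_leD[of 2 "a x i + b x i" "S x"] by simp
  qed
  have bits: "N x i + Q x i \<le> 2 ^ (n x * S x)" if "x \<in> D" "i \<le> n x" for x i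
  proof -
    have "N x i + Q x i \<le> (\<Prod>j<i. a x j + b x j)" unfolding N_def Q_def by (rule fsum_num_bound)
    also have "\<dots> \<le> (\<Prod>j<i. 2 ^ S x)" by (intro prod_mono) (use ab' that in auto)
    also have "\<dots> = 2 ^ (S x * i)" by (simp add: power_mult)
    also have "\<dots> \<le> 2 ^ (n x * S x)" using that(2) by (intro power_increasing) auto
    finally show ?thesis .
  qed
  let ?st = "\<lambda>x i. VPair (VNum (N x i)) (VNum (Q x i))"
  have "polytime_on D inp (\<lambda>x. ?st x (n x))"
  proof (rule polytime_for[OF n])
    show "polytime_on D inp (\<lambda>x. ?st x 0)"
      by (simp add: N_def Q_def polytime_pair polytime_const)
    let ?inp = "\<lambda>p. VPair (ext inp p) (?st (fst p) (snd p))"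
    note in1 = polytime_first[OF polytime_input[of ?X ?inp]]
      and in2 = polytime_second[OF polytime_input[of ?X ?inp]]
    have a: "pnat ?X ?inp a'" and b: "pnat ?X ?inp b'"
      by (rule polytime_compose[where h = "\<lambda>x. x", OF in1 _ f(1)], assumption)
        (rule polytime_compose[where h = "\<lambda>x. x", OF in1 _ f(2)], assumption)
    have "polytime_on ?X ?inp (\<lambda>p. VPair (VNum (N (fst p) (snd p) * b' p + a' p * Q (fst p) (snd p)))
        (VNum (Q (fst p) (snd p) * b' p)))"
      by (intro polytime_pair pnat_add pnat_mult a b polytime_first[OF in2] polytime_second[OF in2])
    then show "polytime_on ?X ?inp (\<lambda>p. ?st (fst p) (Suc (snd p)))"
      by (rule polytime_cong) (simp add: N_def Q_def a_def b_def)
    show "pbounded D inp (\<lambda>x. 1 + (1 + (n x * S x + 1)) + (1 + (n x * S x + 1)))"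
      by (intro pbounded_add pbounded_mult pbounded_const n S)
    fix x i assume x: "x \<in> D" "i \<le> n x"
    have "N x i < 2 ^ (n x * S x + 1)" "Q x i < 2 ^ (n x * S x + 1)"
    proof -
      have "0 < (2::nat) ^ (n x * S x)" by simp
      with bits[OF x] show "N x i < 2 ^ (n x * S x + 1)" "Q x i < 2 ^ (n x * S x + 1)"
        unfolding power_add power_one_right by linarith+
    qed
    then have "floorlog 2 (N x i) \<le> n x * S x + 1" "floorlog 2 (Q x i) \<le> n x * S x + 1"
      by (intro floorlog_leI; simp)+
    then show "vsize (?st x i) \<le> 1 + (1 + (n x * S x + 1)) + (1 + (n x * S x + 1))" by simp
  qed
  note NQ = polytime_first[OF this] polytime_second[OF this]
  have pos: "0 < b x i" and fab: "f x i = real (a x i) / real (b x i)" if "x \<in> D" "i < n x" for x i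
    using f(3,4)[of "(x, i)"] that by (simp_all add: a_def b_def)
  show ?thesis
  proof (rule prealI[OF NQ])
    show "0 < Q x (n x)" if "x \<in> D" for x
      unfolding Q_def using pos[OF that] by (intro prod_pos) auto
    show "(\<Sum>i<n x. f x i) = real (N x (n x)) / real (Q x (n x))" if "x \<in> D" for x
      unfolding N_def Q_def using pos[OF that]
      by (subst fsum_num[symmetric]) (simp_all add: fab[OF that])
  qed
qed

lemma preal_indicator: "pbool D inp P \<Longrightarrow> preal D inp (\<lambda>x. of_bool (P x))"
  using preal_of_nat[of D inp "\<lambda>x. of_bool (P x)"] by simp

text \<open>A bounded quantifier is the positivity of a sum of indicators, so
  \<open>preal_sum\<close> applies and no new loop has to be analysed.\<close>

lemma pbool_bex:
  assumes "pnat D inp n" "pbounded D inp n"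
    and P: "pbool (SIGMA x:D. {..<n x}) (ext inp) (\<lambda>p. P (fst p) (snd p))"
  shows "pbool D inp (\<lambda>x. \<exists>i<n x. P x i)"
proof -
  have "pbool D inp (\<lambda>x. 0 < (\<Sum>i<n x. of_bool (P x i) :: real))"
    by (intro pbool_preal_less preal_sum assms preal_indicator preal_numeral)
  then show ?thesis
    by (rule polytime_cong) (auto simp: sum_nonneg sum_nonneg_eq_0_iff less_le)
qed

lemma pbool_ball:
  assumes "pnat D inp n" "pbounded D inp n"
    and P: "pbool (SIGMA x:D. {..<n x}) (ext inp) (\<lambda>p. P (fst p) (snd p))"
  shows "pbool D inp (\<lambda>x. \<forall>i<n x. P x i)"
  using pbool_not[OF pbool_bex[OF assms(1,2) pbool_not[OF P]]] by simp

text \<open>The sum counts the \<open>t\<close> such that no \<open>s \<le> t\<close> satisfies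
  \<open>P\<close>, and these are exactly the numbers below the minimum. Minimisation thereby
  becomes a sum over a bounded quantifier.\<close>

lemma Least_eq_sum:
  fixes P :: "nat \<Rightarrow> bool"
  assumes "\<exists>t<n. P t"
  shows "(LEAST t. P t) = (\<Sum>t<n. of_bool (\<forall>s<Suc t. \<not> P s))"
proof -
  let ?l = "LEAST t. P t"
  have l: "P ?l" "?l < n" using assms by (auto intro: LeastI Least_le le_less_trans)
  have "(\<forall>s<Suc t. \<not> P s) = (t < ?l)" for t
    using l(1) not_less_Least[of _ P] by (metis less_Suc_eq_le le_less_trans not_le)
  then have "(\<Sum>t<n. of_bool (\<forall>s<Suc t. \<not> P s)) = card {t. t < n \<and> t < ?l}"
    by (simp add: of_bool_def sum.If_cases lessThan_def Int_def)
  also have "{t. t < n \<and> t < ?l} = {..<?l}" using l(2) by auto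
  finally show ?thesis by simp
qed

lemma pbounded_weaken: "pbounded D inp f \<Longrightarrow> pbounded (Sigma D A) (ext inp) (\<lambda>p. f (fst p))"
  by (rule pbounded_compose[where D' = D and inp' = inp])
    (auto intro: polytime_size[OF polytime_weaken[OF polytime_input]])

lemma pbounded_index: "pbounded D inp n \<Longrightarrow> pbounded (SIGMA x:D. {..<n x}) (ext inp) snd"
  by (rule pbounded_mono[OF pbounded_weaken]) auto

lemma pnat_Least:
  assumes n: "pnat D inp n" "pbounded D inp n"
    and P: "pbool (SIGMA x:D. {..<n x}) (ext inp) (\<lambda>p. P (fst p) (snd p))"
    and ex: "\<And>x. x \<in> D \<Longrightarrow> \<exists>t<n x. P x t"
  shows "pnat D inp (\<lambda>x. LEAST t. P x t)"
proof -
  let ?X = "SIGMA x:D. {..<n x}"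
  let ?Y = "SIGMA p:?X. {..<Suc (snd p)}"
  have Suc: "pnat ?X (ext inp) (\<lambda>p. Suc (snd p))" "pbounded ?X (ext inp) (\<lambda>p. Suc (snd p))"
    using pnat_add[OF pnat_index polytime_const[of _ _ 1]]
      pbounded_add[OF pbounded_index[OF n(2)] pbounded_const[of _ _ 1]] by simp_all
  have "polytime_on ?Y (ext (ext inp)) (\<lambda>q. ext inp (fst (fst q), snd q))"
    unfolding ext_Pair
    by (intro polytime_pair pnat_index polytime_weaken[OF polytime_first[OF polytime_ext]])
  from polytime_compose[OF this _ P]
  have "pbool ?Y (ext (ext inp)) (\<lambda>q. P (fst (fst q)) (snd q))" by force
  then have "pbool ?X (ext inp) (\<lambda>p. \<forall>s<Suc (snd p). \<not> P (fst p) s)"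
    by (intro pbool_ball Suc pbool_not)
  then have "pnat D inp (\<lambda>x. nat \<lfloor>\<Sum>t<n x. of_bool (\<forall>s<Suc t. \<not> P x s) :: real\<rfloor>)"
    by (intro pnat_floor preal_sum n preal_indicator)
  then show ?thesis
  proof (rule polytime_cong)
    fix x assume "x \<in> D"
    have "(\<Sum>t<n x. of_bool (\<forall>s<Suc t. \<not> P x s) :: real) = real (\<Sum>t<n x. of_bool (\<forall>s<Suc t. \<not> P x s))"
      by simp
    then show "VNum (nat \<lfloor>\<Sum>t<n x. of_bool (\<forall>s<Suc t. \<not> P x s) :: real\<rfloor>) = VNum (LEAST t. P x t)"
      unfolding Least_eq_sum[OF ex[OF \<open>x \<in> D\<close>]] by simp
  qed
qed

text \<open>The exponent has to be polynomially bounded as a number, not only in length, since the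
  result has about \<open>h x\<close> bits.\<close>

lemma pnat_power2:
  assumes h: "pnat D inp h" "pbounded D inp h"
  shows "pnat D inp (\<lambda>x. 2 ^ h x)"
proof (rule polytime_for[OF h, where st = "\<lambda>x i. VNum (2 ^ i)"])
  let ?inp = "\<lambda>p. VPair (ext inp p) (VNum (2 ^ snd p))"
  have "pnat (SIGMA x:D. {..<h x}) ?inp (\<lambda>p. 2 ^ snd p + 2 ^ snd p)"
    by (intro pnat_add polytime_second[OF polytime_input])
  then show "pnat (SIGMA x:D. {..<h x}) ?inp (\<lambda>p. 2 ^ Suc (snd p))"
    by (simp add: mult_2)
  show "pbounded D inp (\<lambda>x. h x + 2)" by (intro pbounded_add h pbounded_const)
  show "vsize (VNum (2 ^ i)) \<le> h x + 2" if "i \<le> h x" for x i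
    using floorlog_leI[of "2 ^ i" 2 "Suc i"] that by simp
qed (auto intro: polytime_const)

lemma floorlog_gt_iff: "i < floorlog 2 n \<longleftrightarrow> 2 ^ i \<le> n"
proof -
  have "floorlog 2 n \<le> i \<longleftrightarrow> n < 2 ^ i"
    using floorlog_leI[of n 2 i] floorlog_leD[of 2 n i] by auto
  then show ?thesis by linarith
qed

text \<open>Repeated halving down to zero. The number of rounds is the result itself and not known
  beforehand, hence \<open>polytime_while\<close> with an exit test on the state instead of
  \<open>polytime_for\<close>.\<close>

lemma pnat_floorlog:
  assumes h: "pnat D inp h"
  shows "pnat D inp (\<lambda>x. floorlog 2 (h x))" "pbounded D inp (\<lambda>x. floorlog 2 (h x))"
proof -
  show b: "pbounded D inp (\<lambda>x. floorlog 2 (h x))"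
    by (rule pbounded_mono[OF polytime_size[OF h]]) simp
  let ?n = "\<lambda>x. floorlog 2 (h x)"
  let ?st = "\<lambda>x i. VPair (VNum (h x div 2 ^ i)) (VNum i)"
  note in0 = polytime_input[of _ "\<lambda>(x, i). ?st x i", unfolded split_def]
  note in1 = polytime_first[OF in0] and in2 = polytime_second[OF in0]
  have "polytime_on D inp (\<lambda>x. ?st x (?n x))"
  proof (rule polytime_while)
    show "polytime_on D inp (\<lambda>x. ?st x 0)" using h by (simp add: polytime_pair polytime_const)
    have "1 \<le> h x div 2 ^ i \<longleftrightarrow> i < ?n x" for x i
      by (simp add: floorlog_gt_iff Suc_le_eq div_greater_zero_iff)
    then show "pbool (SIGMA x:D. {..?n x}) (\<lambda>(x, i). ?st x i) (\<lambda>(x, i). i < ?n x)"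
      using pbool_le[OF polytime_const[of _ _ 1] in1, of "SIGMA x:D. {..?n x}"]
      by (simp add: split_def)
    have "polytime_on (SIGMA x:D. {..<?n x}) (\<lambda>p. ?st (fst p) (snd p))
       (\<lambda>p. VPair (VNum (h (fst p) div 2 ^ snd p div 2)) (VNum (snd p + 1)))"
      by (intro polytime_pair pnat_div pnat_add in1 in2 polytime_const)
    then show "polytime_on (SIGMA x:D. {..<?n x}) (\<lambda>(x, i). ?st x i) (\<lambda>(x, i). ?st x (Suc i))"
      unfolding split_def by (rule polytime_cong) (simp add: div_mult2_eq[symmetric] mult.commute)
    show "pbounded D inp ?n" by (fact b)
    show "pbounded D inp (\<lambda>x. 3 + ?n x + ?n x)" by (intro pbounded_add b pbounded_const)
    show "vsize (?st x i) \<le> 3 + ?n x + ?n x" if "i \<le> ?n x" for x i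
      using that floorlog_le_self[of i] floorlog_mono[of "h x div 2 ^ i" "h x" 2] by simp
  qed
  then show "pnat D inp ?n" by (rule polytime_second)
qed

section \<open>Encoded lists\<close>

lemma vsize_enc_list: "vsize (enc_list e xs) = 1 + length xs + (\<Sum>x\<leftarrow>xs. vsize (e x))"
  by (induction xs) (auto simp: enc_list_def floorlog_def)

lemma enc_list_Cons: "enc_list e (x # xs) = VPair (e x) (enc_list e xs)"
  and enc_list_Nil: "enc_list e [] = VNum 0"
  by (simp_all add: enc_list_def)

lemma vsize_enc_list_drop: "vsize (enc_list e (drop i xs)) \<le> vsize (enc_list e xs)"
proof -
  have "(\<Sum>x\<leftarrow>xs. vsize (e x)) = (\<Sum>x\<leftarrow>take i xs. vsize (e x)) + (\<Sum>x\<leftarrow>drop i xs. vsize (e x))"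
    by (metis append_take_drop_id map_append sum_list.append)
  then show ?thesis by (simp add: vsize_enc_list)
qed

lemma polytime_length:
  assumes l: "polytime_on D inp (\<lambda>x. enc_list e (xs x))"
  shows "pnat D inp (\<lambda>x. length (xs x))" "pbounded D inp (\<lambda>x. length (xs x))"
proof -
  let ?n = "\<lambda>x. length (xs x)"
  show b: "pbounded D inp ?n"
    by (rule pbounded_mono[OF polytime_size[OF l]]) (simp add: vsize_enc_list)
  let ?st = "\<lambda>x i. VPair (enc_list e (drop i (xs x))) (VNum i)"
  note in0 = polytime_input[of _ "\<lambda>(x, i). ?st x i", unfolded split_def]
  note in1 = polytime_first[OF in0] and in2 = polytime_second[OF in0]
  have "polytime_on D inp (\<lambda>x. ?st x (?n x))"
  proof (rule polytime_while)
    show "polytime_on D inp (\<lambda>x. ?st x 0)" using l by (simp add: polytime_pair polytime_const)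
    have "apply_prim IsNum (enc_list e ys) = VNum (of_bool (\<not> 0 < length ys))" for ys
      by (cases ys) (auto simp: enc_list_def)
    then have "pbool (SIGMA x:D. {..?n x}) (\<lambda>p. ?st (fst p) (snd p)) (\<lambda>p. \<not> 0 < length (drop (snd p) (xs (fst p))))"
      using polytime_prim[OF in1, of "SIGMA x:D. {..?n x}" IsNum] by (simp only:)
    from pbool_not[OF this]
    show "pbool (SIGMA x:D. {..?n x}) (\<lambda>(x, i). ?st x i) (\<lambda>(x, i). i < ?n x)"
      unfolding split_def by (rule polytime_cong) simp
    have "polytime_on (SIGMA x:D. {..<?n x}) (\<lambda>p. ?st (fst p) (snd p))
       (\<lambda>p. VPair (apply_prim Second (enc_list e (drop (snd p) (xs (fst p))))) (VNum (snd p + 1)))"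
      by (intro polytime_pair polytime_prim pnat_add in1 in2 polytime_const)
    then show "polytime_on (SIGMA x:D. {..<?n x}) (\<lambda>(x, i). ?st x i) (\<lambda>(x, i). ?st x (Suc i))"
      unfolding split_def by (rule polytime_cong) (auto simp: Cons_nth_drop_Suc[symmetric] enc_list_Cons)
    show "pbounded D inp ?n" by (fact b)
    show "pbounded D inp (\<lambda>x. 2 + vsize (enc_list e (xs x)) + ?n x)"
      by (intro pbounded_add b pbounded_const polytime_size l)
    show "vsize (?st x i) \<le> 2 + vsize (enc_list e (xs x)) + ?n x" if "i \<le> ?n x" for x i
      using that floorlog_le_self[of i] vsize_enc_list_drop[of e i "xs x"] by simp
  qed
  then show "pnat D inp ?n" by (rule polytime_second)
qed

lemma polytime_nth:
  assumes l: "polytime_on D inp (\<lambda>x. enc_list e (xs x))" and h: "pnat D inp h"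
    and less: "\<And>x. x \<in> D \<Longrightarrow> h x < length (xs x)"
  shows "polytime_on D inp (\<lambda>x. e (xs x ! h x))"
proof -
  let ?st = "\<lambda>x i. enc_list e (drop i (xs x))"
  have "polytime_on D inp (\<lambda>x. ?st x (h x))"
  proof (rule polytime_for[OF h])
    show "pbounded D inp h"
      by (rule pbounded_mono[OF polytime_length(2)[OF l]]) (use less in force)
    show "polytime_on D inp (\<lambda>x. ?st x 0)" using l by simp
    have "polytime_on (SIGMA x:D. {..<h x}) (\<lambda>p. VPair (ext inp p) (?st (fst p) (snd p)))
        (\<lambda>p. apply_prim Second (?st (fst p) (snd p)))"
      by (intro polytime_prim polytime_second[OF polytime_input])
    then show "polytime_on (SIGMA x:D. {..<h x}) (\<lambda>p. VPair (ext inp p) (?st (fst p) (snd p)))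
        (\<lambda>p. ?st (fst p) (Suc (snd p)))"
    proof (rule polytime_cong)
      fix p assume "p \<in> (SIGMA x:D. {..<h x})"
      then have "snd p < length (xs (fst p))" using less[of "fst p"] by auto
      then show "apply_prim Second (?st (fst p) (snd p)) = ?st (fst p) (Suc (snd p))"
        by (simp add: Cons_nth_drop_Suc[symmetric] enc_list_Cons)
    qed
    show "pbounded D inp (\<lambda>x. vsize (enc_list e (xs x)))" by (intro polytime_size l)
    show "vsize (?st x i) \<le> vsize (enc_list e (xs x))" for x i by (rule vsize_enc_list_drop)
  qed
  from polytime_prim[OF this, of First] show ?thesis
    by (rule polytime_cong) (use less in \<open>simp add: Cons_nth_drop_Suc[symmetric] enc_list_Cons\<close>)
qed

text \<open>An encoded list is easily extended at its front, so the indices are processed from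
  \<open>n x - 1\<close> downwards: after \<open>i\<close> rounds the state is the list for the last
  \<open>i\<close> indices.\<close>

lemma polytime_comprehension:
  assumes n: "pnat D inp n" "pbounded D inp n"
    and P: "pbool (SIGMA x:D. {..<n x}) (ext inp) (\<lambda>p. P (fst p) (snd p))"
    and f: "polytime_on (SIGMA x:D. {..<n x}) (ext inp) (\<lambda>p. f (fst p) (snd p))"
  shows "polytime_on D inp (\<lambda>x. enc_list (f x) (filter (P x) [0..<n x]))"
proof -
  let ?X = "SIGMA x:D. {..<n x}"
  let ?st = "\<lambda>x i. enc_list (f x) (filter (P x) [n x - i..<n x])"
  obtain S where S: "pbounded D inp S"
    and fS: "\<And>x i. x \<in> D \<Longrightarrow> i < n x \<Longrightarrow> vsize (f x i) \<le> S x"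
    using pbounded_uniform[OF polytime_size[OF f] n(2)] by auto
  have "polytime_on D inp (\<lambda>x. ?st x (n x))"
  proof (rule polytime_for[OF n, where st = ?st and S = "\<lambda>x. 1 + n x + n x * S x"])
    show "polytime_on D inp (\<lambda>x. ?st x 0)" by (simp add: enc_list_Nil polytime_const)
    let ?inp = "\<lambda>p. VPair (ext inp p) (?st (fst p) (snd p))"
    let ?h = "\<lambda>p. (fst p, n (fst p) - 1 - snd p)"
    note in1 = polytime_first[OF polytime_input[of ?X ?inp]]
      and in2 = polytime_second[OF polytime_input[of ?X ?inp]]
    have weak: "polytime_on ?X ?inp g" if "polytime_on ?X (ext inp) g" for g
      by (rule polytime_compose[where h = "\<lambda>x. x", OF in1 _ that])
    have h: "polytime_on ?X ?inp (\<lambda>p. ext inp (?h p))"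
      unfolding ext_Pair
      by (intro polytime_pair pnat_diff weak[OF polytime_weaken] weak[OF pnat_index] polytime_input n polytime_const)
    have Pf: "pbool ?X ?inp (\<lambda>p. P (fst p) (n (fst p) - 1 - snd p))"
      "polytime_on ?X ?inp (\<lambda>p. f (fst p) (n (fst p) - 1 - snd p))"
      using polytime_compose[OF h _ P] polytime_compose[OF h _ f] by force+
    have "polytime_on ?X ?inp (\<lambda>p. if P (fst p) (n (fst p) - 1 - snd p)
        then VPair (f (fst p) (n (fst p) - 1 - snd p)) (?st (fst p) (snd p)) else ?st (fst p) (snd p))"
      by (intro polytime_if Pf polytime_subset[OF polytime_pair[OF Pf(2) in2]] polytime_subset[OF in2]) auto
    then show "polytime_on ?X ?inp (\<lambda>p. ?st (fst p) (Suc (snd p)))"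
    proof (rule polytime_cong)
      fix p assume "p \<in> ?X"
      then have "[n (fst p) - Suc (snd p)..<n (fst p)] =
          (n (fst p) - 1 - snd p) # [n (fst p) - snd p..<n (fst p)]"
        by (subst upt_conv_Cons) (auto simp: Suc_diff_Suc)
      then show "(if P (fst p) (n (fst p) - 1 - snd p)
          then VPair (f (fst p) (n (fst p) - 1 - snd p)) (?st (fst p) (snd p)) else ?st (fst p) (snd p))
          = ?st (fst p) (Suc (snd p))" by (simp add: enc_list_Cons)
    qed
    show "pbounded D inp (\<lambda>x. 1 + n x + n x * S x)"
      by (intro pbounded_add pbounded_mult pbounded_const n S)
    fix x i assume x: "x \<in> D" "i \<le> n x"
    let ?l = "filter (P x) [n x - i..<n x]"
    have "length ?l \<le> n x" by (rule order_trans[OF length_filter_le]) simp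
    moreover have "(\<Sum>j\<leftarrow>?l. vsize (f x j)) \<le> (\<Sum>j\<leftarrow>?l. S x)"
      by (rule sum_list_mono) (use fS x in auto)
    moreover have "\<dots> \<le> n x * S x" using \<open>length ?l \<le> n x\<close> by (simp add: sum_list_triv)
    ultimately show "vsize (?st x i) \<le> 1 + n x + n x * S x" by (simp add: vsize_enc_list)
  qed
  then show ?thesis by simp
qed

section \<open>Expectations over finitely supported product distributions\<close>

abbreviation expect :: "'a pmf \<Rightarrow> ('a \<Rightarrow> real) \<Rightarrow> real" where
  "expect M f \<equiv> measure_pmf.expectation M f"

lemma E_mono:
  assumes "finite (set_pmf M)" "\<And>x. x \<in> set_pmf M \<Longrightarrow> f x \<le> g x"
  shows "expect M f \<le> (expect M g :: real)"
  using assms by (intro integral_mono_AE) (auto simp: integrable_measure_pmf_finite AE_measure_pmf_iff)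

lemma E_cong:
  assumes "\<And>x. x \<in> set_pmf M \<Longrightarrow> f x = g x"
  shows "expect M f = (expect M g :: real)"
  using assms by (intro integral_cong_AE) (auto simp: AE_measure_pmf_iff)

lemma E_nonneg:
  assumes "\<And>x. x \<in> set_pmf M \<Longrightarrow> 0 \<le> f x"
  shows "0 \<le> (expect M f :: real)"
  using assms by (intro integral_nonneg_AE) (auto simp: AE_measure_pmf_iff)

lemma E_add:
  assumes "finite (set_pmf M)"
  shows "expect M (\<lambda>x. f x + g x) =
    expect M f + (expect M g :: real)"
  using assms by (intro Bochner_Integration.integral_add integrable_measure_pmf_finite)

lemma E_sum:
  assumes "finite (set_pmf M)"
  shows "expect M (\<lambda>x. \<Sum>i\<in>A. f i x) =
    (\<Sum>i\<in>A. expect M (f i) :: real)"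
  using assms by (intro Bochner_Integration.integral_sum integrable_measure_pmf_finite)

lemma E_zero_imp:
  assumes "finite (set_pmf M)" "\<And>x. x \<in> set_pmf M \<Longrightarrow> 0 \<le> f x"
    "expect M f = (0 :: real)" "x \<in> set_pmf M"
  shows "f x = 0"
proof -
  have "AE x in M. f x = 0"
    using assms by (subst integral_nonneg_eq_0_iff_AE[symmetric])
      (auto simp: integrable_measure_pmf_finite AE_measure_pmf_iff)
  with assms(4) show ?thesis by (auto simp: AE_measure_pmf_iff)
qed

lemma E_bind:
  fixes f :: "'b \<Rightarrow> real"
  assumes "finite (set_pmf M)" "\<And>x. x \<in> set_pmf M \<Longrightarrow> finite (set_pmf (K x))"
  shows "expect (bind_pmf M K) f =
    expect M (\<lambda>x. expect (K x) f)"
proof -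
  have "expect (bind_pmf M K) f =
      (\<Sum>a\<in>set_pmf M. pmf M a *\<^sub>R expect (K a) f)"
    by (rule pmf_expectation_bind) (use assms in auto)
  also have "\<dots> = expect M (\<lambda>x. expect (K x) f)"
    using assms by (subst integral_measure_pmf_real[of "set_pmf M"]) (auto simp: mult.commute)
  finally show ?thesis .
qed

lemma E_pair:
  fixes f :: "'a \<times> 'b \<Rightarrow> real"
  assumes "finite (set_pmf M)" "finite (set_pmf K)"
  shows "expect (pair_pmf M K) f =
    expect M (\<lambda>x. expect K (\<lambda>y. f (x, y)))"
  unfolding pair_pmf_def using assms by (simp add: E_bind)

section \<open>Independent nonnegative sizes of finite support\<close>

locale job_sizes =
  fixes Q :: "nat \<Rightarrow> real pmf"
  assumes fin: "finite (set_pmf (Q i))" and nonneg: "x \<in> set_pmf (Q i) \<Longrightarrow> 0 \<le> x"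
begin

abbreviation P :: "nat set \<Rightarrow> (nat \<Rightarrow> real) pmf" where
  "P A \<equiv> Pi_pmf A 0 Q"

lemma set_P: "finite A \<Longrightarrow> v \<in> set_pmf (P A) \<longleftrightarrow> (\<forall>i. v i \<in> (if i \<in> A then set_pmf (Q i) else {0}))"
  by (auto simp: set_Pi_pmf PiE_dflt_def)

lemma finite_P: "finite A \<Longrightarrow> finite (set_pmf (P A))"
  by (simp add: set_Pi_pmf finite_PiE_dflt fin)

lemma P_nonneg: "finite A \<Longrightarrow> v \<in> set_pmf (P A) \<Longrightarrow> 0 \<le> v i"
  using nonneg[of "v i" i] by (auto simp: set_P dest: spec[of _ i] split: if_splits)

lemma E_insert:
  fixes f :: "(nat \<Rightarrow> real) \<Rightarrow> real"
  assumes "finite A" "i \<notin> A"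
  shows "expect (P (insert i A)) f =
    expect (Q i) (\<lambda>x. expect (P A) (\<lambda>v. f (v(i := x))))"
  using assms by (simp add: Pi_pmf_insert E_pair fin finite_P split_def)

lemma E_union:
  fixes f g :: "(nat \<Rightarrow> real) \<Rightarrow> real"
  assumes "finite A" "finite B" "A \<inter> B = {}"
    and f: "\<And>v w. (\<And>i. i \<in> A \<Longrightarrow> v i = w i) \<Longrightarrow> f v = f w"
    and g: "\<And>v w. (\<And>i. i \<in> B \<Longrightarrow> v i = w i) \<Longrightarrow> g v = g w"
  shows "expect (P (A \<union> B)) (\<lambda>v. f v * g v) =
    expect (P A) f * expect (P B) g"
proof -
  have "f (\<lambda>x. if x \<in> A then v x else w x) = f v" for v w by (rule f) auto
  moreover have "g (\<lambda>x. if x \<in> A then v x else w x) = g w" for v w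
    by (rule g) (use assms(3) in auto)
  ultimately show ?thesis
    using assms(1-3) by (simp add: Pi_pmf_union E_pair finite_P split_def)
qed

lemma E_marginal:
  fixes f :: "(nat \<Rightarrow> real) \<Rightarrow> real"
  assumes "finite A" "B \<subseteq> A"
    and f: "\<And>v w. (\<And>i. i \<in> B \<Longrightarrow> v i = w i) \<Longrightarrow> f v = f w"
  shows "expect (P A) f = expect (P B) f"
proof -
  have "f (\<lambda>x. if x \<in> B then v x else 0) = f v" for v by (rule f) auto
  then show ?thesis using assms(1,2) by (simp add: Pi_pmf_subset[of A B])
qed

lemma E_component:
  fixes f :: "real \<Rightarrow> real"
  assumes "finite A" "i \<in> A"
  shows "expect (P A) (\<lambda>v. f (v i)) = expect (Q i) f"
proof -
  have "expect (map_pmf (\<lambda>v. v i) (P A)) f = expect (Q i) f"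
    using assms by (simp add: Pi_pmf_component)
  then show ?thesis by simp
qed

text \<open>The form in which the independence of different machines enters: each factor depends
  only on the jobs of its own group.\<close>

lemma E_prod_groups:
  fixes g :: "nat \<Rightarrow> (nat \<Rightarrow> real) \<Rightarrow> real"
  assumes "\<And>k. finite (A k)" "\<And>k l. k \<noteq> l \<Longrightarrow> A k \<inter> A l = {}"
    and g: "\<And>k v w. (\<And>i. i \<in> A k \<Longrightarrow> v i = w i) \<Longrightarrow> g k v = g k w"
  shows "expect (P (\<Union>k<K. A k)) (\<lambda>v. \<Prod>k<K. g k v) =
    (\<Prod>k<K. expect (P (A k)) (g k))"
proof (induction K)
  case (Suc K)
  have "expect (P ((\<Union>k<K. A k) \<union> A K)) (\<lambda>v. (\<Prod>k<K. g k v) * g K v) =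
     expect (P (\<Union>k<K. A k)) (\<lambda>v. \<Prod>k<K. g k v) *
     expect (P (A K)) (g K)"
  proof (rule E_union)
    have "A k \<inter> A K = {}" if "k < K" for k using assms(2)[of k K] that by simp
    then show "(\<Union>k<K. A k) \<inter> A K = {}" by blast
    show "(\<Prod>k<K. g k v) = (\<Prod>k<K. g k w)" if "\<And>i. i \<in> (\<Union>k<K. A k) \<Longrightarrow> v i = w i" for v w
    proof (intro prod.cong refl)
      fix k assume "k \<in> {..<K}"
      then show "g k v = g k w" using that by (intro g) blast
    qed
    show "finite (\<Union>k<K. A k)" "finite (A K)" using assms(1) by auto
  qed (rule g)
  moreover have "(\<Union>k<Suc K. A k) = (\<Union>k<K. A k) \<union> A K" by (auto simp: less_Suc_eq)
  ultimately show ?case using Suc by simp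
qed auto

lemma E_prod_singletons:
  fixes g :: "nat \<Rightarrow> real \<Rightarrow> real"
  assumes "finite A" "\<And>i x. 0 \<le> g i x"
  shows "expect (P A) (\<lambda>v. \<Prod>i\<in>A. g i (v i)) =
    (\<Prod>i\<in>A. expect (Q i) (g i))"
  using assms by (intro expectation_prod_Pi_pmf) (auto simp: integrable_measure_pmf_finite fin)

text \<open>The sum exceeds the level \<open>r\<close> by at most \<open>H\<close> when it first crosses it; what comes after
  the crossing is independent and contributes a factor of at most \<open>M\<close>.\<close>

lemma first_crossing:
  fixes t :: "real \<Rightarrow> real"
  assumes "finite A" and t: "\<And>x. 0 \<le> t x" "\<And>x. t x \<le> H" and "0 \<le> r"
    and M: "\<And>B. B \<subseteq> A \<Longrightarrow> expect (P B) (\<lambda>v. 4 powr (\<Sum>i\<in>B. t (v i))) \<le> M"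
  shows "expect (P A) (\<lambda>v. 4 powr (\<Sum>i\<in>A. t (v i))) \<le>
    4 powr r + expect (P A) (\<lambda>v. of_bool (r < (\<Sum>i\<in>A. t (v i)))) * (4 powr (r + H) * M)"
  using assms(1,4) M
proof (induction A arbitrary: r)
  case empty
  then show ?case by (simp add: ge_one_powr_ge_zero)
next
  case (insert j A)
  let ?S = "\<lambda>v. \<Sum>i\<in>A. t (v i)"
  define G where "G s = expect (P A) (\<lambda>v. of_bool (s < ?S v) :: real)" for s
  define F where "F = expect (P A) (\<lambda>v. 4 powr ?S v)"
  have "F \<le> M" unfolding F_def by (rule insert.prems(2)) auto
  moreover have "0 \<le> F" unfolding F_def by (rule E_nonneg) auto
  ultimately have M0: "0 \<le> M" by linarith
  have upd: "(\<Sum>i\<in>insert j A. t ((v(j := x)) i)) = t x + ?S v" for v x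
    using insert.hyps by (auto intro!: sum.cong)
  \<comment> \<open>The size \<open>x\<close> of the new job is held fixed. If it stays within the
    level, the induction hypothesis applies at the lower level \<open>r - t x\<close>, and the
    factor \<open>4 powr t x\<close> restores the exponents; otherwise this job is the one that
    crosses.\<close>
  have step: "4 powr t x * F \<le> 4 powr r +
      expect (P A) (\<lambda>v. of_bool (r < t x + ?S v)) * (4 powr (r + H) * M)" for x
  proof (cases "t x \<le> r")
    case True
    have "F \<le> 4 powr (r - t x) + G (r - t x) * (4 powr (r - t x + H) * M)"
      unfolding F_def G_def using True by (intro insert.IH insert.prems(2)) auto
    then have "4 powr t x * F \<le> 4 powr t x * (4 powr (r - t x) + G (r - t x) * (4 powr (r - t x + H) * M))"
      by (intro mult_left_mono) auto
    also have "\<dots> = 4 powr r + G (r - t x) * (4 powr (r + H) * M)"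
      by (simp add: algebra_simps flip: powr_add)
    also have "G (r - t x) = expect (P A) (\<lambda>v. of_bool (r < t x + ?S v))"
      unfolding G_def by (rule E_cong) (simp add: less_diff_eq diff_less_eq add.commute)
    finally show ?thesis .
  next
    case False
    then have "r < t x + ?S v" for v
      using sum_nonneg[of A "\<lambda>i. t (v i)"] t(1) by (smt (verit))
    then have E1: "expect (P A) (\<lambda>v. of_bool (r < t x + ?S v)) = (1 :: real)" by simp
    have "4 powr t x * F \<le> 4 powr (r + H) * M"
      using t(2)[of x] insert.prems(1) \<open>F \<le> M\<close> \<open>0 \<le> F\<close> by (intro mult_mono) auto
    moreover have "0 \<le> (4::real) powr r" by simp
    ultimately show ?thesis unfolding E1 by linarith
  qed
  have "expect (P (insert j A)) (\<lambda>v. 4 powr (\<Sum>i\<in>insert j A. t (v i))) =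
      expect (Q j) (\<lambda>x. 4 powr t x * F)"
    unfolding F_def E_insert[OF insert.hyps(1,2)] upd powr_add by simp
  also have "\<dots> \<le> expect (Q j) (\<lambda>x. 4 powr r +
      expect (P A) (\<lambda>v. of_bool (r < t x + ?S v)) * (4 powr (r + H) * M))"
    by (intro E_mono fin step)
  also have "\<dots> = 4 powr r + expect (P (insert j A))
      (\<lambda>v. of_bool (r < (\<Sum>i\<in>insert j A. t (v i)))) * (4 powr (r + H) * M)"
    unfolding E_insert[OF insert.hyps(1,2)] upd by (subst E_add[OF fin]) simp
  finally show ?case .
qed

text \<open>The crossing bound with \<open>r = H\<close> and with \<open>M\<close> the moment
  itself, which dominates the moments over all subsets, reads
  \<open>M \<le> 4 powr H + p * (16 powr H * M)\<close>. The assumption on the probability makes the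
  last term at most \<open>M / 2\<close>, so it can be absorbed on the left.\<close>

lemma exponential_moment_bound:
  fixes t :: "real \<Rightarrow> real"
  assumes "finite A" and t: "\<And>x. 0 \<le> t x" "\<And>x. t x \<le> H" and H: "0 \<le> H"
    and p: "expect (P A) (\<lambda>v. of_bool (H < (\<Sum>i\<in>A. t (v i)))) \<le> 1 / (2 * 16 powr H)"
  shows "expect (P A) (\<lambda>v. 4 powr (\<Sum>i\<in>A. t (v i))) \<le> 2 * 4 powr H"
proof -
  define M where "M = expect (P A) (\<lambda>v. 4 powr (\<Sum>i\<in>A. t (v i)))"
  define p where "p = expect (P A) (\<lambda>v. of_bool (H < (\<Sum>i\<in>A. t (v i))) :: real)"
  have "M \<le> 4 powr H + p * (4 powr (H + H) * M)"
    unfolding M_def p_def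
  proof (rule first_crossing[OF assms(1) t H], goal_cases)
    case (1 B)
    have "expect (P B) (\<lambda>v. 4 powr (\<Sum>i\<in>B. t (v i))) =
        expect (P A) (\<lambda>v. 4 powr (\<Sum>i\<in>B. t (v i)))"
      using assms(1) 1 by (intro E_marginal[symmetric]) (auto intro!: sum.cong arg_cong[where f = "\<lambda>x. 4 powr x"])
    also have "\<dots> \<le> expect (P A) (\<lambda>v. 4 powr (\<Sum>i\<in>A. t (v i)))"
      using assms(1) 1 t by (intro E_mono finite_P powr_mono sum_mono2) auto
    finally show ?case .
  qed
  also have "(4::real) powr (H + H) = 16 powr H"
  proof -
    have "(4::real) powr (H + H) = (4 * 4) powr H" unfolding powr_add by (subst powr_mult) auto
    then show ?thesis by simp
  qed
  also have "p * (16 powr H * M) \<le> 1 / (2 * 16 powr H) * (16 powr H * M)"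
    using assms(5) unfolding p_def M_def by (intro mult_right_mono mult_nonneg_nonneg E_nonneg) auto
  also have "\<dots> = M / 2" by simp
  finally show ?thesis unfolding M_def by linarith
qed

end

section \<open>Effective sizes\<close>

text \<open>\<open>level L B x\<close> is a size truncated at \<open>B\<close>, in units in which a machine of load \<open>B\<close> has level \<open>L / 5\<close>;
  \<open>xpow z\<close> is a rational substitute for \<open>2\<^sup>z - 1\<close>, and \<open>eff y\<close> one for the binary logarithm of \<open>1 + y\<close>.\<close>

definition level :: "nat \<Rightarrow> real \<Rightarrow> real \<Rightarrow> real" where
  "level L B x = (if 0 \<le> x \<and> x \<le> B then x * real L / (5 * B) else 0)"

definition xpow :: "real \<Rightarrow> real" where
  "xpow z = (if z < 1 then z else 2 ^ nat \<lfloor>z\<rfloor>)"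

definition eff :: "real \<Rightarrow> real" where
  "eff y = (if y < 1 then y else real (floorlog 2 (nat \<lfloor>y\<rfloor>)))"

definition excess :: "real \<Rightarrow> real \<Rightarrow> real" where
  "excess B x = (if B < x then x else 0)"

lemma two_powr_le: "0 \<le> u \<Longrightarrow> u \<le> 1 \<Longrightarrow> 2 powr u \<le> 1 + (u::real)"
  using convex_onD[OF exp_convex, of u 0 "ln 2"] by (simp add: powr_def algebra_simps)

lemma one_add_le_four_powr: "0 \<le> u \<Longrightarrow> 1 + u \<le> 4 powr (u::real)"
proof -
  assume u: "0 \<le> u"
  have "exp 1 \<le> (4::real)" using exp_le by linarith
  then have "1 \<le> ln (4::real)" by (simp add: ln_ge_iff)
  then have "u \<le> u * ln 4" using u by (simp add: mult_le_cancel_left1)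
  then show ?thesis using exp_ge_add_one_self[of "u * ln 4"] by (simp add: powr_def del: exp_ge_add_one_self)
qed

lemma four_powr: "4 powr u = (2 powr u) * (2 powr (u::real))"
  by (subst powr_mult[symmetric]) auto

lemma two_power_floor_le: "0 \<le> z \<Longrightarrow> 2 ^ nat \<lfloor>z\<rfloor> \<le> 2 powr (z::real)"
  by (subst powr_realpow[symmetric]) auto

lemma xpow_nonneg: "0 \<le> z \<Longrightarrow> 0 \<le> xpow z"
  by (simp add: xpow_def)

text \<open>With \<open>two_powr_half_le\<close> this gives the sandwich
  \<open>2 powr (z / 2) \<le> 1 + xpow z \<le> 4 powr z\<close>: the rational substitute costs a
  factor 2 in the exponent either way. The upper bound serves to bound charges, the lower one to
  bound loads.\<close>

lemma xpow_le_four_powr: "0 \<le> z \<Longrightarrow> 1 + xpow z \<le> 4 powr z"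
proof (cases "z < 1")
  case False
  assume z: "0 \<le> z"
  have "2 powr 1 \<le> 2 powr z" using False by (intro powr_mono) auto
  then have "2 * 2 powr z \<le> 2 powr z * 2 powr z" by simp
  moreover have "xpow z \<le> 2 powr z" using False z two_power_floor_le by (simp add: xpow_def)
  ultimately show ?thesis using \<open>2 powr 1 \<le> 2 powr z\<close> unfolding four_powr by (simp only: powr_one numeral_One)
qed (simp add: xpow_def one_add_le_four_powr)

lemma two_powr_half_le: "0 \<le> z \<Longrightarrow> 2 powr (z / 2) \<le> 1 + xpow z"
proof (cases "z < 1")
  case True
  assume "0 \<le> z"
  with True two_powr_le[of "z / 2"] show ?thesis by (simp add: xpow_def)
next
  case False
  assume z: "0 \<le> z"
  have "1 \<le> \<lfloor>z\<rfloor>" using False by (simp add: le_floor_iff)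
  then have "real (nat \<lfloor>z\<rfloor>) = of_int \<lfloor>z\<rfloor>" "real_of_int 1 \<le> real_of_int \<lfloor>z\<rfloor>"
    by (simp, subst of_int_le_iff)
  then have "z / 2 \<le> real (nat \<lfloor>z\<rfloor>)" by linarith
  then have "2 powr (z / 2) \<le> 2 powr real (nat \<lfloor>z\<rfloor>)" by (intro powr_mono) auto
  also have "\<dots> = 2 ^ nat \<lfloor>z\<rfloor>" by (simp add: powr_realpow)
  finally show ?thesis using False by (simp add: xpow_def)
qed

text \<open>The second bound linearises the moment. It is meant for machines that are overloaded too
  often for their exponential moments to be controlled.\<close>

lemma xpow_le: assumes "0 \<le> z" "z \<le> H"
  shows "xpow z \<le> 2 powr H" "xpow z \<le> 2 powr H * z"
proof -
  have 1: "1 \<le> 2 powr H" using assms by (intro ge_one_powr_ge_zero) auto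
  have "2 ^ nat \<lfloor>z\<rfloor> \<le> 2 powr H"
    using two_power_floor_le[OF assms(1)] powr_mono[of z H 2] assms(2) by linarith
  then show "xpow z \<le> 2 powr H" using 1 by (simp add: xpow_def)
  show "xpow z \<le> 2 powr H * z"
  proof (cases "z < 1")
    case True
    then show ?thesis using mult_right_mono[OF 1 assms(1)] by (simp add: xpow_def)
  next
    case False
    then have "2 powr H * 1 \<le> 2 powr H * z" by (intro mult_left_mono) auto
    then show ?thesis using \<open>xpow z \<le> 2 powr H\<close> by linarith
  qed
qed

lemma nat_floor_pos: "1 \<le> y \<Longrightarrow> 0 < nat \<lfloor>y::real\<rfloor>"
  by (simp add: le_floor_iff)

lemma floorlog_floor:
  assumes "1 \<le> (y::real)"
  shows "real (floorlog 2 (nat \<lfloor>y\<rfloor>)) \<le> log 2 y + 1" "y < 2 ^ floorlog 2 (nat \<lfloor>y\<rfloor>)"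
    "1 \<le> floorlog 2 (nat \<lfloor>y\<rfloor>)"
proof -
  let ?n = "nat \<lfloor>y\<rfloor>"
  have n: "0 < ?n" "real ?n \<le> y" "y < real ?n + 1"
  proof -
    have "real ?n = of_int \<lfloor>y\<rfloor>" using assms by simp
    then show "real ?n \<le> y" "y < real ?n + 1" by linarith+
  qed (fact nat_floor_pos[OF assms])
  have "real (floorlog 2 ?n) \<le> log 2 (real ?n) + 1"
  proof -
    have "0 \<le> log 2 (real ?n)" using n by simp
    then show ?thesis using n(1) by (simp add: floorlog_def)
  qed
  also have "log 2 (real ?n) \<le> log 2 y" using n by simp
  finally show "real (floorlog 2 (nat \<lfloor>y\<rfloor>)) \<le> log 2 y + 1" by simp
  have "?n < 2 ^ floorlog 2 ?n" using floorlog_leD[of 2 ?n "floorlog 2 ?n"] by simp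
  then have "?n + 1 \<le> 2 ^ floorlog 2 ?n" unfolding Suc_eq_plus1[symmetric] by (rule Suc_leI)
  then have "real (?n + 1) \<le> real (2 ^ floorlog 2 ?n)" by (rule of_nat_mono)
  then show "y < 2 ^ floorlog 2 ?n" using n(3) by simp
  show "1 \<le> floorlog 2 ?n" using n(1) by (simp add: floorlog_def)
qed

lemma eff_nonneg: "0 \<le> y \<Longrightarrow> 0 \<le> eff y"
  by (simp add: eff_def)

text \<open>With \<open>one_add_le_eff\<close>, \<open>eff y\<close> lies between one half and twice
  \<open>log 2 (1 + y)\<close>. Below 1 the value \<open>y\<close> itself is taken: rounding there
  to a positive integer would charge every job a constant, while many jobs of tiny moment must be
  charged in proportion.\<close>

lemma eff_le_log: assumes "0 \<le> y" shows "eff y \<le> 2 * log 2 (1 + y)"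
proof (cases "y < 1")
  case True
  have "y \<le> log 2 (1 + y)" using two_powr_le[of y] assms True by (subst le_log_iff) auto
  then show ?thesis using assms True by (simp add: eff_def)
next
  case False
  have y: "1 \<le> y" using False by simp
  have "log 2 2 \<le> log 2 (1 + y)" "log 2 y \<le> log 2 (1 + y)" using False by (intro log_mono; simp)+
  then have "real (floorlog 2 (nat \<lfloor>y\<rfloor>)) \<le> 2 * log 2 (1 + y)"
    using floorlog_floor(1)[OF y] by simp
  then show ?thesis using False by (simp add: eff_def)
qed

lemma one_add_le_eff: assumes "0 \<le> y" shows "1 + y \<le> 4 powr eff y"
proof (cases "y < 1")
  case True
  then show ?thesis using one_add_le_four_powr[OF assms] by (simp add: eff_def)
next
  case False
  let ?k = "floorlog 2 (nat \<lfloor>y\<rfloor>)"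
  have "(2::real) ^ 1 \<le> 2 ^ ?k" using False floorlog_floor(3)[of y] by (intro power_increasing) auto
  then have "2 * (2::real) ^ ?k \<le> 2 ^ ?k * 2 ^ ?k" by (intro mult_right_mono) auto
  moreover have "1 + y \<le> 2 * 2 ^ ?k" using floorlog_floor(2)[of y] False by linarith
  ultimately have "1 + y \<le> 2 ^ ?k * 2 ^ ?k" by linarith
  then show ?thesis using False by (simp add: eff_def four_powr powr_realpow)
qed

lemma eff_le_self: "0 \<le> y \<Longrightarrow> eff y \<le> y"
  using floorlog_le_self[of "nat \<lfloor>y\<rfloor>"] by (auto simp: eff_def) linarith

lemma eff_le:
  assumes "0 \<le> y" "y \<le> 2 powr H" "0 \<le> H"
  shows "eff y \<le> H + 1"
proof (cases "y < 1")
  case False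
  have "log 2 y \<le> log 2 (2 powr H)" using False assms by (intro log_mono) auto
  then have "log 2 y \<le> H" by simp
  then show ?thesis using floorlog_floor(1)[of y] False by (simp add: eff_def)
qed (use assms in \<open>simp add: eff_def\<close>)

lemma level_bounds: assumes "0 \<le> B"
  shows "0 \<le> level L B x" "level L B x \<le> real L / 5" "0 \<le> x \<Longrightarrow> level L B x \<le> real L / (5 * B) * x"
proof -
  show "0 \<le> level L B x" using assms by (simp add: level_def)
  show "level L B x \<le> real L / 5"
  proof (cases "0 \<le> x \<and> x \<le> B \<and> 0 < B")
    case True
    then have "x * real L / (5 * B) \<le> B * real L / (5 * B)"
      by (intro divide_right_mono mult_right_mono) auto
    then show ?thesis using True by (simp add: level_def)
  next
    case False
    then show ?thesis using assms by (auto simp: level_def)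
  qed
  show "0 \<le> x \<Longrightarrow> level L B x \<le> real L / (5 * B) * x" using assms by (simp add: level_def mult.commute)
qed

section \<open>A small expected makespan forces small charges\<close>

locale machine_sizes = job_sizes Q for Q +
  fixes I :: sched
  assumes machines_pos: "0 < machines I"
begin

abbreviation m :: nat where "m \<equiv> machines I"
abbreviation L :: nat where "L \<equiv> floorlog 2 m"

abbreviation moment :: "real \<Rightarrow> nat \<Rightarrow> real" where
  "moment B i \<equiv> expect (Q i) (\<lambda>x. xpow (level L B x))"
abbreviation tail :: "real \<Rightarrow> nat \<Rightarrow> real" where
  "tail B i \<equiv> expect (Q i) (excess B)"
text \<open>The normalisation makes each summand total at most 1 over jobs that fit:
  \<open>4 * L * m\<close> bounds the total of the \<open>eff\<close> part and \<open>B\<close> that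
  of the tails.\<close>

definition weight :: "real \<Rightarrow> nat \<Rightarrow> real" where
  "weight B i = eff (moment B i) / (4 * real L * real m) + tail B i / B"

lemma L_bounds: "1 \<le> L" "m < 2 ^ L" "2 ^ L \<le> 2 * m"
proof -
  show L: "1 \<le> L" using machines_pos by (simp add: floorlog_def)
  show "m < 2 ^ L" using floorlog_leD[of 2 m L] by simp
  have "\<not> L \<le> L - 1" using L by simp
  then have "2 ^ (L - 1) \<le> m" using floorlog_leI[of m 2 "L - 1"] by fastforce
  then have "2 * 2 ^ (L - 1) \<le> 2 * m" by simp
  then show "2 ^ L \<le> 2 * m" using L by (simp flip: power_Suc)
qed

lemma load_le_makespan: "k < m \<Longrightarrow> (\<Sum>i\<in>{i \<in> A. a i = k}. v i) \<le> makespan I A a v"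
  unfolding makespan_def by (intro Max_ge) auto

lemma makespan_le: "(\<And>k. k < m \<Longrightarrow> (\<Sum>i\<in>{i \<in> A. a i = k}. v i) \<le> c) \<Longrightarrow> makespan I A a v \<le> c"
  unfolding makespan_def using machines_pos by (subst Max_le_iff) auto

lemma job_le_makespan:
  assumes "finite A" "i \<in> A" "a i < m" "\<And>j. j \<in> A \<Longrightarrow> 0 \<le> v j"
  shows "v i \<le> makespan I A a v"
proof -
  have "v i \<le> (\<Sum>j\<in>{j \<in> A. a j = a i}. v j)" using assms by (intro member_le_sum) auto
  then show ?thesis using load_le_makespan[OF assms(3), where A = A and a = a and v = v] by linarith
qed

lemma makespan_nonneg:
  assumes "\<And>j. j \<in> A \<Longrightarrow> 0 \<le> v j"
  shows "0 \<le> makespan I A a v"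
proof -
  have "0 \<le> (\<Sum>j\<in>{j \<in> A. a j = 0}. v j)" using assms by (intro sum_nonneg) auto
  then show ?thesis using load_le_makespan[OF machines_pos, where A = A and a = a and v = v] by linarith
qed

lemma moment_bounds: assumes "0 \<le> B"
  shows "0 \<le> moment B i" "moment B i \<le> 2 powr (L / 5)"
proof -
  show "0 \<le> moment B i" by (intro E_nonneg xpow_nonneg level_bounds assms)
  have "moment B i \<le> expect (Q i) (\<lambda>_. 2 powr (L / 5))"
    by (intro E_mono fin xpow_le level_bounds assms)
  then show "moment B i \<le> 2 powr (L / 5)" by simp
qed

lemma tail_nonneg: "0 \<le> tail B i"
  by (intro E_nonneg) (simp add: excess_def nonneg)

context
  fixes A :: "nat set" and a :: "nat \<Rightarrow> nat" and B :: real
  assumes A: "finite A" and a: "\<And>i. i \<in> A \<Longrightarrow> a i < m" and B: "0 < B"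
    and small: "expect (P A) (makespan I A a) \<le> B / 2"
begin

lemma overload_prob: "expect (P A) (\<lambda>v. of_bool (B < makespan I A a v)) \<le> (1/2 :: real)"
proof -
  have "expect (P A) (\<lambda>v. of_bool (B < makespan I A a v)) \<le>
      expect (P A) (\<lambda>v. makespan I A a v / B)"
  proof (intro E_mono finite_P A)
    fix v assume "v \<in> set_pmf (P A)"
    then have "0 \<le> makespan I A a v" using P_nonneg[OF A] by (intro makespan_nonneg) auto
    then show "of_bool (B < makespan I A a v) \<le> makespan I A a v / B" using B by simp
  qed
  also have "\<dots> \<le> 1 / 2" using small B by (simp add: field_simps)
  finally show ?thesis .
qed

text \<open>With probability at least 1/2 no size exceeds \<open>B\<close>; so by independence,
  whatever the size of job \<open>i\<close>, the other jobs all stay within \<open>B\<close> with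
  probability at least 1/2. The events that \<open>i\<close> is the only large job are disjoint for
  different \<open>i\<close>, and on each of them the makespan is at least the size of
  \<open>i\<close>. Hence half of the sum is at most the expected makespan, which is at most
  \<open>B / 2\<close>.\<close>

lemma tail_sum: "(\<Sum>i\<in>A. tail B i) \<le> B"
proof -
  define q where "q i = expect (Q i) (\<lambda>x. of_bool (x \<le> B) :: real)" for i
  have q: "0 \<le> q i" "q i \<le> 1" for i
  proof -
    show "0 \<le> q i" unfolding q_def by (intro E_nonneg) auto
    have "q i \<le> expect (Q i) (\<lambda>_. 1)" unfolding q_def by (intro E_mono fin) auto
    then show "q i \<le> 1" by simp
  qed
  have "1 / 2 \<le> expect (P A) (\<lambda>v. 1 - of_bool (B < makespan I A a v) :: real)"
    using overload_prob A by (subst Bochner_Integration.integral_diff)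
      (auto simp: integrable_measure_pmf_finite finite_P)
  also have "\<dots> \<le> expect (P A) (\<lambda>v. \<Prod>i\<in>A. of_bool (v i \<le> B))"
  proof (intro E_mono finite_P A)
    fix v assume v: "v \<in> set_pmf (P A)"
    show "1 - of_bool (B < makespan I A a v) \<le> (\<Prod>i\<in>A. of_bool (v i \<le> B) :: real)"
    proof (cases "B < makespan I A a v")
      case False
      have "v i \<le> B" if "i \<in> A" for i
        using job_le_makespan[where v = v and a = a, OF A that a[OF that]] P_nonneg[OF A v] False by simp
      then show ?thesis by simp
    qed (auto intro: prod_nonneg)
  qed
  also have "\<dots> = (\<Prod>i\<in>A. q i)" unfolding q_def using A by (intro E_prod_singletons) auto
  finally have half: "1 / 2 \<le> (\<Prod>i\<in>A. q i)" .
  have "(\<Sum>i\<in>A. tail B i) / 2 \<le> (\<Sum>i\<in>A. tail B i * (\<Prod>j\<in>A - {i}. q j))"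
  proof -
    have "tail B i * (1 / 2) \<le> tail B i * (\<Prod>j\<in>A - {i}. q j)" if "i \<in> A" for i
    proof (intro mult_left_mono tail_nonneg)
      have "(\<Prod>j\<in>A. q j) = q i * (\<Prod>j\<in>A - {i}. q j)" using A that by (rule prod.remove)
      also have "\<dots> \<le> 1 * (\<Prod>j\<in>A - {i}. q j)" using q by (intro mult_right_mono prod_nonneg) auto
      finally show "1 / 2 \<le> (\<Prod>j\<in>A - {i}. q j)" using half by simp
    qed
    then show ?thesis unfolding sum_divide_distrib by (intro sum_mono) simp
  qed
  also have "\<dots> = (\<Sum>i\<in>A. expect (P A) (\<lambda>v. excess B (v i) * (\<Prod>j\<in>A - {i}. of_bool (v j \<le> B))))"
  proof (intro sum.cong refl)
    fix i assume i: "i \<in> A"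
    define g where "g j x = (if j = i then \<bar>excess B x\<bar> else of_bool (x \<le> B))" for j x
    have g_other: "g j = (\<lambda>x. of_bool (x \<le> B))" if "j \<noteq> i" for j
      using that by (auto simp: g_def)
    have rem: "(\<Prod>j\<in>A. h j) = h i * (\<Prod>j\<in>A - {i}. h j)" for h :: "nat \<Rightarrow> real"
      using A i by (rule prod.remove)
    have "expect (P A) (\<lambda>v. \<Prod>j\<in>A. g j (v j)) = (\<Prod>j\<in>A. expect (Q j) (g j))"
      using A by (intro E_prod_singletons) (auto simp: g_def)
    also have "\<dots> = expect (Q i) (g i) * (\<Prod>j\<in>A - {i}. q j)"
      unfolding rem by (intro arg_cong2[where f = "(*)"] prod.cong refl) (auto simp: g_other q_def)
    also have "expect (Q i) (g i) = tail B i"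
      by (intro E_cong) (auto simp: g_def excess_def nonneg)
    also have "expect (P A) (\<lambda>v. \<Prod>j\<in>A. g j (v j)) =
        expect (P A) (\<lambda>v. excess B (v i) * (\<Prod>j\<in>A - {i}. of_bool (v j \<le> B)))"
    proof (intro E_cong)
      fix v assume "v \<in> set_pmf (P A)"
      then have "g i (v i) = excess B (v i)" using P_nonneg[OF A] by (simp add: g_def excess_def)
      moreover have "(\<Prod>j\<in>A - {i}. g j (v j)) = (\<Prod>j\<in>A - {i}. of_bool (v j \<le> B))"
        by (intro prod.cong) (auto simp: g_def)
      ultimately show "(\<Prod>j\<in>A. g j (v j)) = excess B (v i) * (\<Prod>j\<in>A - {i}. of_bool (v j \<le> B))"
        unfolding rem by simp
    qed
    finally show "tail B i * (\<Prod>j\<in>A - {i}. q j) =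
        expect (P A) (\<lambda>v. excess B (v i) * (\<Prod>j\<in>A - {i}. of_bool (v j \<le> B)))" by simp
  qed
  also have "\<dots> = expect (P A) (\<lambda>v. \<Sum>i\<in>A. excess B (v i) * (\<Prod>j\<in>A - {i}. of_bool (v j \<le> B)))"
    using A by (intro E_sum[symmetric] finite_P)
  also have "\<dots> \<le> expect (P A) (makespan I A a)"
  proof (intro E_mono finite_P A)
    fix v assume v: "v \<in> set_pmf (P A)"
    show "(\<Sum>i\<in>A. excess B (v i) * (\<Prod>j\<in>A - {i}. of_bool (v j \<le> B))) \<le> makespan I A a v"
    proof (cases "\<exists>i\<in>A. B < v i")
      case True
      then obtain i where i: "i \<in> A" "B < v i" by blast
      have z: "excess B (v k) * (\<Prod>j\<in>A - {k}. of_bool (v j \<le> B)) = 0" if "k \<in> A - {i}" for k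
      proof -
        have "(\<Prod>j\<in>A - {k}. of_bool (v j \<le> B)) = (0::real)"
          using A i that by (intro prod_zero) (auto intro!: bexI[of _ i])
        then show ?thesis by simp
      qed
      have z0: "(\<Sum>k\<in>A - {i}. excess B (v k) * (\<Prod>j\<in>A - {k}. of_bool (v j \<le> B))) = 0"
        by (intro sum.neutral ballI z)
      have "(\<Sum>i\<in>A. excess B (v i) * (\<Prod>j\<in>A - {i}. of_bool (v j \<le> B))) =
          excess B (v i) * (\<Prod>j\<in>A - {i}. of_bool (v j \<le> B))"
        unfolding sum.remove[OF A i(1)] z0 by simp
      also have "\<dots> \<le> v i * 1"
        using P_nonneg[OF A v, of i] by (intro mult_mono prod_le_1 prod_nonneg) (auto simp: excess_def)
      also have "\<dots> \<le> makespan I A a v"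
        using job_le_makespan[where v = v and a = a, OF A i(1) a[OF i(1)]] P_nonneg[OF A v] by simp
      finally show ?thesis .
    next
      case False
      then have "excess B (v i) = 0" if "i \<in> A" for i using that by (auto simp: excess_def)
      then show ?thesis using makespan_nonneg[of A v] P_nonneg[OF A v] by simp
    qed
  qed
  finally show ?thesis using small by linarith
qed

abbreviation on_machine :: "nat \<Rightarrow> nat set" where
  "on_machine k \<equiv> {i \<in> A. a i = k}"

text \<open>The probability that machine \<open>k\<close> receives more than \<open>B\<close> in
  truncated sizes, since load \<open>B\<close> corresponds to level \<open>L / 5\<close>.\<close>

definition overload :: "nat \<Rightarrow> real" where
  "overload k = expect (P (on_machine k))
    (\<lambda>v. of_bool (L / 5 < (\<Sum>i\<in>on_machine k. level L B (v i))))"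

lemma level_load:
  assumes "v \<in> set_pmf (P A)" "k < m"
  shows "(\<Sum>i\<in>on_machine k. level L B (v i)) \<le> L / (5 * B) * makespan I A a v"
proof -
  have "(\<Sum>i\<in>on_machine k. level L B (v i)) \<le> (\<Sum>i\<in>on_machine k. L / (5 * B) * v i)"
    by (intro sum_mono level_bounds P_nonneg[OF A assms(1)]) (use B in auto)
  also have "\<dots> = L / (5 * B) * (\<Sum>i\<in>on_machine k. v i)" by (simp add: sum_distrib_left)
  also have "\<dots> \<le> L / (5 * B) * makespan I A a v"
    using B by (intro mult_left_mono load_le_makespan assms) auto
  finally show ?thesis .
qed

lemma overload_bounds: "0 \<le> overload k" "overload k \<le> 1"
proof -
  show "0 \<le> overload k" unfolding overload_def by (intro E_nonneg) auto
  have "overload k \<le> expect (P (on_machine k)) (\<lambda>_. 1)"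
    unfolding overload_def using A by (intro E_mono finite_P) auto
  then show "overload k \<le> 1" by simp
qed

text \<open>A makespan of at most \<open>B\<close> excludes overload everywhere, so with probability
  at least 1/2 no machine is overloaded. By independence of the machines the same probability is at
  most \<open>exp (- (\<Sum>k<m. overload k))\<close>, which a sum above 1 would push below
  \<open>exp (- 1) \<le> 1 / 2\<close>.\<close>

lemma overload_sum: "(\<Sum>k<m. overload k) \<le> 1"
proof (rule ccontr)
  assume large: "\<not> ?thesis"
  define g where "g k v = (1 - of_bool (L / 5 < (\<Sum>i\<in>on_machine k. level L B (v i))) :: real)" for k v
  have un: "(\<Union>k<m. on_machine k) = A" using a by auto
  have "1 / 2 \<le> expect (P A) (\<lambda>v. 1 - of_bool (B < makespan I A a v) :: real)"
    using overload_prob A by (subst Bochner_Integration.integral_diff)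
      (auto simp: integrable_measure_pmf_finite finite_P)
  also have "\<dots> \<le> expect (P A) (\<lambda>v. \<Prod>k<m. g k v)"
  proof (intro E_mono finite_P A)
    fix v assume v: "v \<in> set_pmf (P A)"
    show "1 - of_bool (B < makespan I A a v) \<le> (\<Prod>k<m. g k v)"
    proof (cases "B < makespan I A a v")
      case False
      have "g k v = 1" if "k < m" for k
      proof -
        have "L / (5 * B) * makespan I A a v \<le> L / (5 * B) * B"
          using False B by (intro mult_left_mono) auto
        also have "\<dots> = L / 5" using B by simp
        finally have "\<not> L / 5 < (\<Sum>i\<in>on_machine k. level L B (v i))"
          using level_load[OF v that] by linarith
        then show ?thesis by (simp add: g_def)
      qed
      then show ?thesis by simp
    next
      case True
      then show ?thesis by (auto simp: g_def intro!: prod_nonneg)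
    qed
  qed
  also have "\<dots> = (\<Prod>k<m. expect (P (on_machine k)) (g k))"
    (is "_ = ?r")
  proof -
    have "expect (P (\<Union>k<m. on_machine k)) (\<lambda>v. \<Prod>k<m. g k v) = ?r"
    proof (rule E_prod_groups)
      show "finite (on_machine k)" for k using A by simp
      show "on_machine k \<inter> on_machine l = {}" if "k \<noteq> l" for k l using that by blast
      fix k and v w :: "nat \<Rightarrow> real"
      assume "\<And>i. i \<in> on_machine k \<Longrightarrow> v i = w i"
      then have "(\<Sum>i\<in>on_machine k. level L B (v i)) = (\<Sum>i\<in>on_machine k. level L B (w i))"
        by (intro sum.cong) simp_all
      then show "g k v = g k w" unfolding g_def by simp
    qed
    then show ?thesis unfolding un .
  qed
  also have "\<dots> = (\<Prod>k<m. 1 - overload k)"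
    unfolding g_def overload_def using A by (intro prod.cong refl, subst Bochner_Integration.integral_diff)
      (auto simp: integrable_measure_pmf_finite finite_P)
  also have "\<dots> \<le> (\<Prod>k<m. exp (- overload k))"
    using overload_bounds exp_ge_add_one_self[of "- overload _"] by (intro prod_mono) auto
  also have "\<dots> = exp (- (\<Sum>k<m. overload k))" by (simp add: exp_sum flip: sum_negf)
  also have "\<dots> < exp (- 1)" using large by simp
  also have "\<dots> \<le> 1 / 2"
    using exp_ge_add_one_self[of 1] by (simp add: exp_minus field_simps)
  finally show False by simp
qed

text \<open>For a rarely overloaded machine the logarithm of \<open>exponential_moment_bound\<close>
  gives the first term. For any other one, \<open>overload k * (2 * 16 powr (L / 5))\<close> is at
  least 1 and may be multiplied to the linear bound, in which the expected level sum is at most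
  \<open>L / 10\<close> because the expected makespan is at most \<open>B / 2\<close>. Adding both
  terms gives one bound for all machines, to be summed by \<open>overload_sum\<close>.\<close>

lemma machine_eff_sum:
  assumes k: "k < m"
  shows "(\<Sum>i\<in>on_machine k. eff (moment B i)) \<le>
    2 * (1 + 2 * (L / 5)) + overload k * (2 * 16 powr (L / 5)) * (2 powr (L / 5) * (L / 10))"
    (is "_ \<le> ?g + ?b")
proof -
  let ?H = "L / 5"
  have fk: "finite (on_machine k)" using A by simp
  note lv = level_bounds[of B L, OF less_imp_le[OF B]]
  have pos: "0 \<le> ?g" "0 \<le> ?b" using overload_bounds(1)[of k] by auto
  show ?thesis
  proof (cases "overload k \<le> 1 / (2 * 16 powr ?H)")
    case True
    have "(\<Sum>i\<in>on_machine k. eff (moment B i)) \<le> (\<Sum>i\<in>on_machine k. 2 * log 2 (1 + moment B i))"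
      using B by (intro sum_mono eff_le_log moment_bounds) auto
    also have "\<dots> = 2 * log 2 (\<Prod>i\<in>on_machine k. 1 + moment B i)"
    proof -
      have "1 + moment B i \<noteq> 0" "0 < 1 + moment B i" for i using moment_bounds(1)[of B i] B by auto
      then have "ln (\<Prod>i\<in>on_machine k. 1 + moment B i) = (\<Sum>i\<in>on_machine k. ln (1 + moment B i))"
        using fk by (intro ln_prod) auto
      then show ?thesis by (simp add: log_def sum_divide_distrib sum_distrib_left)
    qed
    also have "\<dots> \<le> 2 * log 2 (2 * 4 powr ?H)"
    proof -
      have "(\<Prod>i\<in>on_machine k. 1 + moment B i) \<le>
          (\<Prod>i\<in>on_machine k. expect (Q i) (\<lambda>x. 4 powr level L B x))"
      proof (intro prod_mono conjI)
        fix i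
        have "1 + moment B i = expect (Q i) (\<lambda>x. 1 + xpow (level L B x))"
          by (subst E_add[OF fin]) simp
        also have "\<dots> \<le> expect (Q i) (\<lambda>x. 4 powr level L B x)"
          by (intro E_mono fin xpow_le_four_powr lv)
        finally show "1 + moment B i \<le> expect (Q i) (\<lambda>x. 4 powr level L B x)" .
      qed (use moment_bounds(1)[of B] B in \<open>simp add: add_nonneg_nonneg\<close>)
      also have "\<dots> = expect (P (on_machine k)) (\<lambda>v. \<Prod>i\<in>on_machine k. 4 powr level L B (v i))"
        by (intro E_prod_singletons[symmetric] fk) auto
      also have "\<dots> = expect (P (on_machine k)) (\<lambda>v. 4 powr (\<Sum>i\<in>on_machine k. level L B (v i)))"
        by (intro E_cong) (simp add: powr_sum fk)
      also have "\<dots> \<le> 2 * 4 powr ?H"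
        using True unfolding overload_def by (intro exponential_moment_bound fk lv) auto
      finally have "(\<Prod>i\<in>on_machine k. 1 + moment B i) \<le> 2 * 4 powr ?H" .
      moreover have "0 < (\<Prod>i\<in>on_machine k. 1 + moment B i)"
        using moment_bounds(1)[of B] B by (intro prod_pos) (simp add: add_pos_nonneg)
      ultimately show ?thesis by simp
    qed
    also have "log 2 (2 * 4 powr ?H) = 1 + 2 * ?H"
      by (simp add: log_mult four_powr)
    finally show ?thesis using pos(2) by linarith
  next
    case False
    have "(\<Sum>i\<in>on_machine k. eff (moment B i)) \<le> (\<Sum>i\<in>on_machine k. moment B i)"
      using B by (intro sum_mono eff_le_self moment_bounds) auto
    also have "\<dots> \<le> (\<Sum>i\<in>on_machine k. 2 powr ?H * expect (Q i) (level L B))"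
    proof (intro sum_mono)
      fix i
      have "moment B i \<le> expect (Q i) (\<lambda>x. 2 powr ?H * level L B x)"
        by (intro E_mono fin xpow_le lv)
      then show "moment B i \<le> 2 powr ?H * expect (Q i) (level L B)" by simp
    qed
    also have "\<dots> = 2 powr ?H * expect (P A) (\<lambda>v. \<Sum>i\<in>on_machine k. level L B (v i))"
      using A by (simp add: E_sum finite_P E_component sum_distrib_left)
    also have "\<dots> \<le> 2 powr ?H * (L / 10)"
    proof (intro mult_left_mono)
      have "expect (P A) (\<lambda>v. \<Sum>i\<in>on_machine k. level L B (v i)) \<le>
          expect (P A) (\<lambda>v. L / (5 * B) * makespan I A a v)"
        by (intro E_mono finite_P A level_load k)
      also have "\<dots> \<le> L / (5 * B) * (B / 2)"
        using mult_left_mono[OF small, of "L / (5 * B)"] B by simp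
      also have "\<dots> = L / 10" using B by simp
      finally show "expect (P A) (\<lambda>v. \<Sum>i\<in>on_machine k. level L B (v i)) \<le> L / 10" .
    qed auto
    also have "\<dots> \<le> overload k * (2 * 16 powr ?H) * (2 powr ?H * (L / 10))"
    proof -
      have "1 \<le> overload k * (2 * 16 powr ?H)" using False by (simp add: field_simps)
      then have "1 * (2 powr ?H * (L / 10)) \<le> overload k * (2 * 16 powr ?H) * (2 powr ?H * (L / 10))"
        by (intro mult_right_mono) auto
      then show ?thesis by simp
    qed
    finally show ?thesis using pos(1) by linarith
  qed
qed

theorem weight_sum_le: "(\<Sum>i\<in>A. weight B i) \<le> 2"
proof -
  let ?H = "L / 5"
  have "(\<Sum>i\<in>A. eff (moment B i)) = (\<Sum>k<m. \<Sum>i\<in>on_machine k. eff (moment B i))"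
    using A a by (intro sum.group[symmetric]) auto
  also have "\<dots> \<le> (\<Sum>k<m. 2 * (1 + 2 * ?H) + overload k * (2 * 16 powr ?H) * (2 powr ?H * (L / 10)))"
    by (intro sum_mono machine_eff_sum) auto
  also have "\<dots> = m * (2 * (1 + 2 * ?H)) + (\<Sum>k<m. overload k) * (2 * 16 powr ?H * (2 powr ?H * (L / 10)))"
    unfolding sum.distrib sum_distrib_right by (simp add: mult_ac)
  also have "\<dots> \<le> m * (2 * (1 + 2 * ?H)) + 1 * (2 * 16 powr ?H * (2 powr ?H * (L / 10)))"
    by (intro add_left_mono mult_right_mono overload_sum) auto
  \<comment> \<open>The origin of the divisor 5 in \<open>level\<close>:
    \<open>16 * 2 = 2 ^ 5\<close>.\<close>
  also have "16 powr ?H * 2 powr ?H = 2 ^ L"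
  proof -
    have "16 powr ?H * 2 powr ?H = ((2 powr 5) powr ?H :: real)" by (subst powr_mult[symmetric]) auto
    also have "\<dots> = 2 powr L" by (subst powr_powr) simp
    finally show ?thesis by (simp add: powr_realpow)
  qed
  then have "1 * (2 * 16 powr ?H * (2 powr ?H * (L / 10))) = 2 ^ L * (L / 5)" by (simp add: mult.commute)
  also have "(2::real) ^ L * (L / 5) \<le> 2 * m * (L / 5)"
    using of_nat_mono[OF L_bounds(3), where 'a = real] by (intro mult_right_mono) auto
  finally have "(\<Sum>i\<in>A. eff (moment B i)) \<le> m * (2 * (1 + 2 * ?H)) + 2 * m * (L / 5)" by simp
  also have "\<dots> = m * 2 + m * (6 / 5) * L" by (simp add: algebra_simps)
  also have "\<dots> \<le> m * (2 * real L) + m * 2 * L"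
  proof -
    have "real m * 1 \<le> real m * real L" using L_bounds(1) by (intro mult_left_mono) auto
    then show ?thesis by (simp add: algebra_simps)
  qed
  also have "\<dots> = 4 * real L * real m" by simp
  finally have 1: "(\<Sum>i\<in>A. eff (moment B i)) / (4 * real L * real m) \<le> 1"
    using L_bounds(1) machines_pos by (subst divide_le_eq_1_pos) auto
  have 2: "(\<Sum>i\<in>A. tail B i) / B \<le> 1" using tail_sum B by simp
  show ?thesis using 1 2 by (simp add: weight_def sum.distrib sum_divide_distrib)
qed

end

end

text \<open>Meant for replacing a maximum by a sum: the largest of several \<open>u k\<close> is at
  most \<open>c\<close> plus twice the sum of all \<open>2 powr (u k - c)\<close>, whose expectation
  is governed by exponential moments.\<close>

lemma le_two_powr: "u \<le> c + 2 * 2 powr (u - c)" for u c :: real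
proof -
  have "2/3 \<le> ln (2::real)" by (rule ln2_ge_two_thirds)
  have "u - c \<le> 2 * (2 powr (u - c))"
  proof (cases "0 \<le> u - c")
    case True
    then have "(u - c) * (2/3) \<le> (u - c) * ln 2" by (intro mult_left_mono ln2_ge_two_thirds)
    then have "(u - c) / 2 \<le> 1 + (u - c) * ln 2" using True by simp
    also have "\<dots> \<le> 2 powr (u - c)" using exp_ge_add_one_self[of "(u - c) * ln 2"]
      by (simp add: powr_def del: exp_ge_add_one_self)
    finally show ?thesis by simp
  next
    case False
    then have "u - c \<le> 0" by simp
    also have "\<dots> \<le> 2 * (2 powr (u - c))" by simp
    finally show ?thesis .
  qed
  then show ?thesis by linarith
qed

section \<open>Small charges give a good assignment\<close>

context machine_sizes
begin

text \<open>The axis of accumulated charge is cut into pieces of length \<open>17 * L\<close>, and a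
  job goes to the machine of the piece in which it starts. For total weight at most 4 the axis ends
  at \<open>16 * L * m\<close>; length 17 instead of 16 keeps every index strictly below
  \<open>m\<close>.\<close>

definition interval :: "real \<Rightarrow> nat set \<Rightarrow> nat \<Rightarrow> nat" where
  "interval B A i = nat \<lfloor>(\<Sum>j\<in>{j \<in> A. j < i}. eff (moment B j)) / (17 * real L)\<rfloor>"

context
  fixes A :: "nat set" and B :: real
  assumes A: "finite A" and B: "0 < B" and weights: "(\<Sum>i\<in>A. weight B i) \<le> 4"
begin

lemma eff_moment_nonneg: "0 \<le> eff (moment B i)"
  using B by (intro eff_nonneg moment_bounds) auto

lemma eff_sum_le: "(\<Sum>i\<in>A. eff (moment B i)) \<le> 16 * real L * real m"
  and tail_sum_le: "(\<Sum>i\<in>A. tail B i) \<le> 4 * B"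
proof -
  have w: "(\<Sum>i\<in>A. eff (moment B i)) / (4 * real L * real m) + (\<Sum>i\<in>A. tail B i) / B \<le> 4"
    using weights by (simp add: weight_def sum.distrib sum_divide_distrib)
  have "0 \<le> (\<Sum>i\<in>A. eff (moment B i)) / (4 * real L * real m)"
    by (intro divide_nonneg_nonneg sum_nonneg eff_moment_nonneg) auto
  moreover have "0 \<le> (\<Sum>i\<in>A. tail B i) / B"
    using B by (intro divide_nonneg_nonneg sum_nonneg tail_nonneg) auto
  ultimately have w1: "(\<Sum>i\<in>A. eff (moment B i)) / (4 * real L * real m) \<le> 4"
    and w2: "(\<Sum>i\<in>A. tail B i) / B \<le> 4"
    using w by linarith+
  have "0 < 4 * real L * real m" using L_bounds(1) machines_pos by simp
  with w1 show "(\<Sum>i\<in>A. eff (moment B i)) \<le> 16 * real L * real m"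
    by (simp add: pos_divide_le_eq)
  from w2 B show "(\<Sum>i\<in>A. tail B i) \<le> 4 * B" by (simp add: pos_divide_le_eq)
qed

lemma prefix_le: "(\<Sum>j\<in>{j \<in> A. j < i}. eff (moment B j)) \<le> 16 * real L * real m"
  using sum_mono2[OF A, of "{j \<in> A. j < i}" "\<lambda>j. eff (moment B j)"] eff_sum_le eff_moment_nonneg
  by fastforce

lemma interval_less: "interval B A i < m"
proof -
  let ?p = "\<Sum>j\<in>{j \<in> A. j < i}. eff (moment B j)"
  have "?p \<le> 16 * (real L * real m)" using prefix_le[of i] by simp
  also have "\<dots> < 17 * (real L * real m)" using L_bounds(1) machines_pos by simp
  finally have "?p / (17 * real L) < real m"
    using L_bounds(1) by (subst pos_divide_less_eq) (auto simp: mult_ac)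
  moreover have "0 \<le> ?p / (17 * real L)"
    by (intro divide_nonneg_nonneg sum_nonneg eff_moment_nonneg) auto
  ultimately show ?thesis unfolding interval_def by (simp add: nat_less_iff floor_less_iff)
qed

text \<open>The jobs of a piece other than the last one are bounded by a difference of two prefix
  sums in the same window, hence by \<open>17 * L\<close>. The last job may stick out of the window,
  by at most \<open>L / 5 + 1\<close>.\<close>

lemma interval_load: "(\<Sum>i\<in>{i \<in> A. interval B A i = k}. eff (moment B i)) \<le> 19 * real L"
proof (cases "{i \<in> A. interval B A i = k} = {}")
  case True
  then show ?thesis unfolding True by simp
next
  case False
  let ?K = "{i \<in> A. interval B A i = k}"
  let ?p = "\<lambda>i. \<Sum>j\<in>{j \<in> A. j < i}. eff (moment B j)"
  define l f where "l = Max ?K" and "f = Min ?K"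
  have K: "finite ?K" using A by simp
  have l: "l \<in> ?K" and f: "f \<in> ?K" unfolding l_def f_def by (rule Max_in[OF K False], rule Min_in[OF K False])
  have p: "real k * (17 * real L) \<le> ?p i" "?p i < (real k + 1) * (17 * real L)" if "i \<in> ?K" for i
  proof -
    have k: "real k = of_int \<lfloor>?p i / (17 * real L)\<rfloor>"
      using that eff_moment_nonneg by (auto simp: interval_def sum_nonneg)
    have L: "0 < 17 * real L" using L_bounds(1) by simp
    have "real k \<le> ?p i / (17 * real L)" "?p i / (17 * real L) < real k + 1"
      unfolding k by linarith+
    then show "real k * (17 * real L) \<le> ?p i" "?p i < (real k + 1) * (17 * real L)"
      using L by (simp_all add: pos_le_divide_eq pos_divide_less_eq)
  qed
  have "(\<Sum>i\<in>?K. eff (moment B i)) = eff (moment B l) + (\<Sum>i\<in>?K - {l}. eff (moment B i))"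
    using K l by (rule sum.remove)
  also have "(\<Sum>i\<in>?K - {l}. eff (moment B i)) \<le> ?p l - ?p f"
  proof -
    have ord: "f \<le> i" "i \<le> l" if "i \<in> ?K" for i
      unfolding l_def f_def using K that by (auto intro: Max_ge Min_le)
    have "?p f + (\<Sum>i\<in>?K - {l}. eff (moment B i)) =
        (\<Sum>i\<in>{j \<in> A. j < f} \<union> (?K - {l}). eff (moment B i))"
    proof (rule sum.union_disjoint[symmetric])
      show "{j \<in> A. j < f} \<inter> (?K - {l}) = {}" using ord(1) by force
    qed (use A in auto)
    also have "\<dots> \<le> ?p l"
    proof (rule sum_mono2)
      show "{j \<in> A. j < f} \<union> (?K - {l}) \<subseteq> {j \<in> A. j < l}" using ord f l by fastforce
    qed (use A eff_moment_nonneg in auto)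
    finally show ?thesis by simp
  qed
  also have "?p l - ?p f \<le> 17 * real L"
    using p(2)[OF l] p(1)[OF f] by (simp add: algebra_simps)
  also have "eff (moment B l) \<le> real L / 5 + 1"
    using B by (intro eff_le moment_bounds) auto
  also have "real L / 5 + 1 + 17 * real L \<le> 19 * real L" using L_bounds(1) by simp
  finally show ?thesis by simp
qed

text \<open>A load is \<open>10 * B / L\<close> times \<open>u k\<close> plus the sizes above
  \<open>B\<close>; half of the level enters \<open>u\<close> because
  \<open>two_powr_half_le\<close> controls only \<open>2 powr (z / 2)\<close>. The moment of a
  machine is at most \<open>4 powr (19 * L) = 2 powr (38 * L)\<close>, so with
  \<open>c = 39 * L\<close> the sum over all machines is at most \<open>m / 2 ^ L \<le> 1\<close>.
  As \<open>c + 2 \<le> 41 * L\<close>, the truncated part costs \<open>410 * B\<close>, and the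
  tails add \<open>4 * B\<close>.\<close>

theorem interval_makespan:
  "expect (P A) (makespan I A (interval B A)) \<le> 414 * B"
proof -
  let ?K = "\<lambda>k. {i \<in> A. interval B A i = k}"
  define u where "u k v = (\<Sum>i\<in>?K k. level L B (v i)) / 2" for k v
  define c where "c = 39 * real L"
  note lv = level_bounds[of B L, OF less_imp_le[OF B]]
  have L: "1 \<le> real L" using L_bounds(1) by simp
  have mom: "expect (P A) (\<lambda>v. 2 powr u k v) \<le> 2 powr (38 * real L)" for k
  proof -
    have fk: "finite (?K k)" using A by simp
    have "expect (P A) (\<lambda>v. 2 powr u k v) =
        expect (P (?K k)) (\<lambda>v. 2 powr u k v)"
    proof (rule E_marginal[OF A])
      fix v w :: "nat \<Rightarrow> real" assume "\<And>i. i \<in> ?K k \<Longrightarrow> v i = w i"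
      then have "u k v = u k w" unfolding u_def by (intro arg_cong2[where f = "(/)"] sum.cong) auto
      then show "2 powr u k v = 2 powr u k w" by simp
    qed auto
    also have "\<dots> = expect (P (?K k)) (\<lambda>v. \<Prod>i\<in>?K k. 2 powr (level L B (v i) / 2))"
      by (intro E_cong) (simp add: u_def sum_divide_distrib powr_sum fk)
    also have "\<dots> = (\<Prod>i\<in>?K k. expect (Q i) (\<lambda>x. 2 powr (level L B x / 2)))"
      by (intro E_prod_singletons fk) auto
    also have "\<dots> \<le> (\<Prod>i\<in>?K k. 4 powr eff (moment B i))"
    proof (intro prod_mono conjI)
      fix i
      have "expect (Q i) (\<lambda>x. 2 powr (level L B x / 2)) \<le>
          expect (Q i) (\<lambda>x. 1 + xpow (level L B x))"
        by (intro E_mono fin two_powr_half_le lv)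
      also have "\<dots> = 1 + moment B i" by (subst E_add[OF fin]) simp
      also have "\<dots> \<le> 4 powr eff (moment B i)"
        using B by (intro one_add_le_eff moment_bounds) auto
      finally show "expect (Q i) (\<lambda>x. 2 powr (level L B x / 2)) \<le> 4 powr eff (moment B i)" .
    qed (auto intro: E_nonneg)
    also have "\<dots> = 4 powr (\<Sum>i\<in>?K k. eff (moment B i))" by (simp add: powr_sum fk)
    also have "\<dots> \<le> 4 powr (19 * real L)" by (intro powr_mono interval_load) auto
    also have "\<dots> = 2 powr (38 * real L)" by (simp add: four_powr flip: powr_add)
    finally show ?thesis .
  qed
  have "expect (P A) (makespan I A (interval B A)) \<le>
      expect (P A)
        (\<lambda>v. 10 * B / L * (c + 2 * (\<Sum>k<m. 2 powr (u k v - c))) + (\<Sum>i\<in>A. excess B (v i)))"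
  proof (intro E_mono finite_P A makespan_le)
    fix v k assume v: "v \<in> set_pmf (P A)" and k: "k < m"
    have "v i = 5 * B / L * level L B (v i) + excess B (v i)" for i
      using P_nonneg[OF A v, of i] B L by (simp add: level_def excess_def)
    then have "(\<Sum>i\<in>?K k. v i) = (\<Sum>i\<in>?K k. 5 * B / L * level L B (v i) + excess B (v i))"
      by (intro sum.cong) auto
    also have "\<dots> = 10 * B / L * u k v + (\<Sum>i\<in>?K k. excess B (v i))"
      by (simp add: sum.distrib u_def sum_distrib_left sum_divide_distrib mult_ac)
    also have "\<dots> \<le> 10 * B / L * (c + 2 * (\<Sum>k<m. 2 powr (u k v - c))) + (\<Sum>i\<in>A. excess B (v i))"
    proof (intro add_mono mult_left_mono sum_mono2)
      have "2 powr (u k v - c) \<le> (\<Sum>k<m. 2 powr (u k v - c))"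
        using k by (intro member_le_sum) auto
      then show "u k v \<le> c + 2 * (\<Sum>k<m. 2 powr (u k v - c))" using le_two_powr[of "u k v" c] by linarith
    qed (use A B P_nonneg[OF A v] in \<open>auto simp: excess_def\<close>)
    finally show "(\<Sum>i\<in>?K k. v i) \<le>
        10 * B / L * (c + 2 * (\<Sum>k<m. 2 powr (u k v - c))) + (\<Sum>i\<in>A. excess B (v i))" .
  qed
  also have "\<dots> = 10 * B / L * (c + 2 * (\<Sum>k<m. expect (P A) (\<lambda>v. 2 powr (u k v - c))))
      + (\<Sum>i\<in>A. expect (P A) (\<lambda>v. excess B (v i)))"
    using A by (simp add: E_add E_sum finite_P)
  also have "(\<Sum>i\<in>A. expect (P A) (\<lambda>v. excess B (v i))) = (\<Sum>i\<in>A. tail B i)"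
    using A by (intro sum.cong E_component) auto
  also have "10 * B / L * (c + 2 * (\<Sum>k<m. expect (P A) (\<lambda>v. 2 powr (u k v - c))))
      \<le> 10 * B / L * (c + 2 * 1)"
  proof (intro mult_left_mono add_left_mono)
    have "(\<Sum>k<m. expect (P A) (\<lambda>v. 2 powr (u k v - c))) \<le> (\<Sum>k<m. 2 powr (38 * real L) / 2 powr c)"
      using mom by (intro sum_mono) (simp add: powr_diff divide_right_mono)
    also have "\<dots> = real m * (2 powr (38 * real L) / 2 powr c)" by simp
    also have "2 powr (38 * real L) / 2 powr c = 1 / 2 ^ L"
      by (simp add: c_def powr_minus_divide powr_realpow flip: powr_diff)
    also have "real m * (1 / 2 ^ L) \<le> 1"
      using of_nat_mono[OF less_imp_le[OF L_bounds(2)], where 'a = real] by simp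
    finally show "(\<Sum>k<m. expect (P A) (\<lambda>v. 2 powr (u k v - c))) \<le> 1" .
  qed (use B in auto)
  also have "10 * B / L * (c + 2 * 1) \<le> 410 * B"
  proof -
    have "10 * B / L * (c + 2 * 1) \<le> 10 * B / L * (41 * real L)"
      using B L by (intro mult_left_mono) (auto simp: c_def)
    also have "\<dots> = 410 * B" using L by simp
    finally show ?thesis .
  qed
  also note tail_sum_le
  finally show ?thesis by simp
qed

end

end

section \<open>A greedy covering lemma\<close>

text \<open>Elements are ordered by the ratio \<open>w / c\<close> and then by index.\<close>

definition before :: "(nat \<Rightarrow> real) \<Rightarrow> (nat \<Rightarrow> real) \<Rightarrow> nat \<Rightarrow> nat \<Rightarrow> bool" where
  "before w c j i \<longleftrightarrow> w j * c i < w i * c j \<or> w j * c i = w i * c j \<and> j < i"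

text \<open>Elements are taken in order until their cost reaches \<open>d\<close>, including the one
  that gets there. The condition involves only the cost of the predecessors, so membership can be
  decided for each element separately.\<close>

definition greedy :: "(nat \<Rightarrow> real) \<Rightarrow> (nat \<Rightarrow> real) \<Rightarrow> nat set \<Rightarrow> real \<Rightarrow> nat set" where
  "greedy w c E d = {i \<in> E. (\<Sum>j\<in>{j \<in> E. before w c j i}. c j) < d}"

lemma before_iff:
  assumes "0 < c i" "0 < c j"
  shows "before w c j i \<longleftrightarrow> w j / c j < w i / c i \<or> w j / c j = w i / c i \<and> j < i"
  using assms by (simp add: before_def field_simps)

text \<open>The first element left out has only chosen predecessors, and they cost at least
  \<open>d\<close>, for otherwise it would have been chosen too.\<close>

lemma greedy_cover:
  assumes E: "finite E" "\<And>i. i \<in> E \<Longrightarrow> 0 < c i" and d: "d \<le> sum c E"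
  shows "d \<le> sum c (greedy w c E d)"
proof (cases "greedy w c E d = E")
  case False
  let ?R = "greedy w c E d"
  have "E - ?R \<noteq> {}" "finite (E - ?R)" using False E(1) by (auto simp: greedy_def)
  have "\<exists>i\<in>E - ?R. \<forall>j\<in>E - ?R. \<not> before w c j i"
  proof -
    define \<mu> where "\<mu> = Min ((\<lambda>i. w i / c i) ` (E - ?R))"
    have mu: "\<mu> \<in> (\<lambda>i. w i / c i) ` (E - ?R)" "\<And>j. j \<in> E - ?R \<Longrightarrow> \<mu> \<le> w j / c j"
      unfolding \<mu>_def using \<open>E - ?R \<noteq> {}\<close> \<open>finite (E - ?R)\<close> by (auto intro!: Min_in Min_le simp del: Diff_iff)
    define i where "i = (LEAST i. i \<in> E - ?R \<and> w i / c i = \<mu>)"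
    have i: "i \<in> E - ?R \<and> w i / c i = \<mu>" unfolding i_def by (rule LeastI_ex) (use mu(1) in auto)
    have "\<not> before w c j i" if j: "j \<in> E - ?R" for j
    proof -
      have "i \<le> j" if "w j / c j = \<mu>" unfolding i_def by (rule Least_le) (use that j in auto)
      then show ?thesis using before_iff[of c i j w] E(2) i j mu(2)[OF j] by auto
    qed
    then show ?thesis using i by blast
  qed
  then obtain i where i: "i \<in> E" "i \<notin> ?R" and least: "\<And>j. j \<in> E - ?R \<Longrightarrow> \<not> before w c j i" by blast
  have "d \<le> (\<Sum>j\<in>{j \<in> E. before w c j i}. c j)" using i by (auto simp: greedy_def)
  also have "\<dots> \<le> sum c ?R"
  proof (rule sum_mono2)
    show "{j \<in> E. before w c j i} \<subseteq> ?R" using least by blast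
  qed (use E in \<open>auto simp: greedy_def intro: less_imp_le\<close>)
  finally show ?thesis .
qed (use d in simp)

text \<open>An exchange argument. Without its last element \<open>l\<close> the greedy set costs
  less than \<open>d\<close>, hence less than \<open>T\<close>. What it has beyond \<open>T\<close>
  has at most the ratio of \<open>l\<close>, and what \<open>T\<close> has beyond it has at least
  that ratio, so it weighs no more than \<open>T\<close>. Finally \<open>l\<close> adds at most
  \<open>k\<close>.\<close>

lemma greedy_weight:
  assumes E: "finite E" "\<And>i. i \<in> E \<Longrightarrow> 0 < c i" and w: "\<And>i. i \<in> E \<Longrightarrow> 0 \<le> w i" "\<And>i. i \<in> E \<Longrightarrow> w i \<le> k"
    and T: "T \<subseteq> E" "d \<le> sum c T" "sum w T \<le> k"
  shows "sum w (greedy w c E d) \<le> 2 * k"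
proof (cases "greedy w c E d = {}")
  case True
  have "0 \<le> sum w T" using w(1) T(1) by (intro sum_nonneg) auto
  then show ?thesis using True T(3) by simp
next
  case False
  let ?R = "greedy w c E d"
  have R: "finite ?R" "?R \<subseteq> E" using E(1) by (auto simp: greedy_def)
  define \<mu> where "\<mu> = Max ((\<lambda>i. w i / c i) ` ?R)"
  have mu: "\<mu> \<in> (\<lambda>i. w i / c i) ` ?R" "\<And>j. j \<in> ?R \<Longrightarrow> w j / c j \<le> \<mu>"
    unfolding \<mu>_def using False R by (auto intro!: Max_in)
  define l where "l = Max {i \<in> ?R. w i / c i = \<mu>}"
  have l': "l \<in> {i \<in> ?R. w i / c i = \<mu>}" unfolding l_def by (rule Max_in) (use R mu(1) in auto)
  then have l: "l \<in> ?R" "w l / c l = \<mu>" "l \<in> E" using R by auto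
  have last: "before w c j l" if j: "j \<in> ?R - {l}" for j
  proof -
    have "j \<le> l" if "w j / c j = \<mu>" unfolding l_def by (rule Max_ge) (use that j R in auto)
    then show ?thesis using before_iff[of c l j w] E(2) l j R(2) mu(2)[of j] by fastforce
  qed
  let ?S = "?R - {l}"
  have "sum c ?S \<le> (\<Sum>j\<in>{j \<in> E. before w c j l}. c j)"
    using last R E by (intro sum_mono2) (auto intro: less_imp_le)
  also have "\<dots> < d" using l(1) by (auto simp: greedy_def)
  finally have c: "sum c ?S \<le> sum c T" using T(2) by linarith
  have fS: "finite ?S" and fT: "finite T" using R E T(1) by (auto intro: finite_subset)
  have split: "sum f ?S = sum f (?S - T) + sum f (?S \<inter> T)" "sum f T = sum f (T - ?S) + sum f (?S \<inter> T)"
    for f :: "nat \<Rightarrow> real"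
    using sum.Int_Diff[OF fS, of f T] sum.Int_Diff[OF fT, of f ?S] by (simp_all add: Int_commute)
  have mu0: "0 \<le> \<mu>" using l w(1)[OF l(3)] E(2)[OF l(3)] by auto
  have "sum w (?S - T) \<le> (\<Sum>i\<in>?S - T. \<mu> * c i)"
  proof (rule sum_mono)
    fix i assume "i \<in> ?S - T"
    then have "w i / c i \<le> \<mu>" "0 < c i" using mu(2) E(2) R(2) by auto
    then show "w i \<le> \<mu> * c i" by (simp add: pos_divide_le_eq)
  qed
  also have "\<dots> = \<mu> * sum c (?S - T)" by (simp add: sum_distrib_left)
  also have "\<dots> \<le> \<mu> * sum c (T - ?S)"
    using c split[of c] mu0 by (intro mult_left_mono) auto
  also have "\<dots> = (\<Sum>i\<in>T - ?S. \<mu> * c i)" by (simp add: sum_distrib_left)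
  also have "\<dots> \<le> sum w (T - ?S)"
  proof (rule sum_mono)
    fix i assume i: "i \<in> T - ?S"
    then have iE: "i \<in> E" using T(1) by auto
    show "\<mu> * c i \<le> w i"
    proof (cases "i = l")
      case True
      then show ?thesis using l E(2)[OF l(3)] by auto
    next
      case False
      then have "i \<notin> ?R" using i by auto
      \<comment> \<open>With a smaller ratio, every predecessor of \<open>i\<close> would precede
        \<open>l\<close> as well; their cost would be below \<open>d\<close>, and \<open>i\<close>
        would have been chosen.\<close>
      have "\<mu> \<le> w i / c i"
      proof (rule ccontr)
        assume less: "\<not> \<mu> \<le> w i / c i"
        have "{j \<in> E. before w c j i} \<subseteq> {j \<in> E. before w c j l}"
        proof safe
          fix j assume j: "j \<in> E" "before w c j i"
          then show "before w c j l" using less before_iff[of c i j w] before_iff[of c l j w] E(2) iE l by auto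
        qed
        then have "(\<Sum>j\<in>{j \<in> E. before w c j i}. c j) \<le> (\<Sum>j\<in>{j \<in> E. before w c j l}. c j)"
          using E by (intro sum_mono2) (auto intro: less_imp_le)
        then have "i \<in> ?R" using l(1) iE by (auto simp: greedy_def)
        with \<open>i \<notin> ?R\<close> show False ..
      qed
      then show ?thesis using E(2)[OF iE] by (simp add: pos_le_divide_eq)
    qed
  qed
  finally have "sum w ?S \<le> sum w T" using split[of w] by linarith
  moreover have "sum w ?R = w l + sum w ?S" using R(1) l(1) by (rule sum.remove)
  moreover have "w l \<le> k" using w(2)[OF l(3)] .
  ultimately show ?thesis using T(3) by linarith
qed

lemma finite_assignments: "finite A \<Longrightarrow> finite (assignments I A)"
  unfolding assignments_def by (intro finite_PiE) auto

lemma assignments_nonempty: "0 < machines I \<Longrightarrow> assignments I A \<noteq> {}"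
  unfolding assignments_def by (subst PiE_eq_empty_iff) auto

lemma makespan_cong:
  assumes "\<And>i. i \<in> A \<Longrightarrow> a i = b i" "\<And>i. i \<in> A \<Longrightarrow> v i = w i"
  shows "makespan I A a v = makespan I A b w"
proof -
  have "(\<Sum>i\<in>{i \<in> A. a i = k}. v i) = (\<Sum>i\<in>{i \<in> A. b i = k}. w i)" for k
    using assms by (intro sum.cong) auto
  then show ?thesis unfolding makespan_def by simp
qed

section \<open>The choice of the scale\<close>

context machine_sizes
begin

definition opt :: "nat set \<Rightarrow> real" where
  "opt A = (MIN a\<in>assignments I A. expect (P A) (makespan I A a))"

definition mean :: "nat \<Rightarrow> real" where
  "mean i = expect (Q i) (\<lambda>x. x)"

text \<open>Scale \<open>0\<close> gets its own weights, which certify that all sizes vanish.\<close>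

definition scaled_weight :: "real \<Rightarrow> nat \<Rightarrow> real" where
  "scaled_weight B i = (if B = 0 then (if mean i = 0 then 0 else 5) else weight B i)"

text \<open>The index \<open>t\<close> encodes a job and the exponent of a power of two; the last index stands for scale \<open>0\<close>.\<close>

definition scale :: "nat \<Rightarrow> nat \<Rightarrow> real" where
  "scale n t = (let J = floorlog 2 n + 2 in if t < n * J then mean (t div J) * 2 ^ (t mod J) else 0)"

lemma opt_le: "finite A \<Longrightarrow> a \<in> assignments I A \<Longrightarrow> opt A \<le> expect (P A) (makespan I A a)"
  unfolding opt_def by (intro Min_le) (auto intro: finite_assignments)

lemma opt_attained:
  assumes "finite A"
  obtains a where "a \<in> assignments I A" "opt A = expect (P A) (makespan I A a)"
proof -
  have "opt A \<in> (\<lambda>a. expect (P A) (makespan I A a)) ` assignments I A"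
    unfolding opt_def using assms machines_pos
    by (intro Min_in) (auto simp: finite_assignments assignments_nonempty)
  then show thesis using that by blast
qed

lemma opt_le_of:
  assumes "finite A" "\<And>i. i \<in> A \<Longrightarrow> a i < m"
  shows "opt A \<le> expect (P A) (makespan I A a)"
proof -
  have "restrict a A \<in> assignments I A" using assms(2) by (auto simp: assignments_def)
  moreover have "makespan I A (restrict a A) = makespan I A a"
    by (intro ext makespan_cong) auto
  ultimately show ?thesis using opt_le[OF assms(1)] by metis
qed

lemma mean_nonneg: "0 \<le> mean i"
  unfolding mean_def by (intro E_nonneg nonneg)

lemma mean_zero: "mean i = 0 \<Longrightarrow> x \<in> set_pmf (Q i) \<Longrightarrow> x = 0"
  unfolding mean_def by (rule E_zero_imp[where f = "\<lambda>x. x" and M = "Q i", OF fin nonneg])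

lemma mean_le_opt:
  assumes "finite A" "i \<in> A"
  shows "mean i \<le> opt A"
proof -
  obtain a where a: "a \<in> assignments I A" "opt A = expect (P A) (makespan I A a)"
    using opt_attained[OF assms(1)] .
  have "mean i = expect (P A) (\<lambda>v. v i)"
    unfolding mean_def using assms by (intro E_component[symmetric])
  also have "\<dots> \<le> expect (P A) (makespan I A a)"
    using assms a(1) by (intro E_mono finite_P job_le_makespan) (auto simp: assignments_def P_nonneg)
  finally show ?thesis using a(2) by simp
qed

lemma opt_nonneg: "finite A \<Longrightarrow> 0 \<le> opt A"
proof -
  assume A: "finite A"
  obtain a where "opt A = expect (P A) (makespan I A a)"
    using opt_attained[OF A] by blast
  then show ?thesis using P_nonneg[OF A] by (simp add: E_nonneg makespan_nonneg)
qed

lemma opt_le_sum_mean: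
  assumes "finite A"
  shows "opt A \<le> (\<Sum>i\<in>A. mean i)"
proof -
  have "opt A \<le> expect (P A) (makespan I A (\<lambda>_. 0))"
    using assms machines_pos by (intro opt_le_of) auto
  also have "\<dots> \<le> expect (P A) (\<lambda>v. \<Sum>i\<in>A. v i)"
    using assms by (intro E_mono finite_P makespan_le sum_mono2) (auto simp: P_nonneg)
  also have "\<dots> = (\<Sum>i\<in>A. mean i)"
    unfolding mean_def using assms by (simp add: E_sum finite_P E_component[where f = "\<lambda>x. x"])
  finally show ?thesis .
qed

lemma scaled_weight_nonneg: "0 \<le> B \<Longrightarrow> 0 \<le> scaled_weight B i"
  unfolding scaled_weight_def weight_def
  by (auto intro!: add_nonneg_nonneg divide_nonneg_nonneg eff_nonneg moment_bounds tail_nonneg)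

lemma scaled_weight_sum_le:
  assumes A: "finite A" and B: "0 \<le> B" "opt A \<le> B / 2"
  shows "(\<Sum>i\<in>A. scaled_weight B i) \<le> 2"
proof (cases "B = 0")
  case True
  have "mean i = 0" if "i \<in> A" for i
    using mean_le_opt[OF A that] mean_nonneg[of i] B True by simp
  then show ?thesis using True by (simp add: scaled_weight_def)
next
  case False
  obtain a where a: "a \<in> assignments I A" "opt A = expect (P A) (makespan I A a)"
    using opt_attained[OF A] .
  have "(\<Sum>i\<in>A. weight B i) \<le> 2"
    using A a B False by (intro weight_sum_le[of A a]) (auto simp: assignments_def)
  then show ?thesis using False by (simp add: scaled_weight_def)
qed

lemma interval_correct:
  assumes A: "finite A" and B: "0 \<le> B" and w: "(\<Sum>i\<in>A. scaled_weight B i) \<le> 4"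
  shows "interval B A i < m"
    "expect (P A) (makespan I A (interval B A)) \<le> 414 * B"
proof -
  have "interval B A i < m \<and> expect (P A) (makespan I A (interval B A)) \<le> 414 * B"
  proof (cases "B = 0")
    case True
    \<comment> \<open>At scale 0 a job of positive mean weighs 5, more than the admissible total
      4.\<close>
    have "scaled_weight B i \<le> 4" if "i \<in> A" for i
      using member_le_sum[of i A "scaled_weight B"] scaled_weight_nonneg[OF B] A that w by fastforce
    then have "mean i = 0" if "i \<in> A" for i
      using that[THEN \<open>\<And>i. i \<in> A \<Longrightarrow> scaled_weight B i \<le> 4\<close>] True
      by (simp add: scaled_weight_def split: if_splits)
    then have zero: "v i = 0" if "v \<in> set_pmf (P A)" "i \<in> A" for v i
      using that A mean_zero[of i "v i"] by (auto simp: set_P dest: spec[of _ i])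
    have "makespan I A (interval B A) v \<le> 0" if "v \<in> set_pmf (P A)" for v
      by (intro makespan_le sum_nonpos) (simp add: zero[OF that])
    then have "expect (P A) (makespan I A (interval B A)) \<le>
        expect (P A) (\<lambda>_. 0)"
      using A by (intro E_mono finite_P) auto
    moreover have "level L 0 x = 0" for x by (simp add: level_def)
    then have "interval 0 A i = 0" by (simp add: interval_def xpow_def eff_def)
    ultimately show ?thesis using True machines_pos by simp
  next
    case False
    then have "(\<Sum>i\<in>A. weight B i) \<le> 4" using w by (simp add: scaled_weight_def)
    then show ?thesis using interval_less[OF A _ ] interval_makespan[OF A] B False by simp
  qed
  then show "interval B A i < m"
    "expect (P A) (makespan I A (interval B A)) \<le> 414 * B" by auto
qed

lemma scale_nonneg: "0 \<le> scale n t"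
  by (simp add: scale_def Let_def mean_nonneg)

text \<open>The optimum lies between the largest mean \<open>\<mu>\<close> in \<open>A\<close> and
  \<open>n * \<mu>\<close>. So the least \<open>j\<close> with
  \<open>2 * opt A \<le> 2 ^ j * \<mu>\<close> is at most \<open>floorlog 2 n + 1\<close>, which
  explains the \<open>floorlog 2 n + 2\<close> exponents per job, and by minimality it overshoots by
  a factor of at most 2. All jobs are tried since the one of largest mean depends on
  \<open>A\<close>, which an algorithm choosing the set does not know.\<close>

lemma scale_exists:
  assumes A: "A \<subseteq> {..<n}"
  shows "\<exists>t < n * (floorlog 2 n + 2) + 1. opt A \<le> scale n t / 2 \<and> scale n t \<le> 4 * opt A"
proof (cases "opt A = 0")
  case True
  then show ?thesis by (intro exI[of _ "n * (floorlog 2 n + 2)"]) (simp add: scale_def)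
next
  case False
  have fA: "finite A" using A finite_subset by blast
  define J where "J = floorlog 2 n + 2"
  define \<mu> where "\<mu> = Max (mean ` A)"
  have V: "0 < opt A" using False opt_nonneg[OF fA] by simp
  have "A \<noteq> {}" using opt_le_sum_mean[OF fA] V by auto
  then have "\<mu> \<in> mean ` A" unfolding \<mu>_def using fA by (intro Max_in) auto
  then obtain i where i: "i \<in> A" "\<mu> = mean i" by auto
  have "opt A \<le> (\<Sum>i\<in>A. \<mu>)"
    by (rule order_trans[OF opt_le_sum_mean[OF fA] sum_mono]) (simp add: \<mu>_def fA)
  also have "\<dots> \<le> real n * \<mu>"
    using card_mono[OF _ A] mean_nonneg[of i] i(2) by (simp add: mult_right_mono)
  finally have upper: "opt A \<le> real n * \<mu>" .
  have lower: "\<mu> \<le> opt A" using mean_le_opt[OF fA i(1)] i(2) by simp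
  have "n < 2 ^ floorlog 2 n" using floorlog_leD[of 2 n "floorlog 2 n"] by simp
  then have n: "real n < 2 ^ floorlog 2 n" using of_nat_less_iff[of n "2 ^ floorlog 2 n", where 'a = real] by simp
  have mu: "0 < \<mu>" using V upper mean_nonneg[of i] i(2) by (auto simp: less_le)
  have ex: "2 * opt A \<le> 2 ^ (floorlog 2 n + 1) * \<mu>"
  proof -
    have "2 * opt A \<le> 2 * (2 ^ floorlog 2 n * \<mu>)" using upper n mu mult_right_mono[of "real n" "2 ^ floorlog 2 n" \<mu>] by linarith
    then show ?thesis by simp
  qed
  define j where "j = (LEAST j. 2 * opt A \<le> 2 ^ j * \<mu>)"
  have j: "2 * opt A \<le> 2 ^ j * \<mu>" unfolding j_def using ex by (rule LeastI)
  have "j \<le> floorlog 2 n + 1" unfolding j_def using ex by (rule Least_le)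
  then have jJ: "j < J" by (simp add: J_def)
  have "j \<noteq> 0"
  proof
    assume "j = 0"
    then have "2 * opt A \<le> \<mu>" using j by simp
    then show False using lower V by linarith
  qed
  then obtain j' where j': "j = Suc j'" using not0_implies_Suc by blast
  have "\<not> 2 * opt A \<le> 2 ^ j' * \<mu>"
    using not_less_Least[of j' "\<lambda>j. 2 * opt A \<le> 2 ^ j * \<mu>"] j' by (simp add: j_def)
  then have j2: "2 ^ j * \<mu> \<le> 4 * opt A" unfolding j' power_Suc mult.assoc by linarith
  have "i < n" using i A by auto
  then have "i * J + j < n * J"
    using jJ mult_le_mono1[of "Suc i" n J] by simp
  moreover have "scale n (i * J + j) = mean i * 2 ^ j"
    using calculation jJ unfolding scale_def J_def[symmetric] Let_def by simp
  ultimately show ?thesis unfolding J_def[symmetric] using j j2 i(2)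
    by (intro exI[of _ "i * J + j"]) (simp add: mult.commute)
qed

text \<open>The smallest scale that passes the test \<open>F\<close>. Whatever good scale the
  analysis exhibits, the one found is no larger, while the quality of the output at that scale rests
  on the test alone.\<close>

definition best_scale :: "nat \<Rightarrow> (nat \<Rightarrow> bool) \<Rightarrow> nat" where
  "best_scale n F = (LEAST t. t < n * (floorlog 2 n + 2) + 1 \<and> F t \<and>
     (\<forall>s < n * (floorlog 2 n + 2) + 1. F s \<longrightarrow> scale n t \<le> scale n s))"

text \<open>The bound on \<open>t\<close> appears twice: as part of the predicate minimised in
  \<open>best_scale\<close> and as the search range that \<open>pnat_Least\<close> asks for.\<close>

lemma best_scale_exists:
  assumes "s < n * (floorlog 2 n + 2) + 1" "F s"
  shows "\<exists>t < n * (floorlog 2 n + 2) + 1. t < n * (floorlog 2 n + 2) + 1 \<and> F t \<and>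
     (\<forall>s < n * (floorlog 2 n + 2) + 1. F s \<longrightarrow> scale n t \<le> scale n s)"
proof -
  let ?T = "{t. t < n * (floorlog 2 n + 2) + 1 \<and> F t}"
  have "finite ?T" "s \<in> ?T" using assms by auto
  then have "Min (scale n ` ?T) \<in> scale n ` ?T" by (intro Min_in) auto
  then obtain t where t: "t \<in> ?T" "scale n t = Min (scale n ` ?T)" by auto
  have "scale n t \<le> scale n s" if "s \<in> ?T" for s
    unfolding t(2) using that \<open>finite ?T\<close> by (intro Min_le) auto
  then show ?thesis using t(1) by blast
qed

lemma best_scale:
  assumes "s < n * (floorlog 2 n + 2) + 1" "F s"
  shows "F (best_scale n F)" "scale n (best_scale n F) \<le> scale n s"
proof -
  have "\<exists>t. t < n * (floorlog 2 n + 2) + 1 \<and> F t \<and>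
     (\<forall>s < n * (floorlog 2 n + 2) + 1. F s \<longrightarrow> scale n t \<le> scale n s)"
    using best_scale_exists[where n = n and s = s and F = F] assms by blast
  from LeastI_ex[OF this] show "F (best_scale n F)" "scale n (best_scale n F) \<le> scale n s"
    unfolding best_scale_def[symmetric] using assms by auto
qed

definition light :: "nat \<Rightarrow> nat \<Rightarrow> bool" where
  "light n t \<longleftrightarrow> (\<Sum>i<n. scaled_weight (scale n t) i) \<le> 4"

text \<open>The factor is \<open>4 * 414\<close>: a scale of at most 4 times the optimum passes the
  test, and \<open>interval_correct\<close> costs 414 times the scale found. The last claim
  guarantees that the search for the scale succeeds, as its polynomial-time implementation
  requires.\<close>

theorem schedule_correct:
  fixes n :: nat
  defines "a \<equiv> interval (scale n (best_scale n (light n))) {..<n}"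
  shows "a i < m" "expect (P {..<n}) (makespan I {..<n} a) \<le> 1656 * opt {..<n}"
    "\<exists>s < n * (floorlog 2 n + 2) + 1. light n s"
proof -
  obtain s where s: "s < n * (floorlog 2 n + 2) + 1" "opt {..<n} \<le> scale n s / 2"
    "scale n s \<le> 4 * opt {..<n}"
    using scale_exists[of "{..<n}" n] by blast
  have "light n s"
    unfolding light_def using scaled_weight_sum_le[OF _ scale_nonneg s(2)] by simp
  then show "\<exists>s < n * (floorlog 2 n + 2) + 1. light n s" using s(1) by blast
  note best = best_scale[of s n "light n", OF s(1) \<open>light n s\<close>]
  note corr = interval_correct[OF finite_lessThan scale_nonneg iffD1[OF light_def best(1)]]
  show "a i < m" unfolding a_def by (rule corr(1))
  have "expect (P {..<n}) (makespan I {..<n} a) \<le> 414 * scale n (best_scale n (light n))"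
    unfolding a_def by (rule corr(2))
  also have "\<dots> \<le> 1656 * opt {..<n}" using best(2) s(3) by simp
  finally show "expect (P {..<n}) (makespan I {..<n} a) \<le> 1656 * opt {..<n}" .
qed

text \<open>The jobs left unprobed. Within budget \<open>C\<close>, unprobed jobs must account for
  at least the total cost minus \<open>C\<close>, which is the demand to be covered. Jobs of cost 0
  are always probed. A job of weight above 2 lies in no set whose optimum is at most half the
  scale.\<close>

definition kept :: "(nat \<Rightarrow> real) \<Rightarrow> real \<Rightarrow> nat \<Rightarrow> nat \<Rightarrow> nat set" where
  "kept c C n t = greedy (scaled_weight (scale n t)) c
     {i. i < n \<and> 0 < c i \<and> scaled_weight (scale n t) i \<le> 2} ((\<Sum>i<n. c i) - C)"

definition affordable :: "(nat \<Rightarrow> real) \<Rightarrow> real \<Rightarrow> nat \<Rightarrow> nat \<Rightarrow> bool" where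
  "affordable c C n t \<longleftrightarrow> (\<Sum>i<n. c i) \<le> C + (\<Sum>i\<in>kept c C n t. c i) \<and>
     (\<Sum>i\<in>kept c C n t. scaled_weight (scale n t) i) \<le> 4"

text \<open>The jobs of positive cost outside \<open>S\<close> meet the demand, and at the scale for
  their optimum they have weight at most 2. So the greedy choice passes the test there with weight
  at most 4.\<close>

theorem kept_correct:
  assumes c: "\<And>i. i < n \<Longrightarrow> 0 \<le> c i" and S: "S \<subseteq> {..<n}" "(\<Sum>i\<in>S. c i) \<le> C"
  defines "R \<equiv> kept c C n (best_scale n (affordable c C n))"
  shows "R \<subseteq> {..<n}" "(\<Sum>i\<in>{..<n} - R. c i) \<le> C" "opt R \<le> 1656 * opt ({..<n} - S)"
    "\<exists>s < n * (floorlog 2 n + 2) + 1. affordable c C n s"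
proof -
  let ?U = "{..<n} - S"
  obtain s where s: "s < n * (floorlog 2 n + 2) + 1" "opt ?U \<le> scale n s / 2"
    "scale n s \<le> 4 * opt ?U"
    using scale_exists[of ?U n] by blast
  let ?w = "scaled_weight (scale n s)"
  let ?E = "{i. i < n \<and> 0 < c i \<and> ?w i \<le> 2}"
  let ?T = "{i \<in> ?U. 0 < c i}"
  let ?d = "(\<Sum>i<n. c i) - C"
  note w0 = scaled_weight_nonneg[OF scale_nonneg]
  have wU: "(\<Sum>i\<in>?U. ?w i) \<le> 2" using s(2) by (intro scaled_weight_sum_le scale_nonneg) auto
  have E: "finite ?E" "\<And>i. i \<in> ?E \<Longrightarrow> 0 < c i" by auto
  have "?w i \<le> 2" if "i \<in> ?U" for i
    using member_le_sum[of i ?U ?w] w0 that wU by fastforce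
  then have T: "?T \<subseteq> ?E" by auto
  have "sum c ?T = sum c ?U"
    using c by (intro sum.mono_neutral_left) (auto simp: less_le)
  moreover have "sum c {..<n} = sum c ?U + sum c S" using S(1) by (intro sum.subset_diff) auto
  ultimately have dT: "?d \<le> sum c ?T" using S(2) by linarith
  also have "\<dots> \<le> sum c ?E" by (rule sum_mono2[OF _ T]) auto
  finally have dE: "?d \<le> sum c ?E" .
  have wT: "sum ?w ?T \<le> 2"
    using wU sum_mono2[of ?U ?T ?w] w0 by fastforce
  have "sum ?w (kept c C n s) \<le> 2 * 2"
    unfolding kept_def by (rule greedy_weight[OF E _ _ T dT wT]) (auto simp: w0)
  moreover have "?d \<le> sum c (kept c C n s)"
    unfolding kept_def by (rule greedy_cover[OF E dE])
  ultimately have "affordable c C n s" unfolding affordable_def by simp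
  then show "\<exists>s < n * (floorlog 2 n + 2) + 1. affordable c C n s" using s(1) by blast
  note best = best_scale[of s n "affordable c C n", OF s(1) \<open>affordable c C n s\<close>]
  show R: "R \<subseteq> {..<n}" unfolding R_def kept_def by (auto simp: greedy_def)
  have "sum c {..<n} = sum c ({..<n} - R) + sum c R" using R by (intro sum.subset_diff) auto
  moreover have "sum c {..<n} \<le> C + sum c R" using best(1) unfolding affordable_def R_def by blast
  ultimately show "sum c ({..<n} - R) \<le> C" by linarith
  have fR: "finite R" using R finite_subset by blast
  have "(\<Sum>i\<in>R. scaled_weight (scale n (best_scale n (affordable c C n))) i) \<le> 4"
    using best(1) unfolding affordable_def R_def by blast
  note corr = interval_correct[OF fR scale_nonneg this]
  have "opt R \<le> 414 * scale n (best_scale n (affordable c C n))"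
    by (rule order_trans[OF opt_le_of[OF fR] corr(2)]) (rule corr(1))
  also have "\<dots> \<le> 1656 * opt ?U" using best(2) s(3) by simp
  finally show "opt R \<le> 1656 * opt ?U" .
qed

end

text \<open>Observed sizes become point masses. The situation after probing is thus again a family
  of independent sizes, and one analysis serves both algorithms. The point mass at 0 outside the job
  set makes the conditions of \<open>job_sizes\<close> hold at every index.\<close>

definition law :: "sched \<Rightarrow> nat set \<Rightarrow> (nat \<Rightarrow> real) \<Rightarrow> nat \<Rightarrow> real pmf" where
  "law I S v i = (if i \<in> job_set I then if i \<in> S then return_pmf (v i) else job_size I i
     else return_pmf 0)"

lemma valid_job:
  assumes "valid I" "i < length (jobs I)"
  shows "0 \<le> job_cost I i" "job_cost I i \<le> budget I" "pmf_of_list_wf (snd (jobs I ! i))"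
    "\<And>x p. (x, p) \<in> set (snd (jobs I ! i)) \<Longrightarrow> 0 \<le> x"
proof -
  obtain c d where cd: "jobs I ! i = (c, d)" by (cases "jobs I ! i")
  then have "(c, d) \<in> set (jobs I)" using assms(2) nth_mem by metis
  then have *: "0 \<le> c \<and> c \<le> budget I \<and> pmf_of_list_wf d \<and> (\<forall>(x, p)\<in>set d. 0 \<le> x)"
    using assms(1) unfolding valid_def by blast
  then show "0 \<le> job_cost I i" "job_cost I i \<le> budget I" "pmf_of_list_wf (snd (jobs I ! i))"
    by (simp_all add: job_cost_def cd)
  show "0 \<le> x" if "(x, p) \<in> set (snd (jobs I ! i))" for x p
    using * that unfolding cd by auto
qed

lemma finite_job_size: "valid I \<Longrightarrow> i \<in> job_set I \<Longrightarrow> finite (set_pmf (job_size I i))"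
  unfolding job_size_def using valid_job(3) by (auto intro: finite_set_pmf_of_list)

lemma set_job_size:
  assumes "valid I" "i \<in> job_set I" "x \<in> set_pmf (job_size I i)"
  obtains p where "(x, p) \<in> set (snd (jobs I ! i))"
proof -
  have "x \<in> set (map fst (snd (jobs I ! i)))"
    using assms set_pmf_of_list[OF valid_job(3)[of I i]] unfolding job_size_def by auto
  then show thesis using that by force
qed

lemma machine_sizes_law:
  assumes "valid I" "\<And>i. i \<in> S \<Longrightarrow> 0 \<le> v i"
  shows "machine_sizes (law I S v) I"
proof
  show "finite (set_pmf (law I S v i))" for i
    using finite_job_size[OF assms(1)] by (simp add: law_def)
  show "0 \<le> x" if "x \<in> set_pmf (law I S v i)" for x i
    using that assms set_job_size[OF assms(1), of i x] valid_job(4)[OF assms(1), of i x]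
    by (auto simp: law_def split: if_splits)
  show "0 < machines I" using assms(1) by (simp add: valid_def)
qed

lemma sizes_eq_law: "A \<subseteq> job_set I \<Longrightarrow> S \<inter> A = {} \<Longrightarrow> sizes I A = Pi_pmf A 0 (law I S v)"
  unfolding sizes_def by (intro Pi_pmf_cong) (auto simp: law_def)

lemma Pi_law:
  assumes "S \<subseteq> job_set I"
  shows "Pi_pmf (job_set I) 0 (law I S v) = map_pmf (\<lambda>w. override_on w v S) (sizes I (job_set I - S))"
proof -
  have fS: "finite S" using assms finite_subset by blast
  have "Pi_pmf (S \<union> (job_set I - S)) 0 (law I S v) =
      map_pmf (\<lambda>(f, g) x. if x \<in> S then f x else g x)
        (pair_pmf (Pi_pmf S 0 (law I S v)) (Pi_pmf (job_set I - S) 0 (law I S v)))"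
    using fS by (intro Pi_pmf_union) auto
  also have "Pi_pmf S 0 (law I S v) = Pi_pmf S 0 (\<lambda>i. return_pmf (v i))"
    using assms by (intro Pi_pmf_cong) (auto simp: law_def)
  also have "\<dots> = return_pmf (\<lambda>i. if i \<in> S then v i else 0)" using fS by simp
  also have "Pi_pmf (job_set I - S) 0 (law I S v) = sizes I (job_set I - S)"
    by (intro sizes_eq_law[symmetric]) auto
  finally have "Pi_pmf (S \<union> (job_set I - S)) 0 (law I S v) =
      map_pmf (\<lambda>w x. if x \<in> S then if x \<in> S then v x else 0 else w x) (sizes I (job_set I - S))"
    by (simp add: pair_return_pmf1 pmf.map_comp o_def)
  also have "(\<lambda>w x. if x \<in> S then if x \<in> S then v x else 0 else w x) = (\<lambda>w. override_on w v S)"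
    by (auto simp: override_on_def fun_eq_iff)
  finally show ?thesis using assms by (simp add: Un_absorb1)
qed

lemma expected_makespan_law:
  assumes "S \<subseteq> job_set I"
  shows "expected_makespan I S v a =
    expect (Pi_pmf (job_set I) 0 (law I S v)) (makespan I (job_set I) a)"
  unfolding expected_makespan_def Pi_law[OF assms] by simp

lemma best_value_law:
  assumes "valid I" "S \<subseteq> job_set I" "\<And>i. i \<in> S \<Longrightarrow> 0 \<le> v i"
  shows "best_value I S v = machine_sizes.opt (law I S v) I (job_set I)"
proof -
  interpret machine_sizes "law I S v" I by (rule machine_sizes_law) (use assms in auto)
  show ?thesis unfolding best_value_def opt_def expected_makespan_law[OF assms(2)] ..
qed

lemma outlier_value_law:
  assumes "valid I"
  shows "outlier_value I S = machine_sizes.opt (law I {} v) I (job_set I - S)"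
proof -
  interpret machine_sizes "law I {} v" I by (rule machine_sizes_law) (use assms in auto)
  have "sizes I (job_set I - S) = P (job_set I - S)" by (rule sizes_eq_law) auto
  then show ?thesis unfolding outlier_value_def opt_def by simp
qed

section \<open>Reading the input\<close>

type_synonym observation = "sched \<times> nat set \<times> (nat \<Rightarrow> real)"

abbreviation inst :: "observation \<Rightarrow> sched" where "inst x \<equiv> fst x"
abbreviation seen :: "observation \<Rightarrow> nat set" where "seen x \<equiv> fst (snd x)"
abbreviation val_of :: "observation \<Rightarrow> nat \<Rightarrow> real" where "val_of x \<equiv> snd (snd x)"
abbreviation num_jobs :: "observation \<Rightarrow> nat" where "num_jobs x \<equiv> length (jobs (inst x))"
abbreviation lawx :: "observation \<Rightarrow> nat \<Rightarrow> real pmf" where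
  "lawx x \<equiv> law (inst x) (seen x) (val_of x)"

definition enc_obs :: "observation \<Rightarrow> val" where
  "enc_obs x = VPair (enc_sched (inst x)) (enc_observed (seen x) (val_of x))"

definition outcomes :: "observation \<Rightarrow> nat \<Rightarrow> (real \<times> real) list" where
  "outcomes x i = (if i \<in> seen x then [(val_of x i, 1)] else snd (jobs (inst x) ! i))"

lemma observationsD:
  assumes "x \<in> observations"
  shows "valid (inst x)" "rational (inst x)" "seen x \<subseteq> job_set (inst x)"
    "\<And>i. i \<in> seen x \<Longrightarrow> 0 \<le> val_of x i" "\<And>i. i \<in> seen x \<Longrightarrow> val_of x i \<in> \<rat>"
    "machine_sizes (lawx x) (inst x)"
  using assms by (auto simp: observations_def inputs_def intro!: machine_sizes_law)

lemma rational_job: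
  assumes "rational I" "i < length (jobs I)"
  shows "job_cost I i \<in> \<rat>" "\<And>x p. (x, p) \<in> set (snd (jobs I ! i)) \<Longrightarrow> x \<in> \<rat> \<and> p \<in> \<rat>"
proof -
  obtain c d where cd: "jobs I ! i = (c, d)" by (cases "jobs I ! i")
  then have "(c, d) \<in> set (jobs I)" using assms(2) nth_mem by metis
  then have *: "c \<in> \<rat> \<and> (\<forall>(x, p)\<in>set d. x \<in> \<rat> \<and> p \<in> \<rat>)"
    using assms(1) unfolding rational_def by blast
  then show "job_cost I i \<in> \<rat>" by (simp add: job_cost_def cd)
  show "x \<in> \<rat> \<and> p \<in> \<rat>" if "(x, p) \<in> set (snd (jobs I ! i))" for x p
    using * that unfolding cd by auto
qed

lemma pmf_of_list_prob_nonneg: "pmf_of_list_wf d \<Longrightarrow> (x, p) \<in> set d \<Longrightarrow> 0 \<le> p"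
  by (force simp: pmf_of_list_wf_def)

lemma outcomes_good:
  assumes "x \<in> observations" "i < num_jobs x" "k < length (outcomes x i)"
  shows "0 \<le> fst (outcomes x i ! k)" "fst (outcomes x i ! k) \<in> \<rat>"
    "0 \<le> snd (outcomes x i ! k)" "snd (outcomes x i ! k) \<in> \<rat>"
proof -
  note x = observationsD[OF assms(1)]
  obtain y p where yp: "outcomes x i ! k = (y, p)" by (cases "outcomes x i ! k")
  then have "(y, p) \<in> set (outcomes x i)" using assms(3) nth_mem by metis
  then have "0 \<le> y \<and> y \<in> \<rat> \<and> 0 \<le> p \<and> p \<in> \<rat>"
    using x(4,5)[of i] valid_job(4)[OF x(1) assms(2)] rational_job(2)[OF x(2) assms(2)]
      pmf_of_list_prob_nonneg[OF valid_job(3)[OF x(1) assms(2)]]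
    by (auto simp: outcomes_def split: if_splits)
  with yp show "0 \<le> fst (outcomes x i ! k)" "fst (outcomes x i ! k) \<in> \<rat>"
    "0 \<le> snd (outcomes x i ! k)" "snd (outcomes x i ! k) \<in> \<rat>" by auto
qed

text \<open>The list may mention the same size several times. The mass function collects such
  entries, and grouping the list positions by size separates them again.\<close>

lemma expectation_pmf_of_list:
  assumes "pmf_of_list_wf d"
  shows "expect (pmf_of_list d) f = (\<Sum>k<length d. snd (d ! k) * (f (fst (d ! k)) :: real))"
proof -
  have "expect (pmf_of_list d) f =
      (\<Sum>x\<in>fst ` set d. f x * pmf (pmf_of_list d) x)"
    using set_pmf_of_list[OF assms] by (intro integral_measure_pmf_real) auto
  also have "\<dots> = (\<Sum>x\<in>fst ` set d. \<Sum>k\<in>{k \<in> {..<length d}. fst (d ! k) = x}. snd (d ! k) * f (fst (d ! k)))"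
  proof (intro sum.cong refl)
    fix x
    have "sum_list (map snd (filter (\<lambda>z. fst z = x) d)) = sum_list (map (\<lambda>z. if fst z = x then snd z else 0) d)"
      by (rule sum_list_map_filter')
    also have "\<dots> = (\<Sum>k<length d. if fst (d ! k) = x then snd (d ! k) else 0)"
      by (simp add: sum_list_sum_nth atLeast0LessThan)
    also have "\<dots> = (\<Sum>k\<in>{k \<in> {..<length d}. fst (d ! k) = x}. snd (d ! k))"
      by (rule sum.inter_filter[symmetric]) simp
    finally show "f x * pmf (pmf_of_list d) x =
        (\<Sum>k\<in>{k \<in> {..<length d}. fst (d ! k) = x}. snd (d ! k) * f (fst (d ! k)))"
      by (simp add: pmf_pmf_of_list[OF assms] sum_distrib_left mult.commute)
  qed
  also have "\<dots> = (\<Sum>k<length d. snd (d ! k) * f (fst (d ! k)))"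
    by (intro sum.group) auto
  finally show ?thesis .
qed

lemma expectation_law:
  assumes "x \<in> observations" "i < num_jobs x"
  shows "expect (lawx x i) f =
    (\<Sum>k<length (outcomes x i). snd (outcomes x i ! k) * (f (fst (outcomes x i ! k)) :: real))"
  using observationsD[OF assms(1)] assms(2) expectation_pmf_of_list[OF valid_job(3), of "inst x" i f]
  by (auto simp: law_def outcomes_def job_size_def)

text \<open>For a nonnegative rational the \<open>THE\<close> in \<open>enc_rat\<close> denotes its
  unique preimage and \<open>nat\<close> loses nothing, so the encoding already is a fraction of the
  kind used by \<open>preal\<close>.\<close>

lemma preal_enc_rat:
  assumes "polytime_on D inp (\<lambda>x. enc_rat (f x))" "\<And>x. x \<in> D \<Longrightarrow> 0 \<le> f x \<and> f x \<in> \<rat>"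
  shows "preal D inp f"
proof -
  define q where "q x = quotient_of (THE q. of_rat q = f x)" for x
  show ?thesis
    unfolding preal_def
  proof (intro exI conjI ballI)
    show "polytime_on D inp (\<lambda>x. VPair (VNum (nat (fst (q x)))) (VNum (nat (snd (q x)))))"
      using assms(1) by (simp add: enc_rat_def q_def split_def Let_def)
    fix x assume x: "x \<in> D"
    obtain r where r: "f x = of_rat r" using assms(2)[OF x] by (auto elim: Rats_cases)
    have "(THE q. of_rat q = f x) = r" unfolding r by (rule the_equality) auto
    then have q: "quotient_of r = q x" by (simp add: q_def)
    obtain a b where ab: "q x = (a, b)" by (cases "q x")
    have b: "0 < b" using quotient_of_denom_pos[of r a b] q ab by simp
    have r': "r = of_int a / of_int b" using quotient_of_div[of r a b] q ab by simp
    have "0 \<le> r" using assms(2)[OF x] unfolding r by simp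
    then have a: "0 \<le> a" using b unfolding r' by (simp add: zero_le_divide_iff)
    show "0 < nat (snd (q x))" using b ab by simp
    show "f x = real (nat (fst (q x))) / real (nat (snd (q x)))"
      using a b unfolding r r' ab by (simp add: of_rat_divide)
  qed
qed

definition enc_outcome :: "real \<times> real \<Rightarrow> val" where
  "enc_outcome = (\<lambda>(x, p). VPair (enc_rat x) (enc_rat p))"

definition enc_job :: "real \<times> (real \<times> real) list \<Rightarrow> val" where
  "enc_job = (\<lambda>(c, d). VPair (enc_rat c) (enc_list enc_outcome d))"

definition observed_list :: "observation \<Rightarrow> (nat \<times> real) list" where
  "observed_list x = map (\<lambda>i. (i, val_of x i)) (sorted_list_of_set (seen x))"

definition enc_seen :: "nat \<times> real \<Rightarrow> val" where
  "enc_seen = (\<lambda>(i, y). VPair (VNum i) (enc_rat y))"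

lemma enc_list_map: "enc_list e (map f xs) = enc_list (\<lambda>x. e (f x)) xs"
  by (induction xs) (simp_all add: enc_list_def)

lemma enc_obs_eq: "enc_obs x = VPair (VPair (VNum (machines (inst x)))
    (VPair (enc_rat (budget (inst x))) (enc_list enc_job (jobs (inst x)))))
    (enc_list enc_seen (observed_list x))"
  by (simp add: enc_obs_def enc_sched_def enc_observed_def enc_job_def enc_outcome_def enc_seen_def
    observed_list_def enc_list_map)

abbreviation D0 :: "observation set" where "D0 \<equiv> observations"

lemma base:
  shows base_machines: "pnat D0 enc_obs (\<lambda>x. machines (inst x))"
    and base_budget: "polytime_on D0 enc_obs (\<lambda>x. enc_rat (budget (inst x)))"
    and base_jobs: "polytime_on D0 enc_obs (\<lambda>x. enc_list enc_job (jobs (inst x)))"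
    and base_observed: "polytime_on D0 enc_obs (\<lambda>x. enc_list enc_seen (observed_list x))"
proof -
  note 0 = polytime_input[of D0 enc_obs, THEN polytime_cong, OF enc_obs_eq]
  note 1 = polytime_first[OF 0] and 2 = polytime_second[OF polytime_first[OF 0]]
  show "pnat D0 enc_obs (\<lambda>x. machines (inst x))" by (rule polytime_first[OF 1])
  show "polytime_on D0 enc_obs (\<lambda>x. enc_rat (budget (inst x)))" by (rule polytime_first[OF 2])
  show "polytime_on D0 enc_obs (\<lambda>x. enc_list enc_job (jobs (inst x)))" by (rule polytime_second[OF 2])
  show "polytime_on D0 enc_obs (\<lambda>x. enc_list enc_seen (observed_list x))" by (rule polytime_second[OF 0])
qed

text \<open>\<open>ctx D inp h\<close>: the observation \<open>h x\<close> can be extracted from the data \<open>inp x\<close>.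
  Sums, quantifiers and comprehensions extend the data by their index.\<close>

definition ctx :: "'a set \<Rightarrow> ('a \<Rightarrow> val) \<Rightarrow> ('a \<Rightarrow> observation) \<Rightarrow> bool" where
  "ctx D inp h \<longleftrightarrow> polytime_on D inp (\<lambda>x. enc_obs (h x)) \<and> (\<forall>x\<in>D. h x \<in> D0)"

definition job_ctx :: "'a set \<Rightarrow> ('a \<Rightarrow> val) \<Rightarrow> ('a \<Rightarrow> observation) \<Rightarrow> ('a \<Rightarrow> nat) \<Rightarrow> bool" where
  "job_ctx D inp h i \<longleftrightarrow> ctx D inp h \<and> pnat D inp i \<and> (\<forall>x\<in>D. i x < num_jobs (h x))"

lemma ctx_mem: "ctx D inp h \<Longrightarrow> x \<in> D \<Longrightarrow> h x \<in> D0"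
  by (simp add: ctx_def)

lemma ctx_polytime: "ctx D inp h \<Longrightarrow> polytime_on D0 enc_obs f \<Longrightarrow> polytime_on D inp (\<lambda>x. f (h x))"
  unfolding ctx_def by (elim conjE, erule polytime_compose[where inp' = enc_obs]) auto

lemma ctx_weaken: "ctx D inp h \<Longrightarrow> ctx (Sigma D A) (ext inp) (\<lambda>p. h (fst p))"
  unfolding ctx_def by (auto intro: polytime_weaken)

lemma ctx_subset: "ctx D inp h \<Longrightarrow> D' \<subseteq> D \<Longrightarrow> ctx D' inp h"
  unfolding ctx_def by (auto intro: polytime_subset)

lemma job_ctx_index: "ctx D inp h \<Longrightarrow> job_ctx (SIGMA x:D. {..<num_jobs (h x)}) (ext inp) (\<lambda>p. h (fst p)) snd"
  unfolding job_ctx_def using ctx_weaken[of D inp h] pnat_index by auto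

lemma job_ctxD: "job_ctx D inp h i \<Longrightarrow> ctx D inp h" "job_ctx D inp h i \<Longrightarrow> pnat D inp i"
  "job_ctx D inp h i \<Longrightarrow> x \<in> D \<Longrightarrow> i x < num_jobs (h x)"
  by (simp_all add: job_ctx_def)

lemma ctx_machines: "ctx D inp h \<Longrightarrow> pnat D inp (\<lambda>x. machines (inst (h x)))"
  by (rule ctx_polytime[OF _ base_machines])

lemma ctx_budget:
  assumes "ctx D inp h"
  shows "preal D inp (\<lambda>x. budget (inst (h x)))"
proof (rule preal_enc_rat[OF ctx_polytime[OF assms base_budget]])
  fix x assume "x \<in> D"
  note o = observationsD(1,2)[OF ctx_mem[OF assms this]]
  show "0 \<le> budget (inst (h x)) \<and> budget (inst (h x)) \<in> \<rat>"
    using o unfolding valid_def rational_def by blast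
qed

lemma ctx_num_jobs:
  assumes "ctx D inp h"
  shows "pnat D inp (\<lambda>x. num_jobs (h x))" "pbounded D inp (\<lambda>x. num_jobs (h x))"
  using polytime_length[OF ctx_polytime[OF assms base_jobs]] by simp_all

lemma job_ctx_cost:
  assumes "job_ctx D inp h i"
  shows "preal D inp (\<lambda>x. job_cost (inst (h x)) (i x))"
proof -
  note ij = job_ctxD[OF assms]
  have "polytime_on D inp (\<lambda>x. enc_job (jobs (inst (h x)) ! i x))"
    by (rule polytime_nth[OF ctx_polytime[OF ij(1) base_jobs] ij(2,3)])
  then have "polytime_on D inp (\<lambda>x. VPair (enc_rat (job_cost (inst (h x)) (i x)))
      (enc_list enc_outcome (snd (jobs (inst (h x)) ! i x))))"
    by (rule polytime_cong) (simp add: enc_job_def split_def job_cost_def)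
  note 1 = polytime_first[OF this]
  show ?thesis
  proof (rule preal_enc_rat[OF 1])
    fix x assume x: "x \<in> D"
    note o = observationsD[OF ctx_mem[OF ij(1) x]]
    show "0 \<le> job_cost (inst (h x)) (i x) \<and> job_cost (inst (h x)) (i x) \<in> \<rat>"
      using valid_job(1)[OF o(1) ij(3)[OF x]] rational_job(1)[OF o(2) ij(3)[OF x]] ..
  qed
qed

text \<open>Only the sum of the matching entries is needed to look up an observed size, since every job
  occurs at most once.\<close>

lemma observed_lookup:
  assumes "finite (seen x)"
  shows "i \<in> seen x \<longleftrightarrow> (\<exists>k<length (observed_list x). fst (observed_list x ! k) = i)"
    and "i \<in> seen x \<Longrightarrow> val_of x i =
      (\<Sum>k<length (observed_list x). if fst (observed_list x ! k) = i then snd (observed_list x ! k) else 0)"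
proof -
  let ?l = "sorted_list_of_set (seen x)"
  have l: "set ?l = seen x" "distinct ?l" using assms by simp_all
  have "i \<in> seen x \<longleftrightarrow> i \<in> set ?l" by (simp only: l(1))
  also have "\<dots> \<longleftrightarrow> (\<exists>k<length ?l. ?l ! k = i)" by (rule in_set_conv_nth)
  also have "\<dots> \<longleftrightarrow> (\<exists>k<length (observed_list x). fst (observed_list x ! k) = i)"
    by (auto simp: observed_list_def)
  finally show "i \<in> seen x \<longleftrightarrow> (\<exists>k<length (observed_list x). fst (observed_list x ! k) = i)" .
  assume "i \<in> seen x"
  then have "i \<in> set ?l" by (simp only: l(1))
  then obtain k where k: "k < length ?l" "?l ! k = i" unfolding in_set_conv_nth by blast
  have "(\<Sum>j<length (observed_list x). if fst (observed_list x ! j) = i then snd (observed_list x ! j) else 0) =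
      (\<Sum>j<length ?l. if j = k then val_of x i else 0)"
    using k l(2) by (intro sum.cong) (auto simp: observed_list_def nth_eq_iff_index_eq)
  also have "\<dots> = val_of x i" using k by simp
  finally show "val_of x i =
      (\<Sum>k<length (observed_list x). if fst (observed_list x ! k) = i then snd (observed_list x ! k) else 0)" ..
qed

text \<open>The input contains the sizes of the observed jobs only, so the second claim is confined
  to those.\<close>

lemma job_ctx_seen:
  assumes "job_ctx D inp h i"
  shows "pbool D inp (\<lambda>x. i x \<in> seen (h x))"
    "preal {x \<in> D. i x \<in> seen (h x)} inp (\<lambda>x. val_of (h x) (i x))"
proof -
  note ij = job_ctxD[OF assms]
  let ?n = "\<lambda>x. length (observed_list (h x))"
  let ?X = "SIGMA x:D. {..<?n x}"
  note obs = ctx_polytime[OF ij(1) base_observed]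
  note n = polytime_length[OF obs]
  have "polytime_on ?X (ext inp) (\<lambda>p. enc_seen (observed_list (h (fst p)) ! snd p))"
    by (rule polytime_nth[OF polytime_weaken[OF obs] pnat_index]) auto
  then have 0: "polytime_on ?X (ext inp) (\<lambda>p. VPair (VNum (fst (observed_list (h (fst p)) ! snd p)))
      (enc_rat (snd (observed_list (h (fst p)) ! snd p))))"
    by (simp add: enc_seen_def split_def)
  have fin: "finite (seen (h x))" if "x \<in> D" for x
    using observationsD(3)[OF ctx_mem[OF ij(1) that]] finite_subset by blast
  have 2: "preal ?X (ext inp) (\<lambda>p. snd (observed_list (h (fst p)) ! snd p))"
  proof (rule preal_enc_rat[OF polytime_second[OF 0]])
    fix p assume p: "p \<in> ?X"
    then have D: "fst p \<in> D" and k: "snd p < length (sorted_list_of_set (seen (h (fst p))))"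
      by (auto simp: observed_list_def)
    define j where "j = sorted_list_of_set (seen (h (fst p))) ! snd p"
    have "j \<in> seen (h (fst p))"
      using nth_mem[OF k] unfolding j_def[symmetric] set_sorted_list_of_set[OF fin[OF D]] .
    moreover have "snd (observed_list (h (fst p)) ! snd p) = val_of (h (fst p)) j"
      using k by (simp add: observed_list_def j_def)
    ultimately show "0 \<le> snd (observed_list (h (fst p)) ! snd p) \<and> snd (observed_list (h (fst p)) ! snd p) \<in> \<rat>"
      using observationsD(4,5)[OF ctx_mem[OF ij(1) D]] by simp
  qed
  have eq: "pbool ?X (ext inp) (\<lambda>p. fst (observed_list (h (fst p)) ! snd p) = i (fst p))"
    by (intro pbool_eq polytime_first[OF 0] polytime_weaken ij)
  show "pbool D inp (\<lambda>x. i x \<in> seen (h x))"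
    by (rule polytime_cong[OF pbool_bex[OF n eq]]) (use observed_lookup(1)[OF fin] in simp)
  have "preal D inp (\<lambda>x. \<Sum>k<?n x. if fst (observed_list (h x) ! k) = i x then snd (observed_list (h x) ! k) else 0)"
    by (rule preal_sum[OF n], rule preal_if[OF eq]) (auto intro: preal_subset[OF 2] preal_numeral)
  then show "preal {x \<in> D. i x \<in> seen (h x)} inp (\<lambda>x. val_of (h x) (i x))"
    by (rule preal_cong[OF preal_subset]) (use observed_lookup(2)[OF fin] in auto)
qed

lemma job_ctx_outcomes:
  assumes "job_ctx D inp h i"
  shows "pnat D inp (\<lambda>x. length (outcomes (h x) (i x)))"
    "pbounded D inp (\<lambda>x. length (outcomes (h x) (i x)))"
    "preal (SIGMA x:D. {..<length (outcomes (h x) (i x))}) (ext inp)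
      (\<lambda>p. fst (outcomes (h (fst p)) (i (fst p)) ! snd p))" (is "preal ?X _ _")
    "preal (SIGMA x:D. {..<length (outcomes (h x) (i x))}) (ext inp)
      (\<lambda>p. snd (outcomes (h (fst p)) (i (fst p)) ! snd p))"
proof -
  note ij = job_ctxD[OF assms]
  note sn = job_ctx_seen[OF assms]
  let ?d = "\<lambda>x. snd (jobs (inst (h x)) ! i x)"
  have "polytime_on D inp (\<lambda>x. enc_job (jobs (inst (h x)) ! i x))"
    by (rule polytime_nth[OF ctx_polytime[OF ij(1) base_jobs] ij(2,3)])
  then have "polytime_on D inp (\<lambda>x. VPair (enc_rat (fst (jobs (inst (h x)) ! i x))) (enc_list enc_outcome (?d x)))"
    by (simp add: enc_job_def split_def)
  note d = polytime_second[OF this]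
  note len = polytime_length[OF d]
  have "pnat D inp (\<lambda>x. if i x \<in> seen (h x) then 1 else length (?d x))"
    by (rule pnat_if[OF sn(1) polytime_const polytime_subset[OF len(1)]]) auto
  then show "pnat D inp (\<lambda>x. length (outcomes (h x) (i x)))"
    by (rule polytime_cong) (simp add: outcomes_def)
  have "pbounded D inp (\<lambda>x. 1 + length (?d x))" by (intro pbounded_add pbounded_const len)
  then show "pbounded D inp (\<lambda>x. length (outcomes (h x) (i x)))"
    by (rule pbounded_mono) (simp add: outcomes_def)
  let ?Y = "{p \<in> ?X. i (fst p) \<notin> seen (h (fst p))}"
  have sn1: "pbool ?X (ext inp) (\<lambda>p. i (fst p) \<in> seen (h (fst p)))" by (rule polytime_weaken[OF sn(1)])
  have sn2: "preal {p \<in> ?X. i (fst p) \<in> seen (h (fst p))} (ext inp) (\<lambda>p. val_of (h (fst p)) (i (fst p)))"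
    by (rule preal_subset[OF preal_weaken[OF sn(2), where A = "\<lambda>_. UNIV"]]) auto
  have "polytime_on ?Y (ext inp) (\<lambda>p. enc_outcome (?d (fst p) ! snd p))"
    by (rule polytime_nth[OF polytime_subset[OF polytime_weaken[OF d]] pnat_index]) (auto simp: outcomes_def)
  then have "polytime_on ?Y (ext inp) (\<lambda>p. VPair (enc_rat (fst (?d (fst p) ! snd p))) (enc_rat (snd (?d (fst p) ! snd p))))"
    by (simp add: enc_outcome_def split_def)
  note e1 = polytime_first[OF this] and e2 = polytime_second[OF this]
  have good: "0 \<le> fst (?d (fst p) ! snd p) \<and> fst (?d (fst p) ! snd p) \<in> \<rat>"
    "0 \<le> snd (?d (fst p) ! snd p) \<and> snd (?d (fst p) ! snd p) \<in> \<rat>" if p: "p \<in> ?Y" for p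
  proof -
    have D: "fst p \<in> D" using p by auto
    show "0 \<le> fst (?d (fst p) ! snd p) \<and> fst (?d (fst p) ! snd p) \<in> \<rat>"
      "0 \<le> snd (?d (fst p) ! snd p) \<and> snd (?d (fst p) ! snd p) \<in> \<rat>"
      using outcomes_good[OF ctx_mem[OF ij(1) D] ij(3)[OF D], of "snd p"] p
      by (auto simp: outcomes_def)
  qed
  have "preal ?X (ext inp) (\<lambda>p. if i (fst p) \<in> seen (h (fst p)) then val_of (h (fst p)) (i (fst p)) else fst (?d (fst p) ! snd p))"
    by (rule preal_if[OF sn1 sn2 preal_enc_rat[OF e1]]) (use good in auto)
  then show "preal ?X (ext inp) (\<lambda>p. fst (outcomes (h (fst p)) (i (fst p)) ! snd p))"
    by (rule preal_cong) (auto simp: outcomes_def)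
  have "preal ?X (ext inp) (\<lambda>p. if i (fst p) \<in> seen (h (fst p)) then 1 else snd (?d (fst p) ! snd p))"
    by (rule preal_if[OF sn1 preal_numeral(3) preal_enc_rat[OF e2]]) (use good in auto)
  then show "preal ?X (ext inp) (\<lambda>p. snd (outcomes (h (fst p)) (i (fst p)) ! snd p))"
    by (rule preal_cong) (auto simp: outcomes_def)
qed

lemma preal_expectation:
  assumes ij: "job_ctx D inp h i"
    and \<phi>: "preal (SIGMA x:D. {..<length (outcomes (h x) (i x))}) (ext inp)
      (\<lambda>p. \<phi> (fst p) (fst (outcomes (h (fst p)) (i (fst p)) ! snd p)))"
  shows "preal D inp (\<lambda>x. expect (lawx (h x) (i x)) (\<phi> x))"
proof -
  have "preal D inp (\<lambda>x. \<Sum>k<length (outcomes (h x) (i x)).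
      snd (outcomes (h x) (i x) ! k) * \<phi> x (fst (outcomes (h x) (i x) ! k)))"
    by (intro preal_sum preal_mult job_ctx_outcomes[OF ij] \<phi>)
  then show ?thesis
    by (rule preal_cong) (simp add: expectation_law[OF ctx_mem[OF job_ctxD(1)[OF ij]] job_ctxD(3)[OF ij]])
qed

section \<open>The algorithms run in polynomial time\<close>

lemma preal_nonneg: "preal D inp f \<Longrightarrow> x \<in> D \<Longrightarrow> 0 \<le> f x"
  unfolding preal_def by auto

lemma preal_excess:
  assumes "preal D inp B" "preal D inp y"
  shows "preal D inp (\<lambda>x. excess (B x) (y x))"
  unfolding excess_def
  by (intro preal_if pbool_preal_less assms preal_numeral preal_subset[OF assms(2)]) auto

lemma preal_level:
  assumes B: "preal D inp B" and y: "preal D inp y" and l: "pnat D inp l"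
  shows "preal D inp (\<lambda>x. level (l x) (B x) (y x))"
proof -
  have "preal D inp (\<lambda>x. y x * real (l x) / (5 * B x))"
    by (intro preal_divide preal_mult preal_of_nat preal_numeral B y l)
  then have "preal D inp (\<lambda>x. if y x \<le> B x then y x * real (l x) / (5 * B x) else 0)"
    by (intro preal_if pbool_preal_le B y preal_numeral) (auto intro: preal_subset)
  then show ?thesis by (rule preal_cong) (simp add: level_def preal_nonneg[OF y])
qed

text \<open>Writing down the power requires an exponent that is small as a number. Truncation bounds
  the level by \<open>l x\<close>, and \<open>l\<close> will be the bit length of the number of
  machines.\<close>

lemma preal_xpow_level:
  assumes B: "preal D inp B" and y: "preal D inp y" and l: "pnat D inp l" "pbounded D inp l"
  shows "preal D inp (\<lambda>x. xpow (level (l x) (B x) (y x)))"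
proof -
  note z = preal_level[OF B y l(1)]
  have b: "pbounded D inp (\<lambda>x. nat \<lfloor>level (l x) (B x) (y x)\<rfloor>)"
  proof (rule pbounded_mono[OF l(2)])
    fix x assume "x \<in> D"
    then have "level (l x) (B x) (y x) \<le> real (l x) / 5"
      by (intro level_bounds preal_nonneg[OF B])
    then show "nat \<lfloor>level (l x) (B x) (y x)\<rfloor> \<le> l x" by linarith
  qed
  have "preal D inp (\<lambda>x. real (2 ^ nat \<lfloor>level (l x) (B x) (y x)\<rfloor>))"
    by (intro preal_of_nat pnat_power2 pnat_floor z b)
  then have p: "preal D inp (\<lambda>x. 2 ^ nat \<lfloor>level (l x) (B x) (y x)\<rfloor>)" by simp
  show ?thesis unfolding xpow_def
    by (intro preal_if pbool_preal_less z preal_numeral preal_subset[OF z] preal_subset[OF p]) auto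
qed

lemma preal_eff:
  assumes "preal D inp y"
  shows "preal D inp (\<lambda>x. eff (y x))"
  unfolding eff_def
  by (intro preal_if pbool_preal_less assms preal_numeral preal_subset[OF assms]
    preal_of_nat pnat_floorlog pnat_floor) auto

abbreviation log_machines :: "observation \<Rightarrow> nat" where
  "log_machines x \<equiv> floorlog 2 (machines (inst x))"

lemma preal_moment:
  assumes ij: "job_ctx D inp h i" and B: "preal D inp B"
  shows "preal D inp (\<lambda>x. expect (lawx (h x) (i x)) (\<lambda>y. xpow (level (log_machines (h x)) (B x) y)))"
proof (rule preal_expectation[OF ij])
  note l = pnat_floorlog[OF ctx_machines[OF job_ctxD(1)[OF ij]]]
  show "preal (SIGMA x:D. {..<length (outcomes (h x) (i x))}) (ext inp)
     (\<lambda>p. xpow (level (log_machines (h (fst p))) (B (fst p)) (fst (outcomes (h (fst p)) (i (fst p)) ! snd p))))"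
    by (intro preal_xpow_level preal_weaken[OF B] job_ctx_outcomes[OF ij]
      polytime_weaken[OF l(1)] pbounded_weaken[OF l(2)])
qed

lemma preal_tail:
  assumes ij: "job_ctx D inp h i" and B: "preal D inp B"
  shows "preal D inp (\<lambda>x. expect (lawx (h x) (i x)) (excess (B x)))"
  by (intro preal_expectation[OF ij] preal_excess preal_weaken[OF B] job_ctx_outcomes[OF ij])

abbreviation meanx :: "observation \<Rightarrow> nat \<Rightarrow> real" where
  "meanx x i \<equiv> expect (lawx x i) (\<lambda>y. y)"

lemma preal_mean: "job_ctx D inp h i \<Longrightarrow> preal D inp (\<lambda>x. meanx (h x) (i x))"
  by (intro preal_expectation job_ctx_outcomes)

abbreviation weightx :: "observation \<Rightarrow> real \<Rightarrow> nat \<Rightarrow> real" where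
  "weightx x \<equiv> machine_sizes.scaled_weight (lawx x) (inst x)"

lemma preal_weight:
  assumes ij: "job_ctx D inp h i" and B: "preal D inp B"
  shows "preal D inp (\<lambda>x. weightx (h x) (B x) (i x))"
proof -
  note c = job_ctxD(1)[OF ij]
  let ?w = "\<lambda>x. eff (expect (lawx (h x) (i x)) (\<lambda>y. xpow (level (log_machines (h x)) (B x) y)))
      / (4 * real (log_machines (h x)) * real (machines (inst (h x))))
      + expect (lawx (h x) (i x)) (excess (B x)) / B x"
  have w: "preal D inp ?w"
    by (intro preal_add preal_divide preal_mult preal_eff preal_moment preal_tail preal_numeral
      preal_of_nat pnat_floorlog ctx_machines ij c B)
  have 0: "preal D inp (\<lambda>x. if meanx (h x) (i x) = 0 then 0 else 5)"
    by (intro preal_if pbool_preal_eq preal_mean ij preal_numeral)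
  have "preal D inp (\<lambda>x. if B x = 0 then if meanx (h x) (i x) = 0 then 0 else 5 else ?w x)"
    by (intro preal_if[where P = "\<lambda>x. B x = 0"] pbool_preal_eq B preal_numeral preal_subset[OF 0] preal_subset[OF w]) auto
  then show ?thesis
  proof (rule preal_cong)
    fix x assume "x \<in> D"
    then interpret machine_sizes "lawx (h x)" "inst (h x)" by (rule observationsD(6)[OF ctx_mem[OF c]])
    show "(if B x = 0 then if meanx (h x) (i x) = 0 then 0 else 5 else ?w x) = weightx (h x) (B x) (i x)"
      unfolding scaled_weight_def weight_def mean_def ..
  qed
qed

abbreviation scalex :: "observation \<Rightarrow> nat \<Rightarrow> real" where
  "scalex x \<equiv> machine_sizes.scale (lawx x) (num_jobs x)"

abbreviation num_scales :: "observation \<Rightarrow> nat" where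
  "num_scales x \<equiv> num_jobs x * (floorlog 2 (num_jobs x) + 2) + 1"

lemma ctx_num_scales:
  assumes "ctx D inp h"
  shows "pnat D inp (\<lambda>x. num_scales (h x))" "pbounded D inp (\<lambda>x. num_scales (h x))"
  by (intro pnat_add pnat_mult pnat_floorlog polytime_const ctx_num_jobs[OF assms]
     pbounded_add pbounded_mult pbounded_const)+

lemma preal_scale:
  assumes c: "ctx D inp h" and t: "pnat D inp t"
  shows "preal D inp (\<lambda>x. scalex (h x) (t x))"
proof -
  let ?J = "\<lambda>x. floorlog 2 (num_jobs (h x)) + 2"
  have J: "pnat D inp ?J" "pbounded D inp ?J"
    by (intro pnat_add pnat_floorlog polytime_const ctx_num_jobs[OF c] pbounded_add pbounded_const)+
  let ?D = "{x \<in> D. t x < num_jobs (h x) * ?J x}"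
  have sub: "?D \<subseteq> D" by auto
  note t' = polytime_subset[OF t sub] and J' = polytime_subset[OF J(1) sub]
  \<comment> \<open>A mean can be read only for an existing job, so the computation is confined to
    the indices whose quotient is one; the remaining indices stand for scale 0.\<close>
  have "job_ctx ?D inp h (\<lambda>x. t x div ?J x)"
    unfolding job_ctx_def using ctx_subset[OF c sub] pnat_div[OF t' J']
    by (auto simp: div_less_iff_less_mult)
  note m = preal_mean[OF this]
  have "pbounded ?D inp (\<lambda>x. t x mod ?J x)"
    by (rule pbounded_mono[OF pbounded_subset[OF J(2) sub]]) (simp add: less_imp_le)
  then have "preal ?D inp (\<lambda>x. real (2 ^ (t x mod ?J x)))"
    by (intro preal_of_nat pnat_power2 pnat_mod t' J')
  then have "preal ?D inp (\<lambda>x. meanx (h x) (t x div ?J x) * 2 ^ (t x mod ?J x))"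
    using preal_mult[OF m] by simp
  then have "preal D inp (\<lambda>x. if t x < num_jobs (h x) * ?J x
      then meanx (h x) (t x div ?J x) * 2 ^ (t x mod ?J x) else 0)"
    by (intro preal_if pbool_less t pnat_mult ctx_num_jobs[OF c] J preal_numeral)
  then show ?thesis
  proof (rule preal_cong)
    fix x assume "x \<in> D"
    then interpret machine_sizes "lawx (h x)" "inst (h x)" by (rule observationsD(6)[OF ctx_mem[OF c]])
    show "(if t x < num_jobs (h x) * ?J x then meanx (h x) (t x div ?J x) * 2 ^ (t x mod ?J x) else 0)
        = scalex (h x) (t x)"
      unfolding scale_def mean_def Let_def ..
  qed
qed

lemma pnat_best_scale:
  assumes c: "ctx D inp h"
    and F: "pbool (SIGMA x:D. {..<num_scales (h x)}) (ext inp) (\<lambda>p. F (fst p) (snd p))"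
    and ex: "\<And>x. x \<in> D \<Longrightarrow> \<exists>s<num_scales (h x). F x s"
  shows "pnat D inp (\<lambda>x. machine_sizes.best_scale (lawx (h x)) (num_jobs (h x)) (F x))"
proof -
  let ?X = "SIGMA x:D. {..<num_scales (h x)}"
  let ?Y = "SIGMA p:?X. {..<num_scales (h (fst p))}"
  note T = ctx_num_scales[OF c]
  note cX = ctx_weaken[OF c, of "\<lambda>x. {..<num_scales (h x)}"]
  \<comment> \<open>In \<open>best_scale\<close> the scale \<open>s\<close> is quantified inside the
    minimisation over \<open>t\<close>. Dropping the outer index turns the doubly extended data into
    data for \<open>F\<close>.\<close>
  have "polytime_on ?Y (ext (ext inp)) (\<lambda>q. ext inp (fst (fst q), snd q))"
    unfolding ext_Pair by (intro polytime_pair pnat_index polytime_weaken[OF polytime_first[OF polytime_ext]])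
  from polytime_compose[OF this _ F]
  have FY: "pbool ?Y (ext (ext inp)) (\<lambda>q. F (fst (fst q)) (snd q))" by force
  have "pbool ?X (ext inp) (\<lambda>p. snd p < num_scales (h (fst p)) \<and> F (fst p) (snd p) \<and>
      (\<forall>s<num_scales (h (fst p)). F (fst p) s \<longrightarrow> scalex (h (fst p)) (snd p) \<le> scalex (h (fst p)) s))"
    by (intro pbool_conj pbool_ball pbool_imp pbool_less pbool_preal_le ctx_num_scales[OF cX] F FY
      pnat_index preal_scale[OF ctx_weaken[OF cX]] polytime_weaken[OF pnat_index])
  then have "pnat D inp (\<lambda>x. LEAST t. t < num_scales (h x) \<and> F x t \<and>
      (\<forall>s<num_scales (h x). F x s \<longrightarrow> scalex (h x) t \<le> scalex (h x) s))"
  proof (rule pnat_Least[OF T])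
    fix x assume x: "x \<in> D"
    then interpret machine_sizes "lawx (h x)" "inst (h x)" by (rule observationsD(6)[OF ctx_mem[OF c]])
    show "\<exists>t<num_scales (h x). t < num_scales (h x) \<and> F x t \<and>
      (\<forall>s<num_scales (h x). F x s \<longrightarrow> scalex (h x) t \<le> scalex (h x) s)"
      using ex[OF x] best_scale_exists by blast
  qed
  then show ?thesis
  proof (rule polytime_cong)
    fix x assume "x \<in> D"
    then interpret machine_sizes "lawx (h x)" "inst (h x)" by (rule observationsD(6)[OF ctx_mem[OF c]])
    show "VNum (LEAST t. t < num_scales (h x) \<and> F x t \<and>
      (\<forall>s<num_scales (h x). F x s \<longrightarrow> scalex (h x) t \<le> scalex (h x) s)) =
      VNum (best_scale (num_jobs (h x)) (F x))" unfolding best_scale_def ..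
  qed
qed

abbreviation keptx :: "observation \<Rightarrow> nat \<Rightarrow> nat set" where
  "keptx x \<equiv> machine_sizes.kept (lawx x) (inst x) (job_cost (inst x)) (budget (inst x)) (num_jobs x)"

lemma pbool_kept:
  assumes ij: "job_ctx D inp h i" and t: "pnat D inp t"
  shows "pbool D inp (\<lambda>x. i x \<in> keptx (h x) (t x))"
proof -
  note c = job_ctxD(1)[OF ij]
  let ?X = "SIGMA x:D. {..<num_jobs (h x)}"
  let ?w = "\<lambda>x. weightx (h x) (scalex (h x) (t x))"
  let ?c = "\<lambda>x. job_cost (inst (h x))"
  have w: "preal D inp (\<lambda>x. ?w x (i x))" by (intro preal_weight ij preal_scale c t)
  note jX = job_ctx_index[OF c]
  have wX: "preal ?X (ext inp) (\<lambda>p. ?w (fst p) (snd p))"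
    by (intro preal_weight jX preal_scale ctx_weaken c polytime_weaken t)
  note cX = job_ctx_cost[OF jX]
  have sel: "pbool ?X (ext inp) (\<lambda>p. 0 < ?c (fst p) (snd p) \<and> ?w (fst p) (snd p) \<le> 2 \<and>
      before (?w (fst p)) (?c (fst p)) (snd p) (i (fst p)))"
    unfolding before_def
    by (intro pbool_conj pbool_disj pbool_preal_less pbool_preal_le pbool_preal_eq pbool_less preal_mult
      preal_numeral wX cX preal_weaken[OF w] preal_weaken[OF job_ctx_cost[OF ij]] pnat_index
      polytime_weaken[OF job_ctxD(2)[OF ij]])
  have s: "preal ?X (ext inp) (\<lambda>p. if 0 < ?c (fst p) (snd p) \<and> ?w (fst p) (snd p) \<le> 2 \<and>
      before (?w (fst p)) (?c (fst p)) (snd p) (i (fst p)) then ?c (fst p) (snd p) else 0)"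
    by (rule preal_if[OF sel preal_subset[OF cX] preal_numeral(2)]) auto
  \<comment> \<open>The demand, total cost minus budget, may be negative, whereas
    \<open>preal\<close> represents nonnegative numbers only; so the budget is moved to the other
    side.\<close>
  have "pbool D inp (\<lambda>x. 0 < ?c x (i x) \<and> ?w x (i x) \<le> 2 \<and>
      (\<Sum>j<num_jobs (h x). if 0 < ?c x j \<and> ?w x j \<le> 2 \<and> before (?w x) (?c x) j (i x) then ?c x j else 0)
      + budget (inst (h x)) < (\<Sum>j<num_jobs (h x). ?c x j))"
    by (intro pbool_conj pbool_preal_less pbool_preal_le preal_add preal_sum ctx_num_jobs[OF c] s cX
      preal_numeral w job_ctx_cost[OF ij] ctx_budget[OF c])
  then show ?thesis
  proof (rule polytime_cong)
    fix x assume x: "x \<in> D"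
    interpret machine_sizes "lawx (h x)" "inst (h x)" by (rule observationsD(6)[OF ctx_mem[OF c x]])
    let ?n = "num_jobs (h x)"
    have "(\<Sum>j<?n. if 0 < ?c x j \<and> ?w x j \<le> 2 \<and> before (?w x) (?c x) j (i x) then ?c x j else 0) =
        (\<Sum>j\<in>{j \<in> {..<?n}. 0 < ?c x j \<and> ?w x j \<le> 2 \<and> before (?w x) (?c x) j (i x)}. ?c x j)"
      by (rule sum.inter_filter[symmetric]) simp
    also have "{j \<in> {..<?n}. 0 < ?c x j \<and> ?w x j \<le> 2 \<and> before (?w x) (?c x) j (i x)} =
        {j \<in> {j. j < ?n \<and> 0 < ?c x j \<and> ?w x j \<le> 2}. before (?w x) (?c x) j (i x)}" by auto
    finally show "VNum (of_bool (0 < ?c x (i x) \<and> ?w x (i x) \<le> 2 \<and>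
      (\<Sum>j<?n. if 0 < ?c x j \<and> ?w x j \<le> 2 \<and> before (?w x) (?c x) j (i x) then ?c x j else 0)
      + budget (inst (h x)) < (\<Sum>j<?n. ?c x j))) = VNum (of_bool (i x \<in> keptx (h x) (t x)))"
      using job_ctxD(3)[OF ij x] unfolding kept_def greedy_def by (simp add: less_diff_eq)
  qed
qed

abbreviation affordablex :: "observation \<Rightarrow> nat \<Rightarrow> bool" where
  "affordablex x \<equiv> machine_sizes.affordable (lawx x) (inst x) (job_cost (inst x)) (budget (inst x)) (num_jobs x)"

lemma pbool_affordable:
  assumes c: "ctx D inp h" and t: "pnat D inp t"
  shows "pbool D inp (\<lambda>x. affordablex (h x) (t x))"
proof -
  let ?X = "SIGMA x:D. {..<num_jobs (h x)}"
  let ?w = "\<lambda>x. weightx (h x) (scalex (h x) (t x))"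
  let ?c = "\<lambda>x. job_cost (inst (h x))"
  note jX = job_ctx_index[OF c]
  note cX = job_ctx_cost[OF jX]
  have wX: "preal ?X (ext inp) (\<lambda>p. ?w (fst p) (snd p))"
    by (intro preal_weight jX preal_scale ctx_weaken c polytime_weaken t)
  have k: "pbool ?X (ext inp) (\<lambda>p. snd p \<in> keptx (h (fst p)) (t (fst p)))"
    by (intro pbool_kept jX polytime_weaken t)
  have s: "preal ?X (ext inp) (\<lambda>p. if snd p \<in> keptx (h (fst p)) (t (fst p)) then ?c (fst p) (snd p) else 0)"
    "preal ?X (ext inp) (\<lambda>p. if snd p \<in> keptx (h (fst p)) (t (fst p)) then ?w (fst p) (snd p) else 0)"
    by (rule preal_if[OF k preal_subset[OF cX] preal_numeral(2)], blast,
      rule preal_if[OF k preal_subset[OF wX] preal_numeral(2)], blast)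
  have "pbool D inp (\<lambda>x. (\<Sum>j<num_jobs (h x). ?c x j) \<le>
      budget (inst (h x)) + (\<Sum>j<num_jobs (h x). if j \<in> keptx (h x) (t x) then ?c x j else 0) \<and>
      (\<Sum>j<num_jobs (h x). if j \<in> keptx (h x) (t x) then ?w x j else 0) \<le> 4)"
    by (intro pbool_conj pbool_preal_le preal_add preal_sum ctx_num_jobs[OF c] s cX
      preal_numeral ctx_budget[OF c])
  then show ?thesis
  proof (rule polytime_cong)
    fix x assume x: "x \<in> D"
    interpret machine_sizes "lawx (h x)" "inst (h x)" by (rule observationsD(6)[OF ctx_mem[OF c x]])
    let ?n = "num_jobs (h x)"
    have sub: "{j \<in> {..<?n}. j \<in> keptx (h x) (t x)} = keptx (h x) (t x)"
      by (auto simp: kept_def greedy_def)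
    have "(\<Sum>j<?n. if j \<in> keptx (h x) (t x) then f j else 0) = (\<Sum>j\<in>keptx (h x) (t x). f j)"
      for f :: "nat \<Rightarrow> real"
      using sum.inter_filter[of "{..<?n}" f "\<lambda>j. j \<in> keptx (h x) (t x)"] unfolding sub by simp
    then show "VNum (of_bool ((\<Sum>j<?n. ?c x j) \<le>
      budget (inst (h x)) + (\<Sum>j<?n. if j \<in> keptx (h x) (t x) then ?c x j else 0) \<and>
      (\<Sum>j<?n. if j \<in> keptx (h x) (t x) then ?w x j else 0) \<le> 4)) =
      VNum (of_bool (affordablex (h x) (t x)))"
      unfolding affordable_def by simp
  qed
qed

abbreviation lightx :: "observation \<Rightarrow> nat \<Rightarrow> bool" where
  "lightx x \<equiv> machine_sizes.light (lawx x) (inst x) (num_jobs x)"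

lemma pbool_light:
  assumes c: "ctx D inp h" and t: "pnat D inp t"
  shows "pbool D inp (\<lambda>x. lightx (h x) (t x))"
proof -
  have "pbool D inp (\<lambda>x. (\<Sum>i<num_jobs (h x). weightx (h x) (scalex (h x) (t x)) i) \<le> 4)"
    by (intro pbool_preal_le preal_sum ctx_num_jobs[OF c] preal_numeral preal_weight
      job_ctx_index[OF c] preal_scale ctx_weaken[OF c] polytime_weaken[OF t])
  then show ?thesis
  proof (rule polytime_cong)
    fix x assume x: "x \<in> D"
    interpret machine_sizes "lawx (h x)" "inst (h x)" by (rule observationsD(6)[OF ctx_mem[OF c x]])
    show "VNum (of_bool ((\<Sum>i<num_jobs (h x). weightx (h x) (scalex (h x) (t x)) i) \<le> 4)) =
      VNum (of_bool (lightx (h x) (t x)))" unfolding light_def ..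
  qed
qed

abbreviation intervalx :: "observation \<Rightarrow> real \<Rightarrow> nat \<Rightarrow> nat" where
  "intervalx x B \<equiv> machine_sizes.interval (lawx x) (inst x) B {..<num_jobs x}"

lemma pnat_interval:
  assumes ij: "job_ctx D inp h i" and B: "preal D inp B"
  shows "pnat D inp (\<lambda>x. intervalx (h x) (B x) (i x))"
proof -
  note c = job_ctxD(1)[OF ij] and i = job_ctxD(2)[OF ij]
  let ?e = "\<lambda>x j. eff (expect (lawx (h x) j) (\<lambda>y. xpow (level (log_machines (h x)) (B x) y)))"
  have bi: "pbounded D inp i"
    by (rule pbounded_mono[OF ctx_num_jobs(2)[OF c]]) (simp add: job_ctxD(3)[OF ij] less_imp_le)
  have "job_ctx (SIGMA x:D. {..<i x}) (ext inp) (\<lambda>p. h (fst p)) snd"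
    unfolding job_ctx_def using ctx_weaken[OF c] pnat_index job_ctxD(3)[OF ij] less_trans by fastforce
  then have "pnat D inp (\<lambda>x. nat \<lfloor>(\<Sum>j<i x. ?e x j) / (17 * real (log_machines (h x)))\<rfloor>)"
    by (intro pnat_floor preal_divide preal_sum i bi preal_eff preal_moment preal_weaken[OF B]
      preal_mult preal_numeral preal_of_nat pnat_floorlog ctx_machines[OF c])
  then show ?thesis
  proof (rule polytime_cong)
    fix x assume x: "x \<in> D"
    interpret machine_sizes "lawx (h x)" "inst (h x)" by (rule observationsD(6)[OF ctx_mem[OF c x]])
    have "{j \<in> {..<num_jobs (h x)}. j < i x} = {..<i x}" using job_ctxD(3)[OF ij x] by auto
    then show "VNum (nat \<lfloor>(\<Sum>j<i x. ?e x j) / (17 * real (log_machines (h x)))\<rfloor>) =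
        VNum (intervalx (h x) (B x) (i x))" unfolding interval_def by simp
  qed
qed

section \<open>The two algorithms\<close>

lemma ctx_base: "ctx D0 enc_obs (\<lambda>x. x)"
  unfolding ctx_def by (auto intro: polytime_input)

definition assignment_of :: "observation \<Rightarrow> nat \<Rightarrow> nat" where
  "assignment_of x = restrict (intervalx x (scalex x (machine_sizes.best_scale (lawx x) (num_jobs x) (lightx x))))
     (job_set (inst x))"

lemma enc_list_cong: "(\<And>y. y \<in> set xs \<Longrightarrow> e y = e' y) \<Longrightarrow> enc_list e xs = enc_list e' xs"
  by (induction xs) (simp_all add: enc_list_def)

lemma assignment_algorithm_1656: "assignment_algorithm 1656 (\<lambda>I S v. assignment_of (I, S, v))"
  unfolding assignment_algorithm_def
proof
  let ?B = "\<lambda>x. scalex x (machine_sizes.best_scale (lawx x) (num_jobs x) (lightx x))"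
  let ?X = "SIGMA x:D0. {..<num_jobs x}"
  have ex: "\<exists>s<num_scales x. lightx x s" if "x \<in> D0" for x
    using machine_sizes.schedule_correct(3)[OF observationsD(6)[OF that]] .
  have "pbool (SIGMA x:D0. {..<num_scales x}) (ext enc_obs) (\<lambda>p. lightx (fst p) (snd p))"
    by (intro pbool_light ctx_weaken[OF ctx_base] pnat_index)
  then have "pnat D0 enc_obs (\<lambda>x. machine_sizes.best_scale (lawx x) (num_jobs x) (lightx x))"
    by (rule pnat_best_scale[OF ctx_base, where F = lightx]) (rule ex)
  then have B: "preal D0 enc_obs ?B" by (rule preal_scale[OF ctx_base])
  have i: "pnat ?X (ext enc_obs) (\<lambda>p. intervalx (fst p) (?B (fst p)) (snd p))"
    by (intro pnat_interval job_ctx_index ctx_base preal_weaken[OF B])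
  have "pbool ?X (ext enc_obs) (\<lambda>_. True)" using polytime_const[of ?X "ext enc_obs" 1] by simp
  from polytime_comprehension[OF ctx_num_jobs[OF ctx_base] this i]
  have "polytime_on D0 enc_obs (\<lambda>x. enc_list (\<lambda>i. VNum (intervalx x (?B x) i)) (filter (\<lambda>_. True) [0..<num_jobs x]))" .
  then have "polytime_on D0 enc_obs (\<lambda>x. enc_assignment (inst x) (assignment_of x))"
  proof (rule polytime_cong)
    fix x
    have "filter (\<lambda>_. True) [0..<num_jobs x] = [0..<num_jobs x]" by simp
    moreover have "enc_list (\<lambda>i. VNum (intervalx x (?B x) i)) [0..<num_jobs x] =
        enc_list (\<lambda>i. VNum (assignment_of x i)) [0..<num_jobs x]"
      by (rule enc_list_cong) (simp add: assignment_of_def)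
    ultimately show "enc_list (\<lambda>i. VNum (intervalx x (?B x) i)) (filter (\<lambda>_. True) [0..<num_jobs x]) =
        enc_assignment (inst x) (assignment_of x)"
      unfolding enc_assignment_def by (simp only:)
  qed
  moreover have "(\<lambda>x. VPair (enc_sched (inst x)) (enc_observed (seen x) (val_of x))) = enc_obs"
    by (auto simp: enc_obs_def)
  ultimately show "polytime_on observations (\<lambda>(I, S, v). VPair (enc_sched I) (enc_observed S v))
      (\<lambda>(I, S, v). enc_assignment I (assignment_of (I, S, v)))"
    by (simp add: split_def)
  show "\<forall>(I, S, v)\<in>observations. assignment_of (I, S, v) \<in> assignments I (job_set I) \<and>
       expected_makespan I S v (assignment_of (I, S, v)) \<le> 1656 * best_value I S v"
  proof (clarify, intro conjI)
    fix I S v assume x: "(I, S, v) \<in> observations"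
    note o = observationsD[OF x, simplified]
    interpret machine_sizes "law I S v" I by (rule o(6))
    note corr = schedule_correct(1,2)[of "length (jobs I)"]
    show "assignment_of (I, S, v) \<in> assignments I (job_set I)"
      unfolding assignment_of_def assignments_def using corr(1) by simp
    have "expected_makespan I S v (assignment_of (I, S, v)) =
        expect (P (job_set I)) (makespan I (job_set I) (assignment_of (I, S, v)))"
      by (rule expected_makespan_law[OF o(3)])
    also have "makespan I (job_set I) (assignment_of (I, S, v)) = makespan I (job_set I)
        (interval (scale (length (jobs I)) (best_scale (length (jobs I)) (light (length (jobs I))))) (job_set I))"
      by (intro ext makespan_cong) (auto simp: assignment_of_def)
    also have "expect (P (job_set I)) \<dots> \<le> 1656 * opt (job_set I)" by (rule corr(2))
    also have "opt (job_set I) = best_value I S v" using o by (intro best_value_law[symmetric])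
    finally show "expected_makespan I S v (assignment_of (I, S, v)) \<le> 1656 * best_value I S v" .
  qed
qed

text \<open>The observation before any probe. Through it the choice of the probed set reuses
  everything that is computed from observations.\<close>

definition unseen :: "sched \<Rightarrow> observation" where
  "unseen I = (I, {}, \<lambda>_. 0)"

definition outlier_set :: "sched \<Rightarrow> nat set" where
  "outlier_set I = {i \<in> job_set I. i \<notin> keptx (unseen I)
     (machine_sizes.best_scale (lawx (unseen I)) (num_jobs (unseen I)) (affordablex (unseen I)))}"

lemma outlier_opt_attained:
  assumes "valid I"
  obtains S where "S \<subseteq> job_set I" "probing_cost I S \<le> budget I" "outlier_opt I = outlier_value I S"
proof -
  let ?F = "{S. S \<subseteq> job_set I \<and> probing_cost I S \<le> budget I}"
  have "{} \<in> ?F" using assms by (simp add: probing_cost_def valid_def)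
  then have "outlier_opt I \<in> outlier_value I ` ?F"
    unfolding outlier_opt_def by (intro Min_in) auto
  then show thesis using that by blast
qed

lemma outlier_algorithm_1656: "outlier_algorithm 1656 outlier_set"
  unfolding outlier_algorithm_def
proof
  have unseen: "unseen I \<in> D0" if "I \<in> inputs" for I
    using that by (simp add: unseen_def observations_def)
  \<comment> \<open>\<open>VNum 0\<close> is the encoding of the empty list of observed
    sizes.\<close>
  have "polytime_on inputs enc_sched (\<lambda>I. VPair (enc_sched I) (VNum 0))"
    by (intro polytime_pair polytime_input polytime_const)
  then have c: "ctx inputs enc_sched unseen"
    unfolding ctx_def using unseen
    by (simp add: unseen_def enc_obs_def enc_observed_def enc_list_Nil)
  have cost: "0 \<le> job_cost I i" if "I \<in> inputs" "i < length (jobs I)" for I i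
    using valid_job(1) that by (simp add: inputs_def)
  have bud: "0 \<le> budget I" if "I \<in> inputs" for I using that by (simp add: inputs_def valid_def)
  \<comment> \<open>Probing nothing respects the budget, so \<open>S = {}\<close> is a competitor
    that guarantees an affordable scale.\<close>
  have ex: "\<exists>s<num_scales (unseen I). affordablex (unseen I) s" if I: "I \<in> inputs" for I
    by (rule machine_sizes.kept_correct(4)[OF observationsD(6)[OF unseen[OF I]], where S = "{}"])
      (use cost[OF I] bud[OF I] in \<open>auto simp: unseen_def\<close>)
  have "pbool (SIGMA I:inputs. {..<num_scales (unseen I)}) (ext enc_sched) (\<lambda>p. affordablex (unseen (fst p)) (snd p))"
    by (intro pbool_affordable ctx_weaken[OF c] pnat_index)
  then have b: "pnat inputs enc_sched (\<lambda>I. machine_sizes.best_scale (lawx (unseen I)) (num_jobs (unseen I)) (affordablex (unseen I)))"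
    by (rule pnat_best_scale[OF c, where F = "\<lambda>I. affordablex (unseen I)"]) (rule ex)
  let ?P = "\<lambda>I i. i \<notin> keptx (unseen I)
     (machine_sizes.best_scale (lawx (unseen I)) (num_jobs (unseen I)) (affordablex (unseen I)))"
  have "pbool (SIGMA I:inputs. {..<num_jobs (unseen I)}) (ext enc_sched) (\<lambda>p. ?P (fst p) (snd p))"
    by (intro pbool_not pbool_kept job_ctx_index[OF c] polytime_weaken[OF b])
  from polytime_comprehension[OF ctx_num_jobs[OF c] this pnat_index]
  have "polytime_on inputs enc_sched (\<lambda>I. enc_list VNum (filter (?P I) [0..<num_jobs (unseen I)]))" .
  then show "polytime_on inputs enc_sched (\<lambda>I. enc_set (outlier_set I))"
  proof (rule polytime_cong)
    fix I
    define l where "l = filter (?P I) [0..<num_jobs (unseen I)]"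
    have "outlier_set I = set l"
      by (auto simp: outlier_set_def unseen_def l_def)
    moreover have "sorted l" "distinct l" unfolding l_def by (simp_all add: sorted_wrt_filter)
    ultimately have "sorted_list_of_set (outlier_set I) = filter (?P I) [0..<num_jobs (unseen I)]"
      unfolding l_def[symmetric]
      by (simp only: sorted_list_of_set_sort_remdups distinct_remdups_id sorted_sort_id)
    then show "enc_list VNum (filter (?P I) [0..<num_jobs (unseen I)]) = enc_set (outlier_set I)"
      by (simp add: enc_set_def)
  qed
  show "\<forall>I\<in>inputs. outlier_set I \<subseteq> job_set I \<and> probing_cost I (outlier_set I) \<le> budget I \<and>
       outlier_value I (outlier_set I) \<le> 1656 * outlier_opt I"
  proof
    fix I assume I: "I \<in> inputs"
    then have val: "valid I" by (simp add: inputs_def)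
    obtain S where S: "S \<subseteq> job_set I" "probing_cost I S \<le> budget I" "outlier_opt I = outlier_value I S"
      using outlier_opt_attained[OF val] .
    interpret machine_sizes "law I {} (\<lambda>_. 0)" I using observationsD(6)[OF unseen[OF I]] by (simp add: unseen_def)
    let ?R = "kept (job_cost I) (budget I) (length (jobs I))
      (best_scale (length (jobs I)) (affordable (job_cost I) (budget I) (length (jobs I))))"
    note corr = kept_correct[where c = "job_cost I" and C = "budget I" and n = "length (jobs I)" and S = S,
      OF cost[OF I] S(1) S(2)[unfolded probing_cost_def]]
    have eq: "outlier_set I = job_set I - ?R" by (auto simp: outlier_set_def unseen_def)
    have "job_set I - outlier_set I = ?R" unfolding eq using corr(1) by blast
    then have "outlier_value I (outlier_set I) \<le> 1656 * outlier_opt I"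
      unfolding S(3) outlier_value_law[OF val, of _ "\<lambda>_. 0"] using corr(3) by simp
    then show "outlier_set I \<subseteq> job_set I \<and> probing_cost I (outlier_set I) \<le> budget I \<and>
       outlier_value I (outlier_set I) \<le> 1656 * outlier_opt I"
      using corr(2) unfolding probing_cost_def eq by auto
  qed
qed

section \<open>Property (P2) and adaptive policies\<close>

lemma machine_sizes_unseen: "valid I \<Longrightarrow> machine_sizes (law I {} (\<lambda>_. 0)) I"
  by (rule machine_sizes_law) auto

lemma finite_sizes:
  assumes "valid I" "A \<subseteq> job_set I"
  shows "finite (set_pmf (sizes I A))"
proof -
  interpret machine_sizes "law I {} (\<lambda>_. 0)" I by (rule machine_sizes_unseen[OF assms(1)])
  show ?thesis unfolding sizes_eq_law[OF assms(2) Int_empty_left, where v = "\<lambda>_. 0"]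
    by (rule finite_P[OF finite_subset[OF assms(2)]]) simp
qed

lemma sizes_nonneg:
  assumes "valid I" "A \<subseteq> job_set I" "w \<in> set_pmf (sizes I A)"
  shows "0 \<le> w i"
proof -
  interpret machine_sizes "law I {} (\<lambda>_. 0)" I by (rule machine_sizes_unseen[OF assms(1)])
  show ?thesis using assms(3) finite_subset[OF assms(2)]
    unfolding sizes_eq_law[OF assms(2) Int_empty_left, where v = "\<lambda>_. 0"] by (intro P_nonneg) auto
qed

lemma E_sizes_marginal:
  fixes f :: "(nat \<Rightarrow> real) \<Rightarrow> real"
  assumes "valid I" "A \<subseteq> job_set I" and f: "\<And>v w. (\<And>i. i \<in> A \<Longrightarrow> v i = w i) \<Longrightarrow> f v = f w"
  shows "expect (sizes I (job_set I)) f = expect (sizes I A) f"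
proof -
  interpret machine_sizes "law I {} (\<lambda>_. 0)" I by (rule machine_sizes_unseen[OF assms(1)])
  have eq: "sizes I (job_set I) = P (job_set I)" "sizes I A = P A"
    by (intro sizes_eq_law assms(2) order.refl Int_empty_left)+
  show ?thesis unfolding eq by (rule E_marginal[OF _ assms(2) f]) auto
qed

definition min_makespan :: "sched \<Rightarrow> (nat \<Rightarrow> real) \<Rightarrow> real" where
  "min_makespan I v = (MIN a\<in>assignments I (job_set I). makespan I (job_set I) a v)"

lemma Min_assignments_le:
  fixes f :: "(nat \<Rightarrow> nat) \<Rightarrow> real"
  shows "finite A \<Longrightarrow> a \<in> assignments I A \<Longrightarrow> (MIN a\<in>assignments I A. f a) \<le> f a"
  by (intro Min_le) (auto intro: finite_assignments)

lemma le_Min_assignments: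
  fixes f :: "(nat \<Rightarrow> nat) \<Rightarrow> real"
  assumes "valid I" "finite A" "\<And>a. a \<in> assignments I A \<Longrightarrow> c \<le> f a"
  shows "c \<le> (MIN a\<in>assignments I A. f a)"
proof -
  have "0 < machines I" using assms(1) by (simp add: valid_def)
  from assignments_nonempty[OF this, of A] show ?thesis
    using assms by (subst Min_ge_iff) (auto intro: finite_assignments)
qed

lemma Min_assignments_attained:
  fixes f :: "(nat \<Rightarrow> nat) \<Rightarrow> real"
  assumes "valid I" "finite A"
  obtains a where "a \<in> assignments I A" "(MIN a\<in>assignments I A. f a) = f a"
proof -
  have "0 < machines I" using assms(1) by (simp add: valid_def)
  from assignments_nonempty[OF this, of A]
  have "(MIN a\<in>assignments I A. f a) \<in> f ` assignments I A"
    using assms by (intro Min_in) (auto intro: finite_assignments)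
  then show thesis using that by blast
qed

lemma makespan_ge_0: "valid I \<Longrightarrow> (\<And>i. i \<in> A \<Longrightarrow> 0 \<le> v i) \<Longrightarrow> 0 \<le> makespan I A a v"
  using machine_sizes.makespan_nonneg[OF machine_sizes_unseen] by blast

lemma min_makespan_nonneg: "valid I \<Longrightarrow> (\<And>i. i \<in> job_set I \<Longrightarrow> 0 \<le> v i) \<Longrightarrow> 0 \<le> min_makespan I v"
  unfolding min_makespan_def by (intro le_Min_assignments makespan_ge_0) auto

lemma makespan_mono_set:
  assumes "valid I" "A \<subseteq> job_set I" "\<And>i. i \<in> job_set I \<Longrightarrow> 0 \<le> v i"
  shows "makespan I A a v \<le> makespan I (job_set I) a v"
proof -
  interpret machine_sizes "law I {} (\<lambda>_. 0)" I by (rule machine_sizes_unseen[OF assms(1)])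
  show ?thesis
  proof (rule makespan_le)
    fix k assume "k < m"
    have "(\<Sum>i\<in>{i \<in> A. a i = k}. v i) \<le> (\<Sum>i\<in>{i \<in> job_set I. a i = k}. v i)"
      using assms(2,3) by (intro sum_mono2) auto
    also have "\<dots> \<le> makespan I (job_set I) a v" using \<open>k < m\<close> by (rule load_le_makespan)
    finally show "(\<Sum>i\<in>{i \<in> A. a i = k}. v i) \<le> makespan I (job_set I) a v" .
  qed
qed

lemma restrict_assignment: "a \<in> assignments I (job_set I) \<Longrightarrow> A \<subseteq> job_set I \<Longrightarrow> restrict a A \<in> assignments I A"
  by (auto simp: assignments_def)

lemma outlier_value_nonneg: "valid I \<Longrightarrow> 0 \<le> outlier_value I S"
  using machine_sizes.opt_nonneg[OF machine_sizes_unseen]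
  by (subst outlier_value_law[where v = "\<lambda>_. 0"]) auto

lemma best_value_nonneg:
  assumes "valid I" "S \<subseteq> job_set I" "\<And>i. i \<in> S \<Longrightarrow> 0 \<le> v i"
  shows "0 \<le> best_value I S v"
  using machine_sizes.opt_nonneg[OF machine_sizes_law, of I S v "job_set I"] assms
  by (subst best_value_law) auto

theorem P2_one:
  assumes "valid I"
  shows "P2 I 1"
  unfolding P2_def
proof (intro allI impI)
  fix A and v :: "nat \<Rightarrow> real" assume A: "A \<subseteq> job_set I" and v: "\<forall>i\<in>A. 0 \<le> v i"
  interpret machine_sizes "law I {} (\<lambda>_. 0)" I by (rule machine_sizes_unseen[OF assms])
  let ?U = "job_set I - A"
  have fA: "finite A" using A finite_subset by blast
  note fin = finite_sizes[OF assms, of ?U, OF Diff_subset]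
  obtain a where a: "a \<in> assignments I A" "(MIN a\<in>assignments I A. makespan I A a v) = makespan I A a v"
    using Min_assignments_attained[OF assms fA] .
  obtain b where b: "b \<in> assignments I ?U"
    "outlier_value I A = expect (sizes I ?U) (makespan I ?U b)"
    unfolding outlier_value_def using Min_assignments_attained[OF assms, of ?U] by auto
  define c where "c = restrict (\<lambda>i. if i \<in> A then a i else b i) (job_set I)"
  have c: "c \<in> assignments I (job_set I)"
    using a(1) b(1) unfolding c_def assignments_def by (auto simp: PiE_iff)
  have "best_value I A v \<le> expected_makespan I A v c"
    unfolding best_value_def by (rule Min_assignments_le[OF _ c]) simp
  also have "\<dots> \<le> expect (sizes I ?U) (\<lambda>w. makespan I A a v + makespan I ?U b w)"
    unfolding expected_makespan_def
  proof (intro E_mono fin makespan_le)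
    fix w k assume k: "k < m"
    have "{i \<in> job_set I. c i = k} = {i \<in> A. a i = k} \<union> {i \<in> ?U. b i = k}"
      using A by (auto simp: c_def)
    then have "(\<Sum>i\<in>{i \<in> job_set I. c i = k}. override_on w v A i) =
        (\<Sum>i\<in>{i \<in> A. a i = k}. override_on w v A i) + (\<Sum>i\<in>{i \<in> ?U. b i = k}. override_on w v A i)"
      using fA by (simp only:) (intro sum.union_disjoint, auto)
    also have "(\<Sum>i\<in>{i \<in> A. a i = k}. override_on w v A i) = (\<Sum>i\<in>{i \<in> A. a i = k}. v i)"
      by (intro sum.cong) auto
    also have "(\<Sum>i\<in>{i \<in> ?U. b i = k}. override_on w v A i) = (\<Sum>i\<in>{i \<in> ?U. b i = k}. w i)"
      by (intro sum.cong) auto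
    also have "(\<Sum>i\<in>{i \<in> A. a i = k}. v i) + (\<Sum>i\<in>{i \<in> ?U. b i = k}. w i) \<le> makespan I A a v + makespan I ?U b w"
      by (intro add_mono load_le_makespan k)
    finally show "(\<Sum>i\<in>{i \<in> job_set I. c i = k}. override_on w v A i) \<le> makespan I A a v + makespan I ?U b w" .
  qed
  also have "\<dots> = makespan I A a v + outlier_value I A"
    unfolding b(2) by (subst E_add[OF fin]) simp
  also have "0 \<le> expect (sizes I ?U)
       (\<lambda>w. MIN a\<in>assignments I (job_set I). makespan I (job_set I) a (override_on w v A))"
  proof (rule E_nonneg)
    fix w assume "w \<in> set_pmf (sizes I ?U)"
    then have "0 \<le> override_on w v A i" for i
      using sizes_nonneg[OF assms, of ?U w i] v by (cases "i \<in> A") auto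
    then show "0 \<le> (MIN a\<in>assignments I (job_set I). makespan I (job_set I) a (override_on w v A))"
      by (intro min_makespan_nonneg[unfolded min_makespan_def] assms)
  qed
  then have "makespan I A a v + outlier_value I A \<le> 1 * ((MIN a\<in>assignments I A. makespan I A a v)
         + outlier_value I A + expect (sizes I ?U)
             (\<lambda>w. MIN a\<in>assignments I (job_set I). makespan I (job_set I) a (override_on w v A)))"
    unfolding a(2) by simp
  finally show "best_value I A v \<le> 1 * ((MIN a\<in>assignments I A. makespan I A a v)
         + outlier_value I A + expect (sizes I ?U)
             (\<lambda>w. MIN a\<in>assignments I (job_set I). makespan I (job_set I) a (override_on w v A)))" .
qed

text \<open>Redrawing the sizes that the policy has not probed does not change the law of the sizes:
  conditioning on the first probed size leaves a product law.\<close>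

lemma adaptive_law:
  fixes Q :: "nat \<Rightarrow> real pmf"
  assumes N: "finite N"
  shows "bind_pmf (Pi_pmf N 0 Q) (\<lambda>v. map_pmf (\<lambda>w. override_on w v (probed T v)) (Pi_pmf N 0 Q)) = Pi_pmf N 0 Q"
proof (induction T arbitrary: Q)
  case Stop
  have "(\<lambda>w. override_on w v (probed Stop v)) = (\<lambda>w. w)" for v :: "nat \<Rightarrow> real" by simp
  then show ?case by simp
next
  case (Probe i T)
  show ?case
  proof (cases "i \<in> N")
    case True
    define N' where "N' = N - {i}"
    have N': "N = insert i N'" "i \<notin> N'" "finite N'" using True N by (auto simp: N'_def)
    \<comment> \<open>The law of the sizes once job \<open>i\<close> has revealed \<open>a\<close>.
      It is again a product, so the induction hypothesis, general in \<open>Q\<close>, applies to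
      the subtree \<open>T a\<close>.\<close>
    define Q' where "Q' a = Q(i := return_pmf a)" for a
    have Pi': "Pi_pmf N 0 (Q' a) = map_pmf (\<lambda>f. f(i := a)) (Pi_pmf N' 0 Q)" for a
    proof -
      have "Pi_pmf N' 0 (Q' a) = Pi_pmf N' 0 Q" by (intro Pi_pmf_cong) (use N'(2) in \<open>auto simp: Q'_def\<close>)
      then show ?thesis unfolding N'(1) Pi_pmf_insert'[OF N'(3,2)]
        by (simp add: Q'_def bind_return_pmf map_pmf_def)
    qed
    have decomp: "Pi_pmf N 0 Q = bind_pmf (Q i) (\<lambda>a. Pi_pmf N 0 (Q' a))"
      unfolding Pi' unfolding N'(1) Pi_pmf_insert'[OF N'(3,2)] by (simp add: map_pmf_def)
    have "bind_pmf (Pi_pmf N 0 Q) (\<lambda>v. map_pmf (\<lambda>w. override_on w v (probed (Probe i T) v)) (Pi_pmf N 0 Q)) =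
        bind_pmf (Q i) (\<lambda>a. bind_pmf (Pi_pmf N 0 (Q' a))
          (\<lambda>v. map_pmf (\<lambda>w. override_on w v (probed (Probe i T) v)) (Pi_pmf N 0 Q)))"
      by (subst (1) decomp) (simp add: bind_assoc_pmf)
    also have "\<dots> = bind_pmf (Q i) (\<lambda>a. bind_pmf (Pi_pmf N 0 (Q' a))
          (\<lambda>v. map_pmf (\<lambda>w. override_on w v (probed (T a) v)) (Pi_pmf N 0 (Q' a))))"
    proof (intro bind_pmf_cong refl)
      fix a v assume "v \<in> set_pmf (Pi_pmf N 0 (Q' a))"
      then have va: "v i = a" unfolding Pi' by auto
      \<comment> \<open>Coordinate \<open>i\<close> is \<open>a\<close> on both sides: on the left
        it is overridden by \<open>v i = a\<close>, on the right it has been set to \<open>a\<close>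
        beforehand.\<close>
      have ov: "(\<lambda>f. override_on (f(i := b)) v (insert i (probed (T a) v))) =
          (\<lambda>f. override_on (f(i := a)) v (probed (T a) v))" for b
        using va by (auto simp: override_on_def fun_eq_iff)
      have "map_pmf (\<lambda>w. override_on w v (probed (Probe i T) v)) (Pi_pmf N 0 Q) =
          bind_pmf (Q i) (\<lambda>b. map_pmf (\<lambda>f. override_on (f(i := b)) v (insert i (probed (T a) v))) (Pi_pmf N' 0 Q))"
        unfolding decomp Pi' by (simp add: map_bind_pmf pmf.map_comp o_def va)
      also have "\<dots> = map_pmf (\<lambda>f. override_on (f(i := a)) v (probed (T a) v)) (Pi_pmf N' 0 Q)"
        unfolding ov by simp
      finally show "map_pmf (\<lambda>w. override_on w v (probed (Probe i T) v)) (Pi_pmf N 0 Q) =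
          map_pmf (\<lambda>w. override_on w v (probed (T a) v)) (Pi_pmf N 0 (Q' a))"
        unfolding Pi' by (simp add: pmf.map_comp o_def)
    qed
    also have "\<dots> = bind_pmf (Q i) (\<lambda>a. Pi_pmf N 0 (Q' a))"
      by (intro bind_pmf_cong refl Probe.IH) simp
    finally show ?thesis unfolding decomp[symmetric] .
  next
    case False
    \<comment> \<open>Outside \<open>N\<close> the default size 0 is certain, so probing such a job
      always leads to the subtree \<open>T 0\<close>.\<close>
    have zero: "v i = 0" if "v \<in> set_pmf (Pi_pmf N 0 Q)" for v
      using that set_Pi_pmf_subset[OF N, of 0 Q] False by blast
    have "bind_pmf (Pi_pmf N 0 Q) (\<lambda>v. map_pmf (\<lambda>w. override_on w v (probed (Probe i T) v)) (Pi_pmf N 0 Q)) =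
        bind_pmf (Pi_pmf N 0 Q) (\<lambda>v. map_pmf (\<lambda>w. override_on w v (probed (T 0) v)) (Pi_pmf N 0 Q))"
    proof (intro bind_pmf_cong map_pmf_cong refl)
      fix v w assume "v \<in> set_pmf (Pi_pmf N 0 Q)" "w \<in> set_pmf (Pi_pmf N 0 Q)"
      then show "override_on w v (probed (Probe i T) v) = override_on w v (probed (T 0) v)"
        using zero[of v] zero[of w] by (auto simp: override_on_def fun_eq_iff)
    qed
    also have "\<dots> = Pi_pmf N 0 Q" by (rule Probe.IH) simp
    finally show ?thesis .
  qed
qed

section \<open>Lower bounds on the optimal policy\<close>

context
  fixes I :: sched
  assumes valid: "valid I"
begin

abbreviation all_sizes :: "(nat \<Rightarrow> real) pmf" where
  "all_sizes \<equiv> sizes I (job_set I)"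

lemmas finite_all = finite_sizes[OF valid order.refl]
lemmas nonneg_all = sizes_nonneg[OF valid order.refl]

lemma E_min_makespan_le_policy_value:
  assumes T: "T \<in> policies I"
  shows "expect all_sizes (min_makespan I) \<le> policy_value I T"
proof -
  have "expect all_sizes (min_makespan I) =
      expect (bind_pmf all_sizes (\<lambda>v. map_pmf (\<lambda>w. override_on w v (probed T v)) all_sizes)) (min_makespan I)"
    unfolding sizes_def by (subst adaptive_law) auto
  also have "\<dots> = expect all_sizes
      (\<lambda>v. expect all_sizes (\<lambda>w. min_makespan I (override_on w v (probed T v))))"
    by (subst E_bind) (use finite_all in auto)
  also have "\<dots> \<le> expect all_sizes (\<lambda>v. best_value I (probed T v) v)"
  proof (intro E_mono finite_all)
    fix v assume v: "v \<in> set_pmf all_sizes"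
    let ?S = "probed T v"
    have S: "?S \<subseteq> job_set I" using T v by (auto simp: policies_def)
    show "expect all_sizes (\<lambda>w. min_makespan I (override_on w v ?S)) \<le> best_value I ?S v"
      unfolding best_value_def
    proof (intro le_Min_assignments[OF valid])
      fix a assume a: "a \<in> assignments I (job_set I)"
      have "expect all_sizes (\<lambda>w. min_makespan I (override_on w v ?S)) \<le>
          expect all_sizes (\<lambda>w. makespan I (job_set I) a (override_on w v ?S))"
        unfolding min_makespan_def by (intro E_mono finite_all Min_assignments_le a) auto
      \<comment> \<open>Redrawing all sizes or only the unprobed ones makes no difference, because
        the probed coordinates are overridden by \<open>v\<close>.\<close>
      also have "\<dots> = expected_makespan I ?S v a"
        unfolding expected_makespan_def
      proof (rule E_sizes_marginal[OF valid Diff_subset])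
        fix w w' :: "nat \<Rightarrow> real" assume "\<And>i. i \<in> job_set I - ?S \<Longrightarrow> w i = w' i"
        then show "makespan I (job_set I) a (override_on w v ?S) = makespan I (job_set I) a (override_on w' v ?S)"
          by (intro makespan_cong) (auto simp: override_on_def)
      qed
      finally show "expect all_sizes (\<lambda>w. min_makespan I (override_on w v ?S)) \<le> expected_makespan I ?S v a" .
    qed simp
  qed
  finally show ?thesis unfolding policy_value_def .
qed

text \<open>Deleting the probed jobs from an assignment can only lower the makespan, since observed
  sizes are nonnegative.\<close>

lemma outlier_value_le_best_value:
  assumes S: "S \<subseteq> job_set I" and v: "\<And>i. i \<in> S \<Longrightarrow> 0 \<le> v i"
  shows "outlier_value I S \<le> best_value I S v"
  unfolding best_value_def
proof (intro le_Min_assignments[OF valid])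
  fix a assume a: "a \<in> assignments I (job_set I)"
  let ?U = "job_set I - S"
  have "outlier_value I S \<le> expect (sizes I ?U) (makespan I ?U (restrict a ?U))"
    unfolding outlier_value_def by (intro Min_assignments_le restrict_assignment a) auto
  also have "\<dots> \<le> expected_makespan I S v a"
    unfolding expected_makespan_def
  proof (intro E_mono finite_sizes[OF valid Diff_subset])
    fix w assume w: "w \<in> set_pmf (sizes I ?U)"
    have "makespan I ?U (restrict a ?U) w = makespan I ?U a (override_on w v S)"
      by (intro makespan_cong) auto
    also have "\<dots> \<le> makespan I (job_set I) a (override_on w v S)"
      using sizes_nonneg[OF valid Diff_subset w] v
      by (intro makespan_mono_set valid) (auto simp: override_on_def)
    finally show "makespan I ?U (restrict a ?U) w \<le> makespan I (job_set I) a (override_on w v S)" .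
  qed
  finally show "outlier_value I S \<le> expected_makespan I S v a" .
qed simp

text \<open>The budget holds path by path, so every set probed in some realisation competes in the
  outlier problem.\<close>

lemma outlier_opt_le_policy_value:
  assumes T: "T \<in> policies I"
  shows "outlier_opt I \<le> policy_value I T"
proof -
  have "expect all_sizes (\<lambda>_. outlier_opt I) \<le> policy_value I T"
    unfolding policy_value_def
  proof (intro E_mono finite_all)
    fix v assume v: "v \<in> set_pmf all_sizes"
    let ?S = "probed T v"
    have S: "?S \<subseteq> job_set I" "probing_cost I ?S \<le> budget I" using T v by (auto simp: policies_def)
    have "outlier_opt I \<le> outlier_value I ?S"
      unfolding outlier_opt_def using S by (intro Min_le) auto
    also have "\<dots> \<le> best_value I ?S v"
      by (intro outlier_value_le_best_value S nonneg_all[OF v])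
    finally show "outlier_opt I \<le> best_value I ?S v" .
  qed
  then show ?thesis by simp
qed

text \<open>\<open>Stop\<close> respects the budget, so the infimum ranges over a nonempty
  set.\<close>

lemma le_OPT:
  assumes "\<And>T. T \<in> policies I \<Longrightarrow> c \<le> policy_value I T"
  shows "c \<le> OPT I"
proof -
  have "Stop \<in> policies I" using valid by (simp add: policies_def probing_cost_def valid_def)
  then show ?thesis unfolding OPT_def using assms by (intro cINF_greatest) auto
qed

lemma E_override:
  fixes f :: "(nat \<Rightarrow> real) \<Rightarrow> real"
  assumes "S \<subseteq> job_set I"
  shows "expect (sizes I S)
      (\<lambda>v. expect (sizes I (job_set I - S)) (\<lambda>w. f (override_on w v S))) =
    expect all_sizes f"
proof -
  have "sizes I (S \<union> (job_set I - S)) = map_pmf (\<lambda>(v, w). override_on w v S)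
      (pair_pmf (sizes I S) (sizes I (job_set I - S)))"
    unfolding sizes_def using assms finite_subset[OF assms]
    by (subst Pi_pmf_union) (auto simp: override_on_def[abs_def] intro!: map_pmf_cong)
  moreover have "S \<union> (job_set I - S) = job_set I" using assms by blast
  ultimately show ?thesis
    using finite_sizes[OF valid assms] finite_sizes[OF valid Diff_subset]
    by (simp add: E_pair split_def)
qed

text \<open>(P2) with constant 1, averaged over the outcome of probing \<open>S\<close>. Both the
  minimal makespan of the probed jobs alone and the third summand average to at most the expected
  minimal makespan of all jobs, hence the factor 2.\<close>

lemma E_best_value_le:
  assumes S: "S \<subseteq> job_set I"
  shows "expect (sizes I S) (best_value I S) \<le>
    2 * expect all_sizes (min_makespan I) + outlier_value I S"
proof -
  let ?E = "expect (sizes I S)"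
  let ?M = "\<lambda>v. MIN a\<in>assignments I S. makespan I S a v"
  let ?R = "\<lambda>v. expect (sizes I (job_set I - S)) (\<lambda>w. min_makespan I (override_on w v S))"
  note finS = finite_sizes[OF valid S]
  have fS: "finite S" using S finite_subset by blast
  have "?E (best_value I S) \<le> ?E (\<lambda>v. ?M v + outlier_value I S + ?R v)"
  proof (intro E_mono finS)
    fix v assume "v \<in> set_pmf (sizes I S)"
    then show "best_value I S v \<le> ?M v + outlier_value I S + ?R v"
      using P2_one[OF valid] sizes_nonneg[OF valid S] S unfolding P2_def min_makespan_def by simp
  qed
  also have "\<dots> = ?E ?M + outlier_value I S + ?E ?R"
    by (simp add: E_add[OF finS])
  also have "?E ?R = expect all_sizes (min_makespan I)" by (rule E_override[OF S])
  also have "?E ?M = expect all_sizes ?M"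
  proof (rule E_sizes_marginal[OF valid S, symmetric])
    fix v w :: "nat \<Rightarrow> real" assume vw: "\<And>i. i \<in> S \<Longrightarrow> v i = w i"
    have "makespan I S a v = makespan I S a w" for a by (intro makespan_cong refl vw)
    then show "?M v = ?M w" by simp
  qed
  also have "\<dots> \<le> expect all_sizes (min_makespan I)"
  proof (intro E_mono finite_all)
    fix v assume v: "v \<in> set_pmf all_sizes"
    show "?M v \<le> min_makespan I v" unfolding min_makespan_def
    proof (intro le_Min_assignments[OF valid])
      fix a assume a: "a \<in> assignments I (job_set I)"
      have "?M v \<le> makespan I S (restrict a S) v"
        by (intro Min_assignments_le fS restrict_assignment a S)
      also have "\<dots> = makespan I S a v" by (intro makespan_cong) auto
      also have "\<dots> \<le> makespan I (job_set I) a v"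
        by (intro makespan_mono_set valid S nonneg_all[OF v])
      finally show "?M v \<le> makespan I (job_set I) a v" .
    qed simp
  qed
  finally show ?thesis by simp
qed

end

text \<open>In \<open>2 + max \<alpha> 0\<close>, the 2 comes from \<open>E_best_value_le\<close>
  and the rest from the outlier guarantee. \<open>\<alpha>\<close> and \<open>\<beta>\<close> are
  arbitrary reals, and the maxima with 0 make it legitimate to multiply inequalities by
  them.\<close>

theorem nonadaptive_bound:
  assumes f: "outlier_algorithm \<alpha> f" and g: "assignment_algorithm \<beta> g" and I: "I \<in> inputs"
  shows "probing_cost I (f I) \<le> budget I"
    "nonadaptive_value I (f I) (g I (f I)) \<le> max \<beta> 0 * (2 + max \<alpha> 0) * OPT I"
proof -
  have valid: "valid I" and rational: "rational I" using I by (auto simp: inputs_def)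
  let ?S = "f I"
  have S: "?S \<subseteq> job_set I" "probing_cost I ?S \<le> budget I" "outlier_value I ?S \<le> \<alpha> * outlier_opt I"
    using f I unfolding outlier_algorithm_def by blast+
  then show "probing_cost I ?S \<le> budget I" by blast
  let ?V = "expect (sizes I (job_set I)) (min_makespan I)"
  have fS: "finite ?S" using S(1) finite_subset by blast
  \<comment> \<open>The guarantee of \<open>g\<close> covers rational observations only; a size that
    can be drawn is an entry of the input lists and hence rational.\<close>
  have obs: "(I, ?S, v) \<in> observations" if v: "v \<in> set_pmf (sizes I ?S)" for v
  proof -
    have "v i \<in> \<rat>" if i: "i \<in> ?S" for i
    proof -
      have iI: "i \<in> job_set I" using i S(1) by blast
      have "v i \<in> set_pmf (job_size I i)"
        using v i fS unfolding sizes_def by (auto simp: set_Pi_pmf PiE_dflt_def)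
      then obtain p where "(v i, p) \<in> set (snd (jobs I ! i))"
        using set_job_size[OF valid iI] by blast
      then show ?thesis using rational_job(2)[OF rational] iI by blast
    qed
    then show ?thesis using I S(1) sizes_nonneg[OF valid S(1) v] by (simp add: observations_def)
  qed
  have "nonadaptive_value I ?S (g I ?S) \<le>
      expect (sizes I ?S) (\<lambda>v. max \<beta> 0 * best_value I ?S v)"
    unfolding nonadaptive_value_def
  proof (intro E_mono finite_sizes[OF valid S(1)])
    fix v assume v: "v \<in> set_pmf (sizes I ?S)"
    have "expected_makespan I ?S v (g I ?S v) \<le> \<beta> * best_value I ?S v"
      using g obs[OF v] unfolding assignment_algorithm_def by blast
    also have "\<dots> \<le> max \<beta> 0 * best_value I ?S v"
      by (intro mult_right_mono best_value_nonneg valid S(1) sizes_nonneg[OF valid S(1) v]) auto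
    finally show "expected_makespan I ?S v (g I ?S v) \<le> max \<beta> 0 * best_value I ?S v" .
  qed
  also have "\<dots> = max \<beta> 0 * expect (sizes I ?S) (best_value I ?S)" by simp
  also have "\<dots> \<le> max \<beta> 0 * ((2 + max \<alpha> 0) * OPT I)"
  proof (intro mult_left_mono)
    have V: "?V \<le> OPT I" by (intro le_OPT E_min_makespan_le_policy_value valid)
    obtain S' where "outlier_opt I = outlier_value I S'" using outlier_opt_attained[OF valid] .
    then have G0: "0 \<le> outlier_opt I" using outlier_value_nonneg[OF valid] by simp
    have "\<alpha> * outlier_opt I \<le> max \<alpha> 0 * outlier_opt I"
      using G0 by (intro mult_right_mono) auto
    also have "\<dots> \<le> max \<alpha> 0 * OPT I"
      by (intro mult_left_mono le_OPT outlier_opt_le_policy_value valid) auto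
    finally have "outlier_value I ?S \<le> max \<alpha> 0 * OPT I" using S(3) by linarith
    then show "expect (sizes I ?S) (best_value I ?S) \<le> (2 + max \<alpha> 0) * OPT I"
      using E_best_value_le[OF valid S(1)] V by (simp add: algebra_simps)
  qed auto
  finally show "nonadaptive_value I ?S (g I ?S) \<le> max \<beta> 0 * (2 + max \<alpha> 0) * OPT I"
    by (simp add: mult.assoc)
qed

text \<open>The witnesses are 1656 for both approximation factors and
  \<open>max \<beta> 0 * (2 + max \<alpha> 0)\<close> for \<open>\<gamma>\<close>.\<close>

theorem theorem4:
  shows "(\<forall>I. valid I \<longrightarrow> P2 I 1) \<and>
    (\<exists>\<alpha> f. outlier_algorithm \<alpha> f) \<and>
    (\<exists>\<beta> g. assignment_algorithm \<beta> g) \<and>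
    (\<forall>\<alpha> \<beta>. \<exists>\<gamma>. \<forall>f g. outlier_algorithm \<alpha> f \<longrightarrow> assignment_algorithm \<beta> g \<longrightarrow>
      (\<forall>I\<in>inputs. probing_cost I (f I) \<le> budget I \<and>
         nonadaptive_value I (f I) (g I (f I)) \<le> \<gamma> * OPT I))"
  using P2_one outlier_algorithm_1656 assignment_algorithm_1656 nonadaptive_bound by blast

end
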